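(* Let $x\in D_1^+$, $\nu\in\mathbb{C}$, $\mu\in\mathbb{C}\setminus\mathbb{Z}$ with $\nu+\mu\notin-\mathbb{N}$. Then $$\mathsf{Q}_\nu^\mu(x)=\frac{2^{\mu-1}\cos(\pi\mu)\Gamma(\mu)}{(1-x^2)^{\frac12\mu}}x^{\nu+\mu}{}_2F_1\!\left(\frac{-\nu-\mu}{2},\frac{-\nu-\mu+1}{2};1-\mu;\frac{x^2-1}{x^2}\right)+\frac{\Gamma(\nu+\mu+1)\Gamma(-\mu)}{2^{\mu+1}\Gamma(\nu-\mu+1)}(1-x^2)^{\frac12\mu}x^{\nu-\mu}{}_2F_1\!\left(\frac{\mu-\nu}{2},\frac{\mu-\nu+1}{2};1+\mu;\frac{x^2-1}{x^2}\right).$$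
   Context: $\mathbb{N}=\{1,2,3,\dots\}$, $-\mathbb{N}=\{-1,-2,\dots\}$. $D_1=\mathbb{C}\setminus((-\infty,-1]\cup[1,\infty))$, $D_1^+=D_1\cap\{x:\operatorname{Re}x>0\}$, $D_2=\mathbb{C}\setminus(-\infty,1]$. Complex powers are principal values. ${}_2F_1(a,b;c;w)$ is the Gauss hypergeometric function, principal branch on $\mathbb{C}\setminus[1,\infty)$ (the analytic continuation of $\sum_{n\ge0}\frac{(a)_n(b)_n}{(c)_n}\frac{w^n}{n!}$). $1/\Gamma$ is read as the entire function (zero at the poles of $\Gamma$), and a quotient ${}_2F_1(a,b;c;w)/\Gamma(c)$ with $c\in\{0,-1,-2,\dots\}$ is read as the regularized function (continuous in $c$). Associated Legendre function of the second kind: for $z\in D_2$, $\nu+\mu\in\mathbb{C}\setminus-\mathbb{N}$, $$Q_\nu^\mu(z)=\frac{\sqrt{\pi}\,e^{i\pi\mu}\Gamma(\nu+\mu+1)(z^2-1)^{\frac12\mu}}{2^{\nu+1}\Gamma(\nu+\frac32)z^{\nu+\mu+1}}\,{}_2F_1\!\left(\tfrac{\nu+\mu+2}{2},\tfrac{\nu+\mu+1}{2};\nu+\tfrac32;\tfrac1{z^2}\right),$$ where $(z^2-1)^\alpha:=(z+1)^\alpha(z-1)^\alpha$. Ferrers function of the second kind: for $x\in(-1,1)$, $$\mathsf{Q}_\nu^\mu(x)=\tfrac12\big[e^{-\frac12 i\pi\mu}\,e^{-i\pi\mu}Q_\nu^\mu(x+i0)+e^{\frac12 i\pi\mu}\,e^{-i\pi\mu}Q_\nu^\mu(x-i0)\big],$$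 where $x\pm i0$ denotes the limit from the upper/lower half-plane, and $\mathsf{Q}_\nu^\mu$ is extended analytically to $D_1$. *)

theory Defs
  imports "HOL-Complex_Analysis.Complex_Analysis"
begin

definition D1 :: "complex set" where
  "D1 = - complex_of_real ` ({..-1} \<union> {1..})"

definition D1_plus :: "complex set" where
  "D1_plus = D1 \<inter> {x. Re x > 0}"

text \<open>
  The sum of a power series on the unit disc, continued analytically to the plane cut along
  \<open>[1, \<infinity>)\<close>. The choice is immaterial at every point of the cut plane: the cut plane is
  connected, so any two such continuations agree there. On the cut itself the value is arbitrary.
\<close>

definition principal_branch :: "complex fps \<Rightarrow> complex \<Rightarrow> complex" where
  "principal_branch F = (SOME f. f holomorphic_on (- complex_of_real ` {1..}) \<and>
                                 (\<forall>w\<in>ball 0 1. f w = eval_fps F w))"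

text \<open>Only meaningful for \<open>c \<notin> \<int>\<^sub>\<le>\<^sub>0\<close>.\<close>

definition hyp2F1 :: "complex \<Rightarrow> complex \<Rightarrow> complex \<Rightarrow> complex \<Rightarrow> complex" where
  "hyp2F1 a b c = principal_branch (fps_hypergeo [a, b] [c] 1)"

text \<open>
  The regularized function, i.e. the quotient of \<open>hyp2F1 a b c\<close> by \<open>Gamma c\<close>, extended
  continuously in \<open>c\<close> to \<open>c \<in> \<int>\<^sub>\<le>\<^sub>0\<close>. As \<open>rGamma\<close> is the entire function \<open>1 / Gamma\<close>, the
  coefficients below are entire in \<open>c\<close>; the next lemma shows that for \<open>c \<notin> \<int>\<^sub>\<le>\<^sub>0\<close> the
  series is the quotient.
\<close>

definition fps_hyp2F1_reg :: "complex \<Rightarrow> complex \<Rightarrow> complex \<Rightarrow> complex fps" where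
  "fps_hyp2F1_reg a b c =
     Abs_fps (\<lambda>n. pochhammer a n * pochhammer b n * rGamma (c + of_nat n) / fact n)"

lemma fps_hyp2F1_reg_eq:
  assumes "c \<notin> \<int>\<^sub>\<le>\<^sub>0"
  shows "fps_hyp2F1_reg a b c = fps_const (1 / Gamma c) * fps_hypergeo [a, b] [c] 1"
proof (rule fps_ext)
  fix n
  have "pochhammer c n \<noteq> 0"
    using assms pochhammer_eq_0_imp_nonpos_Int by blast
  then have "rGamma (c + of_nat n) = 1 / Gamma c / pochhammer c n"
    using pochhammer_rGamma[of c n] by (simp add: rGamma_inverse_Gamma field_simps)
  then show "fps_hyp2F1_reg a b c $ n = (fps_const (1 / Gamma c) * fps_hypergeo [a, b] [c] 1) $ n"
    by (simp add: fps_hyp2F1_reg_def)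
qed

definition hyp2F1_reg :: "complex \<Rightarrow> complex \<Rightarrow> complex \<Rightarrow> complex \<Rightarrow> complex" where
  "hyp2F1_reg a b c = principal_branch (fps_hyp2F1_reg a b c)"

text \<open>
  The associated Legendre function of the second kind, for \<open>z \<notin> (-\<infinity>, 1]\<close> and \<open>\<nu> + \<mu>\<close> not a
  negative integer. The factor \<open>1 / Gamma (\<nu> + 3/2)\<close> is contained in the regularized
  hypergeometric function.
\<close>

definition Legendre_Q :: "complex \<Rightarrow> complex \<Rightarrow> complex \<Rightarrow> complex" where
  "Legendre_Q \<nu> \<mu> z =
     of_real (sqrt pi) * exp (\<i> * of_real pi * \<mu>) * Gamma (\<nu> + \<mu> + 1)
       * ((z + 1) powr (\<mu> / 2) * (z - 1) powr (\<mu> / 2))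
       / (2 powr (\<nu> + 1) * z powr (\<nu> + \<mu> + 1))
       * hyp2F1_reg ((\<nu> + \<mu> + 2) / 2) ((\<nu> + \<mu> + 1) / 2) (\<nu> + 3 / 2) (1 / z\<^sup>2)"

definition Ferrers_Q_real :: "complex \<Rightarrow> complex \<Rightarrow> real \<Rightarrow> complex" where
  "Ferrers_Q_real \<nu> \<mu> x = 1 / 2 *
     (exp (- (\<i> * of_real pi * \<mu> / 2)) * exp (- (\<i> * of_real pi * \<mu>))
        * Lim (at (of_real x) within {z. Im z > 0}) (Legendre_Q \<nu> \<mu>)
      + exp (\<i> * of_real pi * \<mu> / 2) * exp (- (\<i> * of_real pi * \<mu>))
        * Lim (at (of_real x) within {z. Im z < 0}) (Legendre_Q \<nu> \<mu>))"

text \<open>The analytic extension from \<open>(-1, 1)\<close> to \<open>D1\<close>; it is unique on \<open>D1\<close>.\<close>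

definition Ferrers_Q :: "complex \<Rightarrow> complex \<Rightarrow> complex \<Rightarrow> complex" where
  "Ferrers_Q \<nu> \<mu> = (SOME f. f holomorphic_on D1 \<and>
                            (\<forall>x\<in>{-1<..<1}. f (of_real x) = Ferrers_Q_real \<nu> \<mu> x))"

end

theory Submission
  imports Defs
begin

text \<open>
  Put \<open>w = 1 / z\<^sup>2\<close>. The hypergeometric function \<open>P\<close> in \<open>Legendre_Q\<close> has parameters \<open>\<alpha>\<close>,
  \<open>\<alpha> + 1 / 2\<close>, \<open>c\<close> with \<open>\<alpha> + (\<alpha> + 1 / 2) - c = \<mu>\<close>, and it is a combination \<open>A * \<phi>\<^sub>1 + B * \<phi>\<^sub>2\<close> of the two
  solutions of the hypergeometric equation with exponents \<open>0\<close> and \<open>- \<mu>\<close> at \<open>w = 1\<close>. For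
  \<open>z \<longlongrightarrow> x \<plusminus> \<i> 0\<close> the variable \<open>w\<close> approaches the cut, where \<open>\<phi>\<^sub>1\<close> is holomorphic and \<open>\<phi>\<^sub>2\<close> has the
  boundary values \<open>exp (\<mp> \<i> * pi * \<mu>)\<close> times a common function, so the average of the two limits
  produces the factor \<open>cos (pi * \<mu>)\<close> in front of \<open>B\<close>.

  The constant \<open>B\<close> is the leading coefficient of the singularity at \<open>w = 1\<close> and follows from the growth of
  the Taylor coefficients by an Abelian argument; \<open>A\<close> is obtained in the same way after Euler's
  transformation. Both are brought into the final form by the duplication formula.
\<close>

section \<open>The hypergeometric equation and its power series solutions\<close>

text \<open>Both \<open>principal_branch\<close> and \<open>Ferrers_Q\<close> are choices, so a
  continuation has to be constructed before their values can be discussed. For the hypergeometric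
  functions of the theorem this succeeds because the upper parameters differ by 1/2, which admits a
  quadratic transformation. For the Ferrers function the formula concerns only
  \<open>Re x > 0\<close>, yet a continuation to all of \<open>D1\<close> is required. On the
  imaginary axis \<open>w\<close> is negative or infinite, where the connection formula at
  \<open>w = 1\<close> has its cut; this is why solutions at infinity enter.

  The regularized function admits nonpositive integers \<open>\<nu> + 3 / 2\<close>. For these the
  recursion does not fix the series, so the connection coefficients are not read off at
  \<open>w = 0\<close> but from the behaviour at \<open>w = 1\<close>. That one solution is a
  combination of two others is deduced from constant Wronskians, without existence theory for
  differential equations.\<close>

definition hyp_rec :: "complex \<Rightarrow> complex \<Rightarrow> complex \<Rightarrow> complex fps \<Rightarrow> bool" where
  "hyp_rec a b c F \<longleftrightarrow> (\<forall>n. (of_nat n + 1) * (of_nat n + c) * fps_nth F (Suc n)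
                            = (of_nat n + a) * (of_nat n + b) * fps_nth F n)"

text \<open>The value of the operator rather than a predicate: changes of variable become identities
  valid for every holomorphic \<open>f\<close>, not only for solutions.\<close>

definition hyp_ode :: "complex \<Rightarrow> complex \<Rightarrow> complex \<Rightarrow> (complex \<Rightarrow> complex) \<Rightarrow> complex \<Rightarrow> complex" where
  "hyp_ode a b c f z = z * (1 - z) * deriv (deriv f) z + (c - (a + b + 1) * z) * deriv f z - a * b * f z"

lemma of_nat_add_one_neq_0: "of_nat n + 1 \<noteq> (0 :: complex)"
  by (metis of_nat_Suc add.commute of_nat_eq_0_iff nat.distinct(1))

lemma hyp_ode_has_fps_expansion:
  assumes "f has_fps_expansion F"
  shows "hyp_ode a b c f has_fps_expansion
    fps_X * (1 - fps_X) * fps_deriv (fps_deriv F)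
      + (fps_const c - fps_const (a + b + 1) * fps_X) * fps_deriv F - fps_const (a * b) * F"
  unfolding hyp_ode_def [abs_def]
  by (intro fps_expansion_intros assms)

lemma hyp_rec_iff_fps_ode:
  "hyp_rec a b c F \<longleftrightarrow> fps_X * (1 - fps_X) * fps_deriv (fps_deriv F)
      + (fps_const c - fps_const (a + b + 1) * fps_X) * fps_deriv F - fps_const (a * b) * F = 0"
proof -
  have *: "fps_X * (1 - fps_X) * fps_deriv (fps_deriv F)
      + (fps_const c - fps_const (a + b + 1) * fps_X) * fps_deriv F - fps_const (a * b) * F
      = fps_X * fps_deriv (fps_deriv F) - fps_X * (fps_X * fps_deriv (fps_deriv F))
      + fps_const c * fps_deriv F - fps_const (a + b + 1) * (fps_X * fps_deriv F) - fps_const (a * b) * F"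
    by (simp add: algebra_simps)
  have "fps_nth (fps_X * (1 - fps_X) * fps_deriv (fps_deriv F)
      + (fps_const c - fps_const (a + b + 1) * fps_X) * fps_deriv F - fps_const (a * b) * F) n
     = (of_nat n + 1) * (of_nat n + c) * fps_nth F (Suc n) - (of_nat n + a) * (of_nat n + b) * fps_nth F n" for n
  proof -
    \<comment> \<open>The factors \<open>fps_X\<close> shift the index by up to two, so the
      coefficients 0 and 1 stand apart.\<close>
    consider "n = 0" | "n = 1" | m where "n = Suc (Suc m)" by (metis One_nat_def not0_implies_Suc)
    then show ?thesis
      unfolding * by cases (auto simp: algebra_simps)
  qed
  then show ?thesis unfolding hyp_rec_def fps_eq_iff by simp
qed

text \<open>The recursion makes the expansion of \<open>hyp_ode a b c f\<close> at 0 vanish, and the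
  identity theorem spreads this over \<open>S\<close>: a continuation of a solution is a
  solution.\<close>

lemma hyp_ode_of_rec:
  assumes "hyp_rec a b c F" "f has_fps_expansion F" "f holomorphic_on S" "open S" "connected S" "0 \<in> S" "z \<in> S"
  shows "hyp_ode a b c f z = 0"
proof (rule has_fps_expansion_0_analytic_continuation[of "hyp_ode a b c f" S])
  show "hyp_ode a b c f has_fps_expansion 0"
    using hyp_ode_has_fps_expansion[OF assms(2), of a b c] assms(1) by (simp add: hyp_rec_iff_fps_ode)
  show "hyp_ode a b c f holomorphic_on S"
    using assms(3,4) unfolding hyp_ode_def[abs_def] by (auto intro!: holomorphic_intros holomorphic_deriv)
qed (use assms in auto)

lemma hyp_rec_of_ode:
  assumes "f has_fps_expansion F" "eventually (\<lambda>z. hyp_ode a b c f z = 0) (nhds 0)"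
  shows "hyp_rec a b c F"
  using hyp_ode_has_fps_expansion[OF assms(1), of a b c] assms(2) 
  by (metis has_fps_expansion_0_iff fps_expansion_unique_complex hyp_rec_iff_fps_ode)

lemma hyp_rec_unique:
  assumes "hyp_rec a b c F" "hyp_rec a b c G" "c \<notin> \<int>\<^sub>\<le>\<^sub>0" "fps_nth F 0 = fps_nth G 0"
  shows "F = G"
proof (rule fps_ext)
  fix n show "fps_nth F n = fps_nth G n"
  proof (induction n)
    case (Suc n)
    have "of_nat n + c \<noteq> 0" using assms(3) 
      by (metis add.commute add_eq_0_iff minus_of_nat_in_nonpos_Ints)
    moreover have "of_nat n + 1 \<noteq> (0::complex)" by (rule of_nat_add_one_neq_0)
    moreover have "(of_nat n + 1) * (of_nat n + c) * fps_nth F (Suc n) = (of_nat n + 1) * (of_nat n + c) * fps_nth G (Suc n)"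
      using assms(1,2) Suc unfolding hyp_rec_def by simp
    ultimately show ?case by simp
  qed (use assms in simp)
qed

lemma hyp_rec_reg: "hyp_rec a b c (fps_hyp2F1_reg a b c)"
  unfolding hyp_rec_def
proof
  fix n
  have "rGamma (c + of_nat n) = (c + of_nat n) * rGamma (c + of_nat (Suc n))"
    using rGamma_plus1[of "c + of_nat n"] by (simp add: add_ac)
  moreover have "of_nat n + 1 \<noteq> (0::complex)" by (rule of_nat_add_one_neq_0)
  ultimately show "(of_nat n + 1) * (of_nat n + c) * fps_nth (fps_hyp2F1_reg a b c) (Suc n)
                            = (of_nat n + a) * (of_nat n + b) * fps_nth (fps_hyp2F1_reg a b c) n"
    by (simp add: fps_hyp2F1_reg_def pochhammer_Suc divide_simps add_ac)
qed

lemma hyp_rec_hypergeo: 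
  assumes "c \<notin> \<int>\<^sub>\<le>\<^sub>0" shows "hyp_rec a b c (fps_hypergeo [a, b] [c] 1)"
proof -
  have "of_nat n + c \<noteq> 0" for n using assms
      by (metis add.commute add_eq_0_iff minus_of_nat_in_nonpos_Ints)
  moreover have "of_nat n + 1 \<noteq> (0::complex)" for n by (rule of_nat_add_one_neq_0)
  ultimately show ?thesis unfolding hyp_rec_def by (auto simp: fps_hypergeo_rec divide_simps add_ac simp del: fps_hypergeo_nth)
qed

text \<open>Ratio test: quotients of consecutive coefficients tend to 1. Terminating series, to
  which the test does not apply, have infinite radius, hence the inequality.\<close>

lemma conv_radius_hyp_rec:
  assumes "hyp_rec a b c F" shows "fps_conv_radius F \<ge> 1"
proof -
  have p: "eventually (\<lambda>n. of_nat n + z \<noteq> (0::complex)) sequentially" for z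
  proof -
    obtain N where "real N > cmod z" using reals_Archimedean2 by blast
    then have "of_nat n + z \<noteq> 0" if "n \<ge> N" for n
    proof -
      have "cmod (of_nat n) > cmod z" using that \<open>real N > cmod z\<close> by simp
      then show ?thesis by (metis add_eq_0_iff norm_minus_cancel less_irrefl)
    qed
    then show ?thesis unfolding eventually_sequentially by blast
  qed
  show ?thesis
  proof (cases "eventually (\<lambda>n. fps_nth F n = 0) sequentially")
    case True
    then have "fps_conv_radius F = \<infinity>" unfolding fps_conv_radius_def
      using conv_radius_cong[of "fps_nth F" "\<lambda>_. 0 :: complex"] True by (auto elim: eventually_mono)
    then show ?thesis by simp
  next
    case False
    have nz: "eventually (\<lambda>n. fps_nth F n \<noteq> 0) sequentially"
    proof -
      obtain N where N: "\<And>n. n \<ge> N \<Longrightarrow> of_nat n + c \<noteq> 0"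
        using p[of c] unfolding eventually_sequentially by blast
      \<comment> \<open>Beyond the last zero of \<open>n + c\<close> one vanishing coefficient
        forces all later ones to vanish. A series that does not terminate therefore has no zero
        coefficient from \<open>N\<close> on.\<close>
      have z: "fps_nth F m = 0" if "fps_nth F n = 0" "n \<ge> N" "m \<ge> n" for m n
        using that(3)
      proof (induction m rule: dec_induct)
        case (step k)
        have "(of_nat k + 1) * (of_nat k + c) * fps_nth F (Suc k) = 0"
          using assms step unfolding hyp_rec_def by simp
        moreover have "of_nat k + 1 \<noteq> (0::complex)" by (rule of_nat_add_one_neq_0)
        ultimately show ?case using N[of k] that step by auto
      qed (use that in auto)
      show ?thesis unfolding eventually_sequentially
        using z False unfolding eventually_sequentially by blast
    qed
    have "(\<lambda>n. norm (fps_nth F n) / norm (fps_nth F (Suc n))) \<longlonglongrightarrow> 1"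
    proof (rule Lim_transform_eventually)
      have l: "(\<lambda>n. 1 + z * inverse (of_nat n)) \<longlonglongrightarrow> 1 + z * 0" for z :: complex
        by (intro tendsto_intros lim_inverse_n)
      have "(\<lambda>n. norm ((1 + 1 * inverse (of_nat n)) * (1 + c * inverse (of_nat n)) / ((1 + a * inverse (of_nat n)) * (1 + b * inverse (of_nat n)))))
            \<longlonglongrightarrow> norm ((1 + 1 * 0) * (1 + c * 0) / ((1 + a * 0) * (1 + b * 0)))"
        by (intro tendsto_norm tendsto_divide tendsto_mult l) auto
      then show "(\<lambda>n. norm ((1 + 1 * inverse (of_nat n)) * (1 + c * inverse (of_nat n)) / ((1 + a * inverse (of_nat n)) * (1 + b * inverse (of_nat n))))) \<longlonglongrightarrow> 1"
        by simp
      show "\<forall>\<^sub>F n in sequentially. norm ((1 + 1 * inverse (of_nat n)) * (1 + c * inverse (of_nat n)) / ((1 + a * inverse (of_nat n)) * (1 + b * inverse (of_nat n)))) 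
          = norm (fps_nth F n) / norm (fps_nth F (Suc n))"
        using p[of a] p[of b] p[of c] nz eventually_gt_at_top[of 0] eventually_compose_filterlim[OF nz filterlim_Suc]
      proof eventually_elim
        case (elim n)
        have "(of_nat n + 1) * (of_nat n + c) * fps_nth F (Suc n) = (of_nat n + a) * (of_nat n + b) * fps_nth F n"
          using assms unfolding hyp_rec_def by simp
        then have "fps_nth F n / fps_nth F (Suc n) = (of_nat n + 1) * (of_nat n + c) / ((of_nat n + a) * (of_nat n + b))"
          using elim by (subst frac_eq_eq) (simp_all add: mult.commute)
        also have "\<dots> = (1 + 1 * inverse (of_nat n)) * (1 + c * inverse (of_nat n)) / ((1 + a * inverse (of_nat n)) * (1 + b * inverse (of_nat n)))"
        proof -
          have e: "1 + z * inverse (of_nat n) = (of_nat n + z) / of_nat n" for z :: complex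
            using elim by (simp add: field_simps)
          show ?thesis unfolding e using elim by simp
        qed
        finally show ?case by (simp only: norm_divide[symmetric])
      qed
    qed
    then have "conv_radius (fps_nth F) = ereal 1"
      by (rule conv_radius_ratio_limit_nonzero[rotated 2]) (use nz in auto)
    then show ?thesis by (simp add: fps_conv_radius_def)
  qed
qed

lemma hyp_rec_expansion:
  assumes "hyp_rec a b c F" 
  shows "eval_fps F holomorphic_on ball 0 1" "eval_fps F has_fps_expansion F"
proof -
  have "ball 0 1 \<subseteq> eball (0::complex) (fps_conv_radius F)"
    using conv_radius_hyp_rec[OF assms] ball_eball_mono[of 1] by (simp add: one_ereal_def)
  then show "eval_fps F holomorphic_on ball 0 1" by (rule holomorphic_on_eval_fps)
  have "fps_conv_radius F > 0" using conv_radius_hyp_rec[OF assms] by (rule less_le_trans[rotated]) simp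
  then show "eval_fps F has_fps_expansion F" by (rule eval_fps_has_fps_expansion)
qed

section \<open>Changes of variable and the Wronskian\<close>

text \<open>The prefactor enters only through its logarithmic derivative \<open>r\<close>, so that
  \<open>g\<close> factors out of every derivative.\<close>

lemma deriv_gauge_compose:
  assumes S: "open S" and T: "open T" and f: "f holomorphic_on T" and mT: "\<And>z. z \<in> S \<Longrightarrow> m z \<in> T"
    and m: "\<And>z. z \<in> S \<Longrightarrow> (m has_field_derivative dm z) (at z)"
    and dm: "\<And>z. z \<in> S \<Longrightarrow> (dm has_field_derivative ddm z) (at z)"
    and g: "\<And>z. z \<in> S \<Longrightarrow> (g has_field_derivative g z * r z) (at z)"
    and r: "\<And>z. z \<in> S \<Longrightarrow> (r has_field_derivative dr z) (at z)"
    and z: "z \<in> S"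
  shows "deriv (\<lambda>z. g z * f (m z)) z = g z * (r z * f (m z) + dm z * deriv f (m z))"
    and "deriv (deriv (\<lambda>z. g z * f (m z))) z = g z * ((dr z + (r z)\<^sup>2) * f (m z)
           + (2 * r z * dm z + ddm z) * deriv f (m z) + (dm z)\<^sup>2 * deriv (deriv f) (m z))"
    and "(\<lambda>z. g z * f (m z)) holomorphic_on S"
proof -
  have df: "(f has_field_derivative deriv f (m z)) (at (m z))" if "z \<in> S" for z
    using holomorphic_derivI[OF f T] mT that by blast
  have ddf: "(deriv f has_field_derivative deriv (deriv f) (m z)) (at (m z))" if "z \<in> S" for z
    using holomorphic_derivI[OF holomorphic_deriv[OF f T] T] mT that by blast
  have fm: "((\<lambda>z. f (m z)) has_field_derivative deriv f (m z) * dm z) (at z)" if "z \<in> S" for z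
    using DERIV_chain2[OF df m] that by blast
  have dfm: "((\<lambda>z. deriv f (m z)) has_field_derivative deriv (deriv f) (m z) * dm z) (at z)" if "z \<in> S" for z
    using DERIV_chain2[OF ddf m] that by blast
  have D1: "((\<lambda>z. g z * f (m z)) has_field_derivative g z * (r z * f (m z) + dm z * deriv f (m z))) (at z)"
    if "z \<in> S" for z
    by (rule derivative_eq_intros fm g that refl)+ (simp add: algebra_simps)
  have 1: "deriv (\<lambda>z. g z * f (m z)) z = g z * (r z * f (m z) + dm z * deriv f (m z))" if "z \<in> S" for z
    using D1[OF that] by (rule DERIV_imp_deriv)
  from 1[OF z] show "deriv (\<lambda>z. g z * f (m z)) z = g z * (r z * f (m z) + dm z * deriv f (m z))" .
  have "((\<lambda>z. g z * (r z * f (m z) + dm z * deriv f (m z))) has_field_derivative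
    g z * ((dr z + (r z)\<^sup>2) * f (m z)
           + (2 * r z * dm z + ddm z) * deriv f (m z) + (dm z)\<^sup>2 * deriv (deriv f) (m z))) (at z)"
    by (rule derivative_eq_intros fm dfm g dm r z refl)+ (simp add: algebra_simps power2_eq_square)
  then have "deriv (\<lambda>z. g z * (r z * f (m z) + dm z * deriv f (m z))) z = 
    g z * ((dr z + (r z)\<^sup>2) * f (m z)
           + (2 * r z * dm z + ddm z) * deriv f (m z) + (dm z)\<^sup>2 * deriv (deriv f) (m z))"
    by (rule DERIV_imp_deriv)
  moreover have "eventually (\<lambda>y. y \<in> S) (nhds z)"
    using S z by (rule eventually_nhds_in_open)
  then have "eventually (\<lambda>z. deriv (\<lambda>z. g z * f (m z)) z = g z * (r z * f (m z) + dm z * deriv f (m z))) (nhds z)"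
    by eventually_elim (rule 1)
  then have "deriv (deriv (\<lambda>z. g z * f (m z))) z = deriv (\<lambda>z. g z * (r z * f (m z) + dm z * deriv f (m z))) z"
    by (intro deriv_cong_ev refl)
  ultimately show "deriv (deriv (\<lambda>z. g z * f (m z))) z = g z * ((dr z + (r z)\<^sup>2) * f (m z)
           + (2 * r z * dm z + ddm z) * deriv f (m z) + (dm z)\<^sup>2 * deriv (deriv f) (m z))"
    by simp
  show "(\<lambda>z. g z * f (m z)) holomorphic_on S"
    using D1 S by (auto simp: holomorphic_on_open)
qed

text \<open>The last three assumptions match the coefficients of the second derivative, the first
  derivative and \<open>f\<close> itself, up to a common factor \<open>l\<close>. Each classical
  transformation is thereby reduced to rational identities.\<close>

lemma hyp_ode_gauge_compose:
  assumes S: "open S" and T: "open T" and f: "f holomorphic_on T" and mT: "\<And>z. z \<in> S \<Longrightarrow> m z \<in> T"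
    and m: "\<And>z. z \<in> S \<Longrightarrow> (m has_field_derivative dm z) (at z)"
    and dm: "\<And>z. z \<in> S \<Longrightarrow> (dm has_field_derivative ddm z) (at z)"
    and g: "\<And>z. z \<in> S \<Longrightarrow> (g has_field_derivative g z * r z) (at z)"
    and r: "\<And>z. z \<in> S \<Longrightarrow> (r has_field_derivative dr z) (at z)"
    and z: "z \<in> S"
    and "z * (1 - z) * (dm z)\<^sup>2 = l * (m z * (1 - m z))"
    and "z * (1 - z) * (2 * r z * dm z + ddm z) + (c - (a + b + 1) * z) * dm z = l * (c' - (a' + b' + 1) * m z)"
    and "z * (1 - z) * (dr z + (r z)\<^sup>2) + (c - (a + b + 1) * z) * r z - a * b = - l * (a' * b')"
  shows "hyp_ode a b c (\<lambda>z. g z * f (m z)) z = g z * l * hyp_ode a' b' c' f (m z)"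
proof -
  have "hyp_ode a b c (\<lambda>z. g z * f (m z)) z = g z * (
      (z * (1 - z) * (dm z)\<^sup>2) * deriv (deriv f) (m z)
      + (z * (1 - z) * (2 * r z * dm z + ddm z) + (c - (a + b + 1) * z) * dm z) * deriv f (m z)
      + (z * (1 - z) * (dr z + (r z)\<^sup>2) + (c - (a + b + 1) * z) * r z - a * b) * f (m z))"
    unfolding hyp_ode_def
      deriv_gauge_compose(1)[where f = f, OF S T f mT m dm g r z, simplified]
      deriv_gauge_compose(2)[where f = f, OF S T f mT m dm g r z, simplified]
    by (simp add: algebra_simps)
  also have "\<dots> = g z * l * hyp_ode a' b' c' f (m z)"
    unfolding assms(10-12) hyp_ode_def by (simp add: algebra_simps)
  finally show ?thesis .
qed

lemma hyp_ode_reflect: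
  assumes "open T" "f holomorphic_on T" "1 - z \<in> T"
  shows "hyp_ode a b c (\<lambda>z. f (1 - z)) z = hyp_ode a b (a + b - c + 1) f (1 - z)"
proof -
  have "open ((\<lambda>z. 1 - z) -` T)"
    by (intro open_vimage assms continuous_intros)
  then have "hyp_ode a b c (\<lambda>z. 1 * f (1 - z)) z = 1 * 1 * hyp_ode a b (a + b - c + 1) f (1 - z)"
    by (rule hyp_ode_gauge_compose[where dm = "\<lambda>_. -1" and ddm = "\<lambda>_. 0" and r = "\<lambda>_. 0" and dr = "\<lambda>_. 0" and T = T and m = "\<lambda>z. 1 - z"])
       (use assms in \<open>auto intro!: derivative_eq_intros simp: algebra_simps\<close>)
  then show ?thesis by simp
qed

lemma hyp_ode_Euler:
  assumes "open T" "f holomorphic_on T" "z \<in> T" "1 - z \<notin> \<real>\<^sub>\<le>\<^sub>0"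
  shows "hyp_ode a b c (\<lambda>z. (1 - z) powr (c - a - b) * f z) z = (1 - z) powr (c - a - b) * hyp_ode (c - a) (c - b) c f z"
proof -
  have o: "open (T \<inter> (\<lambda>z. 1 - z) -` (- \<real>\<^sub>\<le>\<^sub>0))"
    by (intro open_Int open_vimage assms continuous_intros) auto
  have nz: "1 - w \<notin> \<real>\<^sub>\<le>\<^sub>0 \<Longrightarrow> w \<noteq> 1" for w :: complex by auto
  have "hyp_ode a b c (\<lambda>z. (1 - z) powr (c - a - b) * f z) z = (1 - z) powr (c - a - b) * 1 * hyp_ode (c - a) (c - b) c f z"
    using o by (rule hyp_ode_gauge_compose[where dm = "\<lambda>_. 1" and ddm = "\<lambda>_. 0" and r = "\<lambda>z. (a + b - c) / (1 - z)" 
       and dr = "\<lambda>z. (a + b - c) / (1 - z)\<^sup>2" and T = T and m = "\<lambda>z. z" and z = z])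
       (use assms nz in \<open>auto intro!: derivative_eq_intros simp: powr_diff divide_simps power2_eq_square, (simp_all add: algebra_simps)?\<close>)
  then show ?thesis by simp
qed

lemma hyp_ode_shift_exponent_0:
  assumes "open T" "f holomorphic_on T" "z \<in> T" "z \<notin> \<real>\<^sub>\<le>\<^sub>0"
  shows "hyp_ode a b c (\<lambda>z. z powr (1 - c) * f z) z = z powr (1 - c) * hyp_ode (a - c + 1) (b - c + 1) (2 - c) f z"
proof -
  have o: "open (T \<inter> (- \<real>\<^sub>\<le>\<^sub>0))"
    by (intro open_Int assms) auto
  have nz: "w \<notin> \<real>\<^sub>\<le>\<^sub>0 \<Longrightarrow> w \<noteq> 0" for w :: complex by auto
  have "hyp_ode a b c (\<lambda>z. z powr (1 - c) * f z) z = z powr (1 - c) * 1 * hyp_ode (a - c + 1) (b - c + 1) (2 - c) f z"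
    using o by (rule hyp_ode_gauge_compose[where dm = "\<lambda>_. 1" and ddm = "\<lambda>_. 0" and r = "\<lambda>z. (1 - c) / z" 
       and dr = "\<lambda>z. (c - 1) / z\<^sup>2" and T = T and m = "\<lambda>z. z" and z = z])
       (use assms nz in \<open>auto intro!: derivative_eq_intros simp: powr_diff divide_simps power2_eq_square, (simp_all add: algebra_simps)?\<close>)
  then show ?thesis by simp
qed

text \<open>The variable \<open>1 / (1 - z)\<close> sends infinity to 0, 1 to infinity and 0 to 1.
  It is suited to the principal branch because \<open>(1 - z) powr (- a)\<close> is cut along the
  same half-line from 1.\<close>

lemma hyp_ode_infinity:
  assumes "open T" "f holomorphic_on T" "1 / (1 - z) \<in> T" "1 - z \<notin> \<real>\<^sub>\<le>\<^sub>0"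
  shows "hyp_ode a b c (\<lambda>z. (1 - z) powr (- a) * f (1 / (1 - z))) z 
    = - ((1 - z) powr (- a)) / (1 - z) * hyp_ode a (c - b) (a - b + 1) f (1 / (1 - z))"
proof -
  have "open ((\<lambda>z. 1 - z) -` (- \<real>\<^sub>\<le>\<^sub>0) \<inter> (\<lambda>z. 1 / (1 - z)) -` T)"
    by (intro continuous_open_preimage open_vimage assms continuous_intros) auto
  then have "hyp_ode a b c (\<lambda>z. (1 - z) powr (- a) * f (1 / (1 - z))) z 
    = (1 - z) powr (- a) * (- 1 / (1 - z)) * hyp_ode a (c - b) (a - b + 1) f (1 / (1 - z))"
    by (rule hyp_ode_gauge_compose[where dm = "\<lambda>z. 1 / (1 - z)\<^sup>2" and ddm = "\<lambda>z. 2 / (1 - z) ^ 3" and r = "\<lambda>z. a / (1 - z)" 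
       and dr = "\<lambda>z. a / (1 - z)\<^sup>2" and T = T and m = "\<lambda>z. 1 / (1 - z)" and z = z])
       (use assms in \<open>auto intro!: derivative_eq_intros simp: powr_diff powr_minus divide_simps power2_eq_square power3_eq_cube, (simp_all add: algebra_simps)?\<close>)
  then show ?thesis by simp
qed

text \<open>Gauss's quadratic transformation
  \<open>F(2a, 2a-c+1; c; z) = (1+z)^(-2a) F(a, a+1/2; c; 4z/(1+z)^2)\<close> on the level of
  operators.\<close>

lemma hyp_ode_quadratic:
  assumes "open T" "f holomorphic_on T" "4 * z / (1 + z)\<^sup>2 \<in> T" "1 + z \<notin> \<real>\<^sub>\<le>\<^sub>0"
  shows "hyp_ode (2 * a) (2 * a - c + 1) c (\<lambda>z. (1 + z) powr (- 2 * a) * f (4 * z / (1 + z)\<^sup>2)) z 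
    = (1 + z) powr (- 2 * a) * (4 * (1 - z) / (1 + z)\<^sup>2) * hyp_ode a (a + 1 / 2) c f (4 * z / (1 + z)\<^sup>2)"
proof -
  have "open ((\<lambda>z. 1 + z) -` (- \<real>\<^sub>\<le>\<^sub>0) \<inter> (\<lambda>z. 4 * z / (1 + z)\<^sup>2) -` T)"
    by (intro continuous_open_preimage open_vimage assms continuous_intros) auto
  then show ?thesis
    by (rule hyp_ode_gauge_compose[where dm = "\<lambda>z. 4 * (1 - z) / (1 + z) ^ 3" and ddm = "\<lambda>z. (8 * z - 16) / (1 + z) ^ 4" and r = "\<lambda>z. - 2 * a / (1 + z)" 
       and dr = "\<lambda>z. 2 * a / (1 + z)\<^sup>2" and T = T and m = "\<lambda>z. 4 * z / (1 + z)\<^sup>2" and z = z])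
       (use assms in \<open>auto intro!: derivative_eq_intros simp: powr_diff powr_minus divide_simps power2_eq_square power3_eq_cube, (simp_all add: algebra_simps power2_eq_square power3_eq_cube power4_eq_xxxx)?\<close>)
qed

text \<open>Abel's identity, with \<open>\<omega>\<close> as integrating factor for the Wronskian.
  It is a parameter because each domain of application needs its own branch of
  \<open>z^c (1-z)^(a+b-c+1)\<close>, up to a constant.\<close>

lemma hyp_ode_Wronskian_const:
  assumes S: "open S" "connected S" "0 \<notin> S" "1 \<notin> S"
    and \<omega>: "\<And>z. z \<in> S \<Longrightarrow> (\<omega> has_field_derivative \<omega> z * (c - (a + b + 1) * z) / (z * (1 - z))) (at z)"
    and f: "f holomorphic_on S" "\<And>z. z \<in> S \<Longrightarrow> hyp_ode a b c f z = 0"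
    and g: "g holomorphic_on S" "\<And>z. z \<in> S \<Longrightarrow> hyp_ode a b c g z = 0"
  obtains K where "\<And>z. z \<in> S \<Longrightarrow> \<omega> z * (f z * deriv g z - deriv f z * g z) = K"
proof -
  have D: "((\<lambda>z. \<omega> z * (f z * deriv g z - deriv f z * g z)) has_field_derivative 0) (at z)" if z: "z \<in> S" for z
  proof -
    have nz: "z * (1 - z) \<noteq> 0" using S z by auto
    define p where "p = (c - (a + b + 1) * z) / (z * (1 - z))"
    define q where "q = a * b / (z * (1 - z))"
    have s: "deriv (deriv h) z = q * h z - p * deriv h z" if "hyp_ode a b c h z = 0" for h
    proof -
      have "z * (1 - z) * deriv (deriv h) z = a * b * h z - (c - (a + b + 1) * z) * deriv h z"
        using that unfolding hyp_ode_def by (simp add: algebra_simps)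
      then have "deriv (deriv h) z = (a * b * h z - (c - (a + b + 1) * z) * deriv h z) / (z * (1 - z))"
        using nz by (subst eq_divide_eq) (simp only: mult.commute if_True simp_thms not_False_eq_True)
      also have "\<dots> = q * h z - p * deriv h z"
        by (simp only: q_def p_def times_divide_eq_left diff_divide_distrib[of "a * b * h z" "(c - (a + b + 1) * z) * deriv h z"])
      finally show ?thesis .
    qed
    have d\<omega>: "(\<omega> has_field_derivative \<omega> z * p) (at z)"
      using \<omega>[OF z] by (simp add: p_def)
    have df: "(f has_field_derivative deriv f z) (at z)" and dg: "(g has_field_derivative deriv g z) (at z)"
      using holomorphic_derivI[OF f(1) S(1) z] holomorphic_derivI[OF g(1) S(1) z] by simp_all
    have ddf: "(deriv f has_field_derivative q * f z - p * deriv f z) (at z)"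
      using holomorphic_derivI[OF holomorphic_deriv[OF f(1) S(1)] S(1) z] s[OF f(2)[OF z]] by simp
    have ddg: "(deriv g has_field_derivative q * g z - p * deriv g z) (at z)"
      using holomorphic_derivI[OF holomorphic_deriv[OF g(1) S(1)] S(1) z] s[OF g(2)[OF z]] by simp
    show ?thesis
      by (rule DERIV_cong[OF DERIV_mult[OF d\<omega> DERIV_diff[OF DERIV_mult[OF df ddg] DERIV_mult[OF ddf dg]]]])
         (simp add: algebra_simps)
  qed
  then have "continuous_on S (\<lambda>z. \<omega> z * (f z * deriv g z - deriv f z * g z))"
    by (intro DERIV_continuous_on) (auto intro: has_field_derivative_at_within)
  from DERIV_zero_connected_constant[OF S(2,1) finite.emptyI this] D that show ?thesis
    by auto
qed

text \<open>Cramer's rule: with \<open>W\<close> for the Wronskian,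
  \<open>W(f,g) u = W(u,g) f + W(f,u) g\<close> holds pointwise, and after multiplication by
  \<open>\<omega>\<close> all three Wronskians are constants.\<close>

lemma hyp_ode_span:
  assumes S: "open S" "connected S" "0 \<notin> S" "1 \<notin> S"
    and \<omega>: "\<And>z. z \<in> S \<Longrightarrow> (\<omega> has_field_derivative \<omega> z * (c - (a + b + 1) * z) / (z * (1 - z))) (at z)"
    and f: "f holomorphic_on S" "\<And>z. z \<in> S \<Longrightarrow> hyp_ode a b c f z = 0"
    and g: "g holomorphic_on S" "\<And>z. z \<in> S \<Longrightarrow> hyp_ode a b c g z = 0"
    and u: "u holomorphic_on S" "\<And>z. z \<in> S \<Longrightarrow> hyp_ode a b c u z = 0"
    and K: "\<And>z. z \<in> S \<Longrightarrow> \<omega> z * (f z * deriv g z - deriv f z * g z) = K" "K \<noteq> 0"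
  obtains A B where "\<And>z. z \<in> S \<Longrightarrow> u z = A * f z + B * g z"
proof -
  obtain K1 where K1: "\<And>z. z \<in> S \<Longrightarrow> \<omega> z * (u z * deriv g z - deriv u z * g z) = K1"
    using hyp_ode_Wronskian_const[OF S \<omega> u g] by blast
  obtain K2 where K2: "\<And>z. z \<in> S \<Longrightarrow> \<omega> z * (f z * deriv u z - deriv f z * u z) = K2"
    using hyp_ode_Wronskian_const[OF S \<omega> f u] by blast
  have "u z = K1 / K * f z + K2 / K * g z" if "z \<in> S" for z
  proof -
    have "K * u z = K1 * f z + K2 * g z"
      unfolding K1[OF that, symmetric] K2[OF that, symmetric] K(1)[OF that, symmetric] by (simp add: algebra_simps)
    then show ?thesis using K(2) by (simp add: field_simps)
  qed
  then show ?thesis by (rule that)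
qed

section \<open>Analytic continuation by a quadratic transformation\<close>

abbreviation cut_plane :: "complex set" where
  "cut_plane \<equiv> - complex_of_real ` {1..}"

lemma cut_plane_iff: "w \<in> cut_plane \<longleftrightarrow> 1 - w \<notin> \<real>\<^sub>\<le>\<^sub>0"
proof -
  have "w \<in> complex_of_real ` {1..} \<longleftrightarrow> Im w = 0 \<and> Re w \<ge> 1"
    by (auto simp: image_iff complex_eq_iff intro!: bexI[of _ "Re w"])
  then show ?thesis by (auto simp: complex_nonpos_Reals_iff)
qed

lemma cut_plane_eq: "cut_plane = (\<lambda>w. 1 - w) -` (- \<real>\<^sub>\<le>\<^sub>0)"
  using cut_plane_iff by auto

lemma open_cut_plane: "open cut_plane"
  unfolding cut_plane_eq by (intro open_vimage continuous_intros) auto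

lemma connected_cut_plane: "connected cut_plane"
  using starlike_slotted_complex_plane_right[of 1] by (intro starlike_imp_connected) simp

lemma zero_in_cut_plane: "0 \<in> cut_plane" and ball_subset_cut_plane: "ball 0 1 \<subseteq> cut_plane"
proof -
  show "ball 0 1 \<subseteq> cut_plane" by (auto simp: dist_norm)
  then show "0 \<in> cut_plane" by auto
qed

text \<open>Any continuation with the germ \<open>F\<close> is a witness for the choice, because the
  unit disc lies in the cut plane.\<close>

lemma principal_branch:
  assumes "f holomorphic_on cut_plane" "f has_fps_expansion F"
  shows "principal_branch F holomorphic_on cut_plane"
    and "principal_branch F has_fps_expansion F"
    and "\<And>w. norm w < 1 \<Longrightarrow> principal_branch F w = eval_fps F w"
proof -
  have "f w = eval_fps F w" if "w \<in> ball 0 1" for w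
    using has_fps_expansion_imp_eval_fps_eq[OF assms(2), of w 1] that
      holomorphic_on_subset[OF assms(1) ball_subset_cut_plane] by simp
  then have "\<exists>f. f holomorphic_on cut_plane \<and> (\<forall>w\<in>ball 0 1. f w = eval_fps F w)"
    using assms(1) by blast
  then have *: "principal_branch F holomorphic_on cut_plane \<and> (\<forall>w\<in>ball 0 1. principal_branch F w = eval_fps F w)"
    unfolding principal_branch_def by (rule someI_ex)
  then show "principal_branch F holomorphic_on cut_plane"
    and **: "\<And>w. norm w < 1 \<Longrightarrow> principal_branch F w = eval_fps F w" by auto
  have "fps_conv_radius F > 0" using assms(2) by (simp add: has_fps_expansion_def)
  moreover have "eventually (\<lambda>w. w \<in> ball (0::complex) 1) (nhds 0)"
    by (intro eventually_nhds_in_open) auto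
  then have "eventually (\<lambda>w. eval_fps F w = principal_branch F w) (nhds 0)"
    by eventually_elim (simp add: **)
  ultimately show "principal_branch F has_fps_expansion F"
    by (simp add: has_fps_expansion_def)
qed

lemma Re_csqrt_pos: "z \<notin> \<real>\<^sub>\<le>\<^sub>0 \<Longrightarrow> Re (csqrt z) > 0"
proof -
  note [simp del] = csqrt.simps
  assume z: "z \<notin> \<real>\<^sub>\<le>\<^sub>0"
  have "Re (csqrt z) \<noteq> 0"
  proof
    assume "Re (csqrt z) = 0"
    then have "Re ((csqrt z)\<^sup>2) \<le> 0" "Im ((csqrt z)\<^sup>2) = 0"
      by (simp_all only: Re_power2 Im_power2) auto
    then have "z \<in> \<real>\<^sub>\<le>\<^sub>0" by (simp add: complex_nonpos_Reals_iff)
    with z show False by simp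
  qed
  then show ?thesis using Re_csqrt[of z] by simp
qed

text \<open>
  With \<open>r = (1 - sqrt (1 - w)) / (1 + sqrt (1 - w))\<close>, i.e. \<open>w = 4 * r / (1 + r)\<^sup>2\<close>, the cut plane is
  mapped onto the unit disc, and \<open>(1 + r) powr (- 2 * a)\<close> times the given solution satisfies a
  hypergeometric equation in \<open>r\<close>. Its Taylor series in \<open>r\<close> therefore converges in the whole disc.
\<close>

lemma quadratic_continuation:
  assumes "hyp_rec a (a + 1 / 2) c F"
  obtains f where "f holomorphic_on cut_plane" "f has_fps_expansion F"
proof -
  note [simp del] = csqrt.simps
  let ?m = "\<lambda>r::complex. 4 * r / (1 + r)\<^sup>2"
  define g where "g = (\<lambda>r. (1 + r) powr (- 2 * a) * eval_fps F (?m r))"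
  have F: "eval_fps F holomorphic_on ball 0 1" "eval_fps F has_fps_expansion F"
    using hyp_rec_expansion[OF assms] by auto
  \<comment> \<open>\<open>A\<close> is merely some neighbourhood of 0 where \<open>g\<close> is
    meaningful; the full disc of convergence of its series \<open>G\<close> comes from the recursion
    alone.\<close>
  define A where "A = (\<lambda>z::complex. 1 + z) -` (- \<real>\<^sub>\<le>\<^sub>0) \<inter> ?m -` ball 0 1"
  have A: "open A" unfolding A_def
    by (intro continuous_open_preimage open_vimage continuous_intros) auto
  have A0: "0 \<in> A" by (auto simp: A_def)
  have "?m holomorphic_on A"
    by (intro holomorphic_intros) (auto simp: A_def)
  then have "(\<lambda>r. eval_fps F (?m r)) holomorphic_on A"
    by (rule holomorphic_on_compose_gen[OF _ F(1), unfolded o_def]) (auto simp: A_def)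
  then have gA: "g holomorphic_on A"
    unfolding g_def by (intro holomorphic_intros) (auto simp: A_def)
  define G where "G = fps_expansion g 0"
  have gG: "g has_fps_expansion G" unfolding G_def 
    using A A0 gA by (intro has_fps_expansion_fps_expansion)
  have ode: "hyp_ode (2 * a) (2 * a - c + 1) c g z = 0" if "z \<in> A" for z
    using that hyp_ode_quadratic[OF _ F(1), of z a c] 
      hyp_ode_of_rec[OF assms F(2,1), of "?m z"] unfolding g_def A_def by simp
  have "eventually (\<lambda>z. z \<in> A) (nhds 0)"
    using A A0 by (rule eventually_nhds_in_open)
  then have "eventually (\<lambda>z. hyp_ode (2 * a) (2 * a - c + 1) c g z = 0) (nhds 0)"
    by eventually_elim (rule ode)
  then have G: "hyp_rec (2 * a) (2 * a - c + 1) c G"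
    by (rule hyp_rec_of_ode[OF gG])
  define \<rho> where "\<rho> = (\<lambda>w. (1 - csqrt (1 - w)) / (1 + csqrt (1 - w)))"
  define f where "f = (\<lambda>w. (1 + \<rho> w) powr (2 * a) * eval_fps G (\<rho> w))"
  have Re: "Re (csqrt (1 - w)) > 0" if "w \<in> cut_plane" for w
    using that Re_csqrt_pos unfolding cut_plane_iff by blast
  have nz: "1 + csqrt (1 - w) \<noteq> 0" if "w \<in> cut_plane" for w
    using Re[OF that] by (auto simp: complex_eq_iff simp del: csqrt.simps)
  have \<rho>1: "1 + \<rho> w = 2 / (1 + csqrt (1 - w))" if "w \<in> cut_plane" for w
    using nz[OF that] by (simp add: \<rho>_def field_simps)
  have \<rho>_norm: "\<rho> w \<in> ball 0 1" if "w \<in> cut_plane" for w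
  proof -
    \<comment> \<open>\<open>|1 - s| < |1 + s|\<close> is equivalent to \<open>Re s > 0\<close>,
      which the principal root satisfies off the cut.\<close>
    have "(norm (1 - csqrt (1 - w)))\<^sup>2 < (norm (1 + csqrt (1 - w)))\<^sup>2"
      using Re[OF that] unfolding cmod_power2 by (simp add: power2_eq_square algebra_simps)
    then have "norm (1 - csqrt (1 - w)) < norm (1 + csqrt (1 - w))"
      using power2_less_imp_less norm_ge_zero by blast
    then show ?thesis using nz[OF that] by (simp add: \<rho>_def norm_divide)
  qed
  have \<rho>_pos: "1 + \<rho> w \<notin> \<real>\<^sub>\<le>\<^sub>0" if "w \<in> cut_plane" for w
    using \<rho>_norm[OF that] 
    by (auto simp: complex_nonpos_Reals_iff dest!: order_le_less_trans[OF abs_Re_le_cmod])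
  have \<rho>_hol: "\<rho> holomorphic_on cut_plane"
    unfolding \<rho>_def using nz by (intro holomorphic_intros) (auto simp: cut_plane_iff[symmetric])
  have f_hol: "f holomorphic_on cut_plane"
    unfolding f_def using \<rho>_norm \<rho>_pos
    by (intro holomorphic_intros \<rho>_hol holomorphic_on_compose_gen[OF _ hyp_rec_expansion(1)[OF G], unfolded o_def]) auto
  have m\<rho>: "?m (\<rho> w) = w" if "w \<in> cut_plane" for w
  proof -
    have "?m (\<rho> w) = (1 - csqrt (1 - w)) * (1 + csqrt (1 - w))"
      unfolding \<rho>1[OF that] using nz[OF that] by (simp add: \<rho>_def power2_eq_square)
    also have "\<dots> = 1 - (csqrt (1 - w))\<^sup>2" by (simp add: algebra_simps power2_eq_square)
    finally show ?thesis by simp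
  qed
  have "isCont \<rho> 0"
    using \<rho>_hol open_cut_plane zero_in_cut_plane
    by (meson continuous_on_eq_continuous_at holomorphic_on_imp_continuous_on)
  then have "filterlim \<rho> (nhds 0) (nhds 0)"
    by (simp add: isCont_def \<rho>_def filterlim_at tendsto_nhds_iff)
  then have "eventually (\<lambda>w. eval_fps G (\<rho> w) = g (\<rho> w)) (nhds 0)"
    using gG unfolding has_fps_expansion_def filterlim_iff by blast
  moreover have "eventually (\<lambda>w. w \<in> cut_plane) (nhds 0)"
    using open_cut_plane zero_in_cut_plane by (rule eventually_nhds_in_open)
  ultimately have "eventually (\<lambda>w. eval_fps F w = f w) (nhds 0)"
  proof eventually_elim
    case (elim w)
    have "1 + \<rho> w \<noteq> 0" using \<rho>_pos[of w] elim by auto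
    then show ?case unfolding f_def elim(1) g_def m\<rho>[OF elim(2)] by (simp add: powr_minus)
  qed
  then have "f has_fps_expansion F"
    using F(2) by (simp add: has_fps_expansion_def)
  with f_hol show ?thesis by (rule that)
qed

section \<open>Euler's transformation of the regularized series\<close>

lemma has_fps_expansion_one_minus_powr:
  fixes \<alpha> :: complex
  shows "(\<lambda>w. (1 - w) powr \<alpha>) has_fps_expansion Abs_fps (\<lambda>n. pochhammer (- \<alpha>) n / fact n)"
proof -
  have "((\<lambda>w. (1 + w) powr \<alpha>) \<circ> uminus) has_fps_expansion fps_compose (fps_binomial \<alpha>) (- fps_X)"
    by (intro fps_expansion_intros) auto
  also have "fps_compose (fps_binomial \<alpha>) (- fps_X) = Abs_fps (\<lambda>n. pochhammer (- \<alpha>) n / fact n)"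
  proof -
    have e: "fps_const (- 1) * fps_X = - (fps_X :: complex fps)" by (simp add: fps_const_neg[symmetric] del: fps_const_neg)
    have "fps_compose (fps_binomial \<alpha>) (- fps_X) = Abs_fps (\<lambda>n. (- 1) ^ n * (\<alpha> gchoose n))"
      using fps_compose_linear[of "fps_binomial \<alpha>" "-1", unfolded e] by simp
    then show ?thesis by (simp add: fps_eq_iff gbinomial_pochhammer flip: power_mult_distrib)
  qed
  finally show ?thesis by (simp add: o_def)
qed

text \<open>Both series satisfy the recursion for \<open>c - a\<close>, \<open>c - b\<close>,
  \<open>c\<close> and start with \<open>rGamma c\<close>. For the product this follows from the
  differential equation of \<open>(1 - w) powr (a + b - c)\<close> times the given function.\<close>

lemma fps_nth_reg_Euler_aux:
  assumes "c \<notin> \<int>\<^sub>\<le>\<^sub>0"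
  shows "Abs_fps (\<lambda>n. pochhammer (c - a - b) n / fact n) * fps_hyp2F1_reg a b c = fps_hyp2F1_reg (c - a) (c - b) c"
proof (rule hyp_rec_unique[OF _ hyp_rec_reg assms])
  let ?R = "fps_hyp2F1_reg a b c"
  let ?g = "\<lambda>w. (1 - w) powr (a + b - c) * eval_fps ?R w"
  have R: "eval_fps ?R holomorphic_on ball 0 1" "eval_fps ?R has_fps_expansion ?R"
    using hyp_rec_expansion[OF hyp_rec_reg] by auto
  have "?g has_fps_expansion Abs_fps (\<lambda>n. pochhammer (c - a - b) n / fact n) * ?R"
    using has_fps_expansion_mult[OF has_fps_expansion_one_minus_powr[of "a + b - c"] R(2)]
    by (simp add: algebra_simps)
  moreover have "hyp_ode (c - a) (c - b) c ?g w = 0" if "w \<in> ball 0 1" for w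
    using hyp_ode_Euler[OF open_ball R(1) that, of "c - a" "c - b" c] that ball_subset_cut_plane 
      hyp_ode_of_rec[OF hyp_rec_reg R(2,1), of w] cut_plane_iff[of w]
    by (auto simp: algebra_simps)
  moreover have "eventually (\<lambda>w. w \<in> ball (0::complex) 1) (nhds 0)"
    by (intro eventually_nhds_in_open) auto
  ultimately show "hyp_rec (c - a) (c - b) c (Abs_fps (\<lambda>n. pochhammer (c - a - b) n / fact n) * ?R)"
    by (intro hyp_rec_of_ode) (auto elim: eventually_mono)
qed (simp add: fps_hyp2F1_reg_def)

text \<open>
  For \<open>c \<in> \<int>\<^sub>\<le>\<^sub>0\<close> the recursion does not determine the coefficients, but both sides are entire in \<open>c\<close>.
\<close>

lemma fps_hyp2F1_reg_Euler:
  "Abs_fps (\<lambda>n. pochhammer (c - a - b) n / fact n) * fps_hyp2F1_reg a b c = fps_hyp2F1_reg (c - a) (c - b) c"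
proof (rule fps_ext)
  fix n
  let ?l = "\<lambda>c. fps_nth (Abs_fps (\<lambda>n. pochhammer (c - a - b) n / fact n) * fps_hyp2F1_reg a b c) n"
  let ?r = "\<lambda>c. fps_nth (fps_hyp2F1_reg (c - a) (c - b) c) n"
  have "?l holomorphic_on UNIV"
    unfolding fps_mult_nth fps_hyp2F1_reg_def pochhammer_prod by (auto intro!: holomorphic_intros)
  moreover have "?r holomorphic_on UNIV"
    unfolding fps_hyp2F1_reg_def pochhammer_prod by (auto intro!: holomorphic_intros)
  moreover have "open (- (\<int>\<^sub>\<le>\<^sub>0 :: complex set))" "- (\<int>\<^sub>\<le>\<^sub>0 :: complex set) \<noteq> {}"
  proof -
    have "1 \<in> - (\<int>\<^sub>\<le>\<^sub>0 :: complex set)" by simp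
    then show "- (\<int>\<^sub>\<le>\<^sub>0 :: complex set) \<noteq> {}" by blast
  qed auto
  ultimately show "?l c = ?r c"
    using fps_nth_reg_Euler_aux
    by (intro analytic_continuation_open[of "- (\<int>\<^sub>\<le>\<^sub>0)" UNIV ?l ?r c]) auto
qed

lemma hyp2F1_reg_Euler:
  assumes "norm w < 1"
  shows "(1 - w) powr (a + b - c) * eval_fps (fps_hyp2F1_reg a b c) w = eval_fps (fps_hyp2F1_reg (c - a) (c - b) c) w"
proof -
  have R: "eval_fps (fps_hyp2F1_reg a b c) holomorphic_on ball 0 1" "eval_fps (fps_hyp2F1_reg a b c) has_fps_expansion fps_hyp2F1_reg a b c"
    using hyp_rec_expansion[OF hyp_rec_reg] by auto
  have "(\<lambda>w. (1 - w) powr (a + b - c) * eval_fps (fps_hyp2F1_reg a b c) w) has_fps_expansion fps_hyp2F1_reg (c - a) (c - b) c"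
    using has_fps_expansion_mult[OF has_fps_expansion_one_minus_powr[of "a + b - c"] R(2)]
      fps_hyp2F1_reg_Euler[of c a b] by (simp add: algebra_simps)
  moreover have "(\<lambda>w. (1 - w) powr (a + b - c) * eval_fps (fps_hyp2F1_reg a b c) w) holomorphic_on ball 0 1"
    using ball_subset_cut_plane by (intro holomorphic_intros R) (auto simp: cut_plane_iff[symmetric])
  ultimately show ?thesis
    using has_fps_expansion_imp_eval_fps_eq[OF _ assms] by (metis (no_types, lifting))
qed

section \<open>The singular coefficient at 1\<close>

text \<open>In a quotient of Gauss's products \<open>rGamma_series\<close> the factorials cancel,
  and the powers of \<open>n\<close> cancel because \<open>a + b = c + d\<close>. The offset 1
  arises since the product with index \<open>n\<close> contains
  \<open>pochhammer _ (n + 1)\<close>.\<close>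

lemma pochhammer_ratio_limit:
  fixes a b c d :: complex
  assumes "a + b = c + d" "c \<notin> \<int>\<^sub>\<le>\<^sub>0" "d \<notin> \<int>\<^sub>\<le>\<^sub>0"
  shows "(\<lambda>n. pochhammer a n * pochhammer b n / (pochhammer c n * pochhammer d n))
           \<longlonglongrightarrow> rGamma a * rGamma b / (rGamma c * rGamma d)"
proof (rule LIMSEQ_offset[where k = 1], rule Lim_transform_eventually)
  show "(\<lambda>n. rGamma_series a n * rGamma_series b n / (rGamma_series c n * rGamma_series d n))
           \<longlonglongrightarrow> rGamma a * rGamma b / (rGamma c * rGamma d)"
    using assms by (intro tendsto_intros) (auto simp: rGamma_eq_zero_iff)
  have "rGamma_series a n * rGamma_series b n / (rGamma_series c n * rGamma_series d n)
      = pochhammer a (n + 1) * pochhammer b (n + 1) / (pochhammer c (n + 1) * pochhammer d (n + 1))" for n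
  proof -
    let ?e = "\<lambda>z::complex. exp (z * complex_of_real (ln (real n)))"
    have e: "?e a * ?e b = ?e c * ?e d"
      by (simp only: exp_add[symmetric] distrib_right[symmetric] assms(1))
    have "rGamma_series a n * rGamma_series b n / (rGamma_series c n * rGamma_series d n) =
      (pochhammer a (n + 1) * pochhammer b (n + 1) / (fact n * fact n * (?e a * ?e b)))
       / (pochhammer c (n + 1) * pochhammer d (n + 1) / (fact n * fact n * (?e c * ?e d)))"
      by (simp only: rGamma_series_def times_divide_times_eq ac_simps of_real_of_nat_eq)
    then show ?thesis unfolding e by simp
  qed
  then show "\<forall>\<^sub>F n in sequentially. rGamma_series a n * rGamma_series b n / (rGamma_series c n * rGamma_series d n)
      = pochhammer a (n + 1) * pochhammer b (n + 1) / (pochhammer c (n + 1) * pochhammer d (n + 1))"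
    by (intro always_eventually allI)
qed

text \<open>The modulus of \<open>n^\<mu>\<close> is \<open>n^(Re \<mu>)\<close>, so complex
  binomial coefficients are comparable with the positive ones of exponent \<open>Re \<mu>\<close>,
  which the Abelian estimate needs.\<close>

lemma norm_pochhammer_ratio_limit:
  fixes \<mu> :: complex
  assumes "Re \<mu> > 0"
  shows "(\<lambda>n. norm (pochhammer \<mu> n) / pochhammer (Re \<mu>) n) \<longlonglongrightarrow> norm (rGamma \<mu>) / norm (rGamma (Re \<mu>))"
proof (rule LIMSEQ_offset[where k = 1], rule Lim_transform_eventually)
  have "Re \<mu> \<notin> \<int>\<^sub>\<le>\<^sub>0" using assms by (auto elim!: nonpos_Ints_cases)
  then show "(\<lambda>n. norm (rGamma_series \<mu> n) / norm (rGamma_series (Re \<mu>) n))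
           \<longlonglongrightarrow> norm (rGamma \<mu>) / norm (rGamma (Re \<mu>))"
    by (intro tendsto_intros) (auto simp: rGamma_eq_zero_iff)
  have "norm (rGamma_series \<mu> n) / norm (rGamma_series (Re \<mu>) n) = norm (pochhammer \<mu> (n + 1)) / pochhammer (Re \<mu>) (n + 1)" for n
    using pochhammer_pos[OF assms, of "n + 1"] 
    by (simp add: rGamma_series_def norm_divide norm_mult del: pochhammer_Suc)
  then show "\<forall>\<^sub>F n in sequentially. norm (rGamma_series \<mu> n) / norm (rGamma_series (Re \<mu>) n) = norm (pochhammer \<mu> (n + 1)) / pochhammer (Re \<mu>) (n + 1)"
    by (intro always_eventually allI)
qed

lemma one_minus_notin_nonpos_Reals: "norm (w :: complex) < 1 \<Longrightarrow> 1 - w \<notin> \<real>\<^sub>\<le>\<^sub>0"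
  using ball_subset_cut_plane cut_plane_iff[of w] by auto

lemma one_minus_powr_sums:
  fixes \<mu> w :: complex
  assumes "norm w < 1"
  shows "(\<lambda>n. pochhammer \<mu> n / fact n * w ^ n) sums (1 - w) powr (- \<mu>)"
proof -
  have "(\<lambda>w. (1 - w) powr (- \<mu>)) holomorphic_on eball 0 1"
    by (auto intro!: holomorphic_intros one_minus_notin_nonpos_Reals simp: one_ereal_def)
  from has_fps_expansion_imp_sums_complex[OF has_fps_expansion_one_minus_powr this] show ?thesis
    using assms by (simp add: one_ereal_def)
qed

lemma one_minus_powr_sums_real:
  fixes \<sigma> x :: real
  assumes "0 < x" "x < 1"
  shows "(\<lambda>n. pochhammer \<sigma> n / fact n * x ^ n) sums (1 - x) powr (- \<sigma>)"
proof -
  have "(1 - complex_of_real x) powr (- of_real \<sigma>) = of_real ((1 - x) powr (- \<sigma>))"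
    using powr_of_real[of "1 - x" "- \<sigma>"] assms by simp
  then have "(\<lambda>n. complex_of_real (pochhammer \<sigma> n / fact n * x ^ n)) sums of_real ((1 - x) powr (- \<sigma>))"
    using one_minus_powr_sums[of "of_real x" "of_real \<sigma>"] assms by (simp add: pochhammer_of_real)
  then show ?thesis by (simp only: sums_of_real_iff)
qed

lemma one_minus_powr_tendsto_0:
  assumes "(\<sigma>::real) > 0" shows "((\<lambda>x. (1 - x) powr \<sigma>) \<longlongrightarrow> 0) (at_left 1)"
proof -
  have "((\<lambda>x. 1 - x) \<longlongrightarrow> 1 - 1) (at_left (1::real))" by (intro tendsto_intros)
  then have "((\<lambda>x. 1 - x) \<longlongrightarrow> 0) (at_left (1::real))" by simp
  moreover have "eventually (\<lambda>x. 0 \<le> 1 - x) (at_left (1::real))"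
    using eventually_at_left_real[of 0 1] by (auto elim!: eventually_mono)
  ultimately show ?thesis using assms
    by (intro tendsto_zero_powrI[OF _ tendsto_const])
qed

text \<open>The comparison series sums to \<open>(1 - x) powr (- \<sigma>)\<close>. The tail is at
  most \<open>\<epsilon> / 2\<close> times this, while the finitely many other terms stay bounded by
  \<open>C\<close> and are killed by the factor \<open>(1 - x) powr \<sigma>\<close>.\<close>

lemma abel_small_coeffs:
  fixes e :: "nat \<Rightarrow> complex"
  assumes "\<sigma> > 0"
    and lim: "(\<lambda>n. norm (e n) / (pochhammer \<sigma> n / fact n)) \<longlonglongrightarrow> 0"
    and summ: "\<And>x. 0 < x \<Longrightarrow> x < 1 \<Longrightarrow> summable (\<lambda>n. norm (e n) * x ^ n)"
  shows "((\<lambda>x. (1 - x) powr \<sigma> * norm (\<Sum>n. e n * of_real x ^ n)) \<longlongrightarrow> 0) (at_left 1)"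
proof (rule tendstoI)
  fix \<epsilon> :: real assume \<epsilon>: "\<epsilon> > 0"
  define p where "p = (\<lambda>n. pochhammer \<sigma> n / fact n)"
  have p: "p n > 0" for n using assms(1) pochhammer_pos[of \<sigma> n] by (simp add: p_def)
  obtain N where N: "\<And>n. n \<ge> N \<Longrightarrow> norm (e n) \<le> \<epsilon> / 2 * p n"
  proof -
    have "eventually (\<lambda>n. norm (e n) / p n < \<epsilon> / 2) sequentially"
      using order_tendstoD(2)[OF lim, of "\<epsilon> / 2"] \<epsilon> unfolding p_def by simp
    then obtain N where N: "\<And>n. n \<ge> N \<Longrightarrow> norm (e n) / p n < \<epsilon> / 2" 
      unfolding eventually_sequentially by blast
    show ?thesis
    proof (rule that)
      fix n assume "n \<ge> N"
      from N[OF this] show "norm (e n) \<le> \<epsilon> / 2 * p n" using p[of n] by (simp add: pos_divide_less_eq)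
    qed
  qed
  define C where "C = (\<Sum>n<N. norm (e n))"
  have bound: "(1 - x) powr \<sigma> * norm (\<Sum>n. e n * of_real x ^ n) \<le> C * (1 - x) powr \<sigma> + \<epsilon> / 2" if x: "0 < x" "x < 1" for x
  proof -
    have ps: "(\<lambda>n. p n * x ^ n) sums (1 - x) powr (- \<sigma>)"
      unfolding p_def using one_minus_powr_sums_real[OF x] .
    have s1: "(\<lambda>n. (if n < N then norm (e n) else 0) + \<epsilon> / 2 * (p n * x ^ n)) sums (C + \<epsilon> / 2 * (1 - x) powr (- \<sigma>))"
      unfolding C_def using sums_If_finite_set[of "{..<N}" "\<lambda>n. norm (e n)"]
      by (intro sums_add sums_mult ps) simp
    have "norm (\<Sum>n. e n * of_real x ^ n) \<le> (\<Sum>n. norm (e n) * x ^ n)"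
      using summable_norm[of "\<lambda>n. e n * of_real x ^ n"] summ[OF x] x by (simp add: norm_mult norm_power)
    also have "\<dots> \<le> C + \<epsilon> / 2 * (1 - x) powr (- \<sigma>)"
    proof (rule sums_le[OF _ summable_sums[OF summ[OF x]] s1])
      fix n
      have "norm (e n) * x ^ n \<le> norm (e n)" using x by (simp add: mult_left_le power_le_one)
      moreover have "\<epsilon> / 2 * (p n * x ^ n) \<ge> 0" using \<epsilon> p[of n] x by simp
      moreover have "norm (e n) * x ^ n \<le> \<epsilon> / 2 * p n * x ^ n" if "n \<ge> N"
        using N[OF that] x by (intro mult_right_mono) auto
      ultimately show "norm (e n) * x ^ n \<le> (if n < N then norm (e n) else 0) + \<epsilon> / 2 * (p n * x ^ n)"
        by (auto simp: mult.assoc)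
    qed
    finally have "(1 - x) powr \<sigma> * norm (\<Sum>n. e n * of_real x ^ n) \<le> (1 - x) powr \<sigma> * (C + \<epsilon> / 2 * (1 - x) powr (- \<sigma>))"
      by (rule mult_left_mono) simp
    also have "\<dots> = C * (1 - x) powr \<sigma> + \<epsilon> / 2 * ((1 - x) powr \<sigma> * (1 - x) powr (- \<sigma>))"
      by (simp add: algebra_simps)
    also have "(1 - x) powr \<sigma> * (1 - x) powr (- \<sigma>) = 1" using x by (simp add: powr_minus)
    finally show ?thesis by simp
  qed
  have "((\<lambda>x. C * (1 - x) powr \<sigma>) \<longlongrightarrow> C * 0) (at_left 1)"
    by (intro tendsto_mult tendsto_const one_minus_powr_tendsto_0 assms)
  then have "eventually (\<lambda>x. C * (1 - x) powr \<sigma> < \<epsilon> / 2) (at_left 1)"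
    using \<epsilon> by (intro order_tendstoD(2)) auto
  moreover have "eventually (\<lambda>x::real. x \<in> {0<..<1}) (at_left 1)"
    by (rule eventually_at_left_real) simp
  ultimately show "eventually (\<lambda>x. dist ((1 - x) powr \<sigma> * norm (\<Sum>n. e n * of_real x ^ n)) 0 < \<epsilon>) (at_left 1)"
  proof eventually_elim
    case (elim x)
    then have "0 < x" "x < 1" by auto
    from bound[OF this] elim show ?case by simp
  qed
qed

text \<open>The coefficients \<open>u n\<close> are asymptotic to \<open>L\<close> times the
  coefficients \<open>v n\<close> of \<open>(1 - x) powr (- \<mu>)\<close>; the error series is
  negligible by \<open>abel_small_coeffs\<close>.\<close>

lemma hyp2F1_reg_limit_1:
  assumes "Re (a + b - c) > 0" "c \<notin> \<int>\<^sub>\<le>\<^sub>0"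
  shows "((\<lambda>x. (1 - of_real x) powr (a + b - c) * eval_fps (fps_hyp2F1_reg a b c) (of_real x))
            \<longlongrightarrow> Gamma (a + b - c) * rGamma a * rGamma b) (at_left 1)"
proof -
  define \<mu> where "\<mu> = a + b - c"
  have \<mu>: "Re \<mu> > 0" using assms by (simp add: \<mu>_def)
  have \<mu>': "\<mu> \<notin> \<int>\<^sub>\<le>\<^sub>0" using \<mu> by (auto elim!: nonpos_Ints_cases)
  \<comment> \<open>\<open>L\<close> is the limit of \<open>u n / v n\<close>, given by
    \<open>pochhammer_ratio_limit\<close> because \<open>a + b = c + \<mu>\<close>.\<close>
  define L where "L = Gamma \<mu> * rGamma a * rGamma b"
  define u where "u = fps_nth (fps_hyp2F1_reg a b c)"
  define v where "v = (\<lambda>n. pochhammer \<mu> n / fact n)"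
  define e where "e = (\<lambda>n. u n - L * v n)"
  have R: "eval_fps (fps_hyp2F1_reg a b c) holomorphic_on ball 0 1" "eval_fps (fps_hyp2F1_reg a b c) has_fps_expansion fps_hyp2F1_reg a b c"
    using hyp_rec_expansion[OF hyp_rec_reg] by auto
  have us: "(\<lambda>n. u n * w ^ n) sums eval_fps (fps_hyp2F1_reg a b c) w" if "norm w < 1" for w
    unfolding u_def using has_fps_expansion_imp_sums_complex[OF R(2), of 1 w] R(1) that by (simp add: one_ereal_def)
  have es: "(\<lambda>n. e n * w ^ n) sums (eval_fps (fps_hyp2F1_reg a b c) w - L * (1 - w) powr (- \<mu>))" if "norm w < 1" for w
    using sums_diff[OF us[OF that] sums_mult[OF one_minus_powr_sums[OF that, of \<mu>], of L]]
    by (simp add: e_def v_def algebra_simps)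
  have pc: "pochhammer c n \<noteq> 0" "pochhammer \<mu> n \<noteq> 0" for n
    using assms(2) \<mu>' pochhammer_eq_0_imp_nonpos_Int by blast+
  have "(\<lambda>n. rGamma c * (pochhammer a n * pochhammer b n / (pochhammer c n * pochhammer \<mu> n)))
     \<longlonglongrightarrow> rGamma c * (rGamma a * rGamma b / (rGamma c * rGamma \<mu>))"
    using assms(2) \<mu>' by (intro tendsto_intros pochhammer_ratio_limit) (auto simp: \<mu>_def)
  moreover have "rGamma c * (pochhammer a n * pochhammer b n / (pochhammer c n * pochhammer \<mu> n)) = u n / v n" for n
    using pc[of n] pochhammer_rGamma[of c n] by (simp add: u_def v_def fps_hyp2F1_reg_def field_simps)
  moreover have "rGamma c * (rGamma a * rGamma b / (rGamma c * rGamma \<mu>)) = L"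
    using assms(2) \<mu>' by (simp add: L_def Gamma_def rGamma_eq_zero_iff field_simps)
  ultimately have uv: "(\<lambda>n. u n / v n) \<longlonglongrightarrow> L" by simp
  have "(\<lambda>n. norm (u n / v n - L) * (norm (pochhammer \<mu> n) / pochhammer (Re \<mu>) n)) \<longlonglongrightarrow> norm (L - L) * (norm (rGamma \<mu>) / norm (rGamma (Re \<mu>)))"
    by (intro tendsto_intros uv norm_pochhammer_ratio_limit \<mu>)
  moreover have "norm (u n / v n - L) * (norm (pochhammer \<mu> n) / pochhammer (Re \<mu>) n) = norm (e n) / (pochhammer (Re \<mu>) n / fact n)" for n
  proof -
    have "e n = (u n / v n - L) * v n" using pc[of n] by (simp add: e_def v_def field_simps)
    then show ?thesis by (simp add: norm_mult norm_divide v_def)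
  qed
  ultimately have lim: "(\<lambda>n. norm (e n) / (pochhammer (Re \<mu>) n / fact n)) \<longlonglongrightarrow> 0"
    by (simp only: diff_self norm_zero mult_zero_left)
  have "((\<lambda>x. (1 - x) powr Re \<mu> * norm (\<Sum>n. e n * of_real x ^ n)) \<longlongrightarrow> 0) (at_left 1)"
  proof (rule abel_small_coeffs[OF \<mu> lim])
    fix x :: real assume x: "0 < x" "x < 1"
    \<comment> \<open>Any point strictly between \<open>x\<close> and 1 would do: convergence at
      \<open>y\<close> gives absolute convergence at \<open>x\<close>.\<close>
    define y where "y = (x + 1) / 2"
    have y: "x < y" "y < 1" "0 < y" using x by (auto simp: y_def)
    have "summable (\<lambda>n. e n * of_real y ^ n)"
      using es[of "of_real y"] y by (auto simp: sums_iff)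
    then have "summable (\<lambda>n. norm (e n * of_real x ^ n))"
      using x y by (rule_tac powser_insidea) auto
    then show "summable (\<lambda>n. norm (e n) * x ^ n)" using x by (simp add: norm_mult norm_power)
  qed
  then have "((\<lambda>x. (1 - of_real x) powr \<mu> * (\<Sum>n. e n * of_real x ^ n)) \<longlongrightarrow> 0) (at_left 1)"
  proof (rule tendsto_norm_zero_cancel[OF Lim_transform_eventually])
    have "eventually (\<lambda>x::real. x \<in> {0<..<1}) (at_left 1)"
      by (rule eventually_at_left_real) simp
    then show "\<forall>\<^sub>F x in at_left 1. (1 - x) powr Re \<mu> * norm (\<Sum>n. e n * of_real x ^ n)
         = norm ((1 - of_real x) powr \<mu> * (\<Sum>n. e n * of_real x ^ n))"
    proof eventually_elim
      case (elim x)
      then show ?case using norm_powr_real_powr[of "of_real (1 - x)" \<mu>] by (simp add: norm_mult)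
    qed
  qed
  then have "((\<lambda>x. L + (1 - of_real x) powr \<mu> * (\<Sum>n. e n * of_real x ^ n)) \<longlongrightarrow> L + 0) (at_left 1)"
    by (intro tendsto_intros)
  moreover have "eventually (\<lambda>x::real. x \<in> {0<..<1}) (at_left 1)"
    by (rule eventually_at_left_real) simp
  then have "\<forall>\<^sub>F x in at_left 1. L + (1 - of_real x) powr \<mu> * (\<Sum>n. e n * of_real x ^ n)
     = (1 - of_real x) powr \<mu> * eval_fps (fps_hyp2F1_reg a b c) (of_real x)"
  proof eventually_elim
    case (elim x)
    then have "norm (complex_of_real x) < 1" by simp
    from sums_unique[OF es[OF this]] have "(\<Sum>n. e n * of_real x ^ n) = eval_fps (fps_hyp2F1_reg a b c) (of_real x) - L * (1 - of_real x) powr (- \<mu>)"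
      by simp
    moreover have "1 - complex_of_real x \<noteq> 0" using elim by (metis eq_iff_diff_eq_0 greaterThanLessThan_iff less_irrefl of_real_eq_1_iff)
    moreover have "(1 - complex_of_real x) powr \<mu> * (L * (1 - of_real x) powr (- \<mu>)) = L"
      using calculation(2) by (simp add: powr_minus)
    ultimately show ?case by (simp add: right_diff_distrib)
  qed
  ultimately show ?thesis unfolding \<mu>_def[symmetric] L_def[symmetric] by (simp add: tendsto_cong)
qed

text \<open>The usual denominator \<open>c\<close> of the derivative is absorbed by
  \<open>rGamma\<close>, so the formula holds for all \<open>c\<close>.\<close>

lemma fps_deriv_hyp2F1_reg:
  "fps_deriv (fps_hyp2F1_reg a b c) = fps_const (a * b) * fps_hyp2F1_reg (a + 1) (b + 1) (c + 1)"
proof (rule fps_ext)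
  fix n
  have c: "c + of_nat (Suc n) = c + 1 + of_nat n" by simp
  have f: "of_nat (Suc n) * (x / fact (Suc n)) = x / fact n" for x :: complex
    by (simp add: fact_Suc del: of_nat_Suc)
  have "fps_nth (fps_deriv (fps_hyp2F1_reg a b c)) n
      = of_nat (Suc n) * (pochhammer a (Suc n) * pochhammer b (Suc n) * rGamma (c + of_nat (Suc n)) / fact (Suc n))"
    by (simp add: fps_hyp2F1_reg_def)
  also have "\<dots> = pochhammer a (Suc n) * pochhammer b (Suc n) * rGamma (c + 1 + of_nat n) / fact n"
    unfolding c by (rule f)
  also have "\<dots> = fps_nth (fps_const (a * b) * fps_hyp2F1_reg (a + 1) (b + 1) (c + 1)) n"
    by (simp add: fps_hyp2F1_reg_def pochhammer_rec mult_ac)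
  finally show "fps_nth (fps_deriv (fps_hyp2F1_reg a b c)) n = fps_nth (fps_const (a * b) * fps_hyp2F1_reg (a + 1) (b + 1) (c + 1)) n" .
qed

text \<open>
  Differentiation raises \<open>a\<close>, \<open>b\<close>, \<open>c\<close> and hence \<open>a + b - c\<close> by 1, which reduces everything to the case
  \<open>Re (a + b - c) > 0\<close>, where the singular term dominates. The factor \<open>k\<close> collects the products
  \<open>a * b\<close>, which may vanish.
\<close>

lemma hyp2F1_reg_singular_coeff:
  fixes a b c :: complex
  assumes "a + b - c \<notin> \<int>" "0 < r"
    and "G1 holomorphic_on ball 1 r" "G2 holomorphic_on ball 1 r"
    and "\<And>w. w \<in> ball 0 1 \<Longrightarrow> w \<in> ball 1 r \<Longrightarrow>
       k * eval_fps (fps_hyp2F1_reg a b c) w = G1 w + (1 - w) powr (c - a - b) * G2 w"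
  shows "G2 1 = k * Gamma (a + b - c) * rGamma a * rGamma b"
proof -
  \<comment> \<open>\<open>n\<close> counts differentiations. They also raise \<open>Re c\<close>
    above 0, which keeps \<open>c\<close> away from the nonpositive integers excluded in
    \<open>hyp2F1_reg_limit_1\<close>.\<close>
  obtain n :: nat where "Re (a + b - c) + real n > 0" "Re c + real n > 0"
  proof -
    obtain n :: nat where "real n > max (- Re (a + b - c)) (- Re c)" using reals_Archimedean2 by blast
    then show ?thesis by (intro that[of n]) auto
  qed
  then show ?thesis using assms(1,3-5)
  proof (induction n arbitrary: a b c k G1 G2)
    case 0
    let ?F = "eval_fps (fps_hyp2F1_reg a b c)"
    have c: "c \<notin> \<int>\<^sub>\<le>\<^sub>0" using 0 by (auto elim!: nonpos_Ints_cases)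
    have at1: "((\<lambda>x::real. of_real x) \<longlongrightarrow> (1::complex)) (at_left 1)"
      using tendsto_of_real[OF tendsto_ident_at, of 1 "{..<1::real}"] by simp
    have Gc: "((\<lambda>x. G (of_real x)) \<longlongrightarrow> G 1) (at_left (1::real))" if "G holomorphic_on ball 1 r" for G
      using that assms(2) at1 
      by (intro isCont_tendsto_compose[of 1 G]) (auto intro: continuous_on_interior holomorphic_on_imp_continuous_on)
    have "((\<lambda>x::real. (1 - of_real x) powr (a + b - c)) \<longlongrightarrow> (0::complex)) (at_left 1)"
    proof (rule tendsto_norm_zero_cancel[OF Lim_transform_eventually[OF one_minus_powr_tendsto_0[of "Re (a + b - c)"]]])
      have "eventually (\<lambda>x::real. x \<in> {0<..<1}) (at_left 1)"
        by (rule eventually_at_left_real) simp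
      then show "\<forall>\<^sub>F x in at_left 1. (1 - x) powr Re (a + b - c) = norm ((1 - complex_of_real x) powr (a + b - c))"
      proof eventually_elim
        case (elim x)
        then show ?case using norm_powr_real_powr[of "of_real (1 - x)" "a + b - c"] by simp
      qed
    qed (use 0 in simp)
    \<comment> \<open>After multiplication by \<open>(1 - x) powr (a + b - c)\<close> the regular
      part \<open>G1\<close> dies out at 1 and exactly \<open>G2 1\<close> survives.\<close>
    then have "((\<lambda>x. (1 - of_real x) powr (a + b - c) * G1 (of_real x) + G2 (of_real x)) \<longlongrightarrow> 0 * G1 1 + G2 1) (at_left (1::real))"
      by (intro tendsto_intros Gc 0)
    moreover have "((\<lambda>x. k * ((1 - of_real x) powr (a + b - c) * ?F (of_real x))) \<longlongrightarrow> k * (Gamma (a + b - c) * rGamma a * rGamma b)) (at_left 1)"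
      using 0 c by (intro tendsto_intros hyp2F1_reg_limit_1) auto
    moreover have "eventually (\<lambda>x::real. x \<in> {max 0 (1 - r)<..<1}) (at_left 1)"
      using assms(2) by (intro eventually_at_left_real) simp
    then have "\<forall>\<^sub>F x in at_left 1. (1 - of_real x) powr (a + b - c) * G1 (of_real x) + G2 (of_real x)
       = k * ((1 - of_real x) powr (a + b - c) * ?F (of_real x))"
    proof eventually_elim
      case (elim x)
      have nz: "1 - complex_of_real x \<noteq> 0" using elim by (metis eq_iff_diff_eq_0 greaterThanLessThan_iff less_irrefl of_real_eq_1_iff)
      have "dist 1 (complex_of_real x) = 1 - x"
        using elim by (metis abs_of_pos dist_norm diff_gt_0_iff_gt greaterThanLessThan_iff norm_of_real of_real_1 of_real_diff)
      then have k: "k * ?F (of_real x) = G1 (of_real x) + (1 - of_real x) powr (c - a - b) * G2 (of_real x)"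
        using elim by (intro 0) auto
      have "(1 - complex_of_real x) powr (a + b - c) * (1 - of_real x) powr (c - a - b) = 1"
        using nz by (simp flip: powr_add)
      then have "(1 - of_real x) powr (a + b - c) * (k * ?F (of_real x)) = (1 - of_real x) powr (a + b - c) * G1 (of_real x) + G2 (of_real x)"
        unfolding k by (simp add: distrib_left mult.assoc[symmetric])
      then show ?case by (simp add: mult_ac)
    qed
    ultimately have "0 * G1 1 + G2 1 = k * (Gamma (a + b - c) * rGamma a * rGamma b)"
      by (intro tendsto_unique[of "at_left (1::real)"]) (auto simp: tendsto_cong)
    then show ?case by (simp add: mult_ac)
  next
    case (Suc n)
    let ?F = "eval_fps (fps_hyp2F1_reg a b c)"
    define \<mu> where "\<mu> = a + b - c"
    define S where "S = ball 0 1 \<inter> ball (1::complex) r"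
    have S: "open S" by (simp add: S_def open_Int)
    have \<mu>: "\<mu> \<notin> \<int>" using Suc.prems by (simp add: \<mu>_def)
    define H1 where "H1 = deriv G1"
    \<comment> \<open>The derivative of \<open>(1 - w) powr (- \<mu>) * G2 w\<close> is
      \<open>(1 - w) powr (- \<mu> - 1) * H2 w\<close>, and
      \<open>H2 1 = \<mu> * G2 1\<close>.\<close>
    define H2 where "H2 = (\<lambda>w. \<mu> * G2 w + (1 - w) * deriv G2 w)"
    have "H2 1 = (k * (a * b)) * Gamma ((a + 1) + (b + 1) - (c + 1)) * rGamma (a + 1) * rGamma (b + 1)"
    proof (rule Suc.IH)
      show "0 < Re (a + 1 + (b + 1) - (c + 1)) + real n" "0 < Re (c + 1) + real n"
        using Suc.prems by simp_all
      show "a + 1 + (b + 1) - (c + 1) \<notin> \<int>"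
      proof
        assume "a + 1 + (b + 1) - (c + 1) \<in> \<int>"
        then have "a + 1 + (b + 1) - (c + 1) - 1 \<in> \<int>" by (rule Ints_diff[OF _ Ints_1])
        also have "a + 1 + (b + 1) - (c + 1) - 1 = a + b - c" by simp
        finally show False using Suc.prems(3) by blast
      qed
      show "H1 holomorphic_on ball 1 r" "H2 holomorphic_on ball 1 r"
        unfolding H1_def H2_def by (auto intro!: holomorphic_intros holomorphic_deriv Suc.prems)
      fix w :: complex assume w: "w \<in> ball 0 1" "w \<in> ball 1 r"
      then have wS: "w \<in> S" by (simp add: S_def)
      have cut: "1 - w \<notin> \<real>\<^sub>\<le>\<^sub>0" using w ball_subset_cut_plane cut_plane_iff by blast
      then have nz: "1 - w \<noteq> 0" by auto
      have "?F holomorphic_on ball 0 1" using hyp_rec_expansion(1)[OF hyp_rec_reg] .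
      then have dF: "(?F has_field_derivative deriv ?F w) (at w)" 
        using w(1) by (intro holomorphic_derivI[of _ "ball 0 1"]) auto
      have "ereal (norm w) < 1" using w by (simp add: one_ereal_def)
      then have rad: "norm w < fps_conv_radius (fps_hyp2F1_reg a b c)" for a b c
        by (rule less_le_trans[OF _ conv_radius_hyp_rec[OF hyp_rec_reg]])
      then have "deriv ?F w = eval_fps (fps_const (a * b) * fps_hyp2F1_reg (a + 1) (b + 1) (c + 1)) w"
        by (simp add: eval_fps_deriv flip: fps_deriv_hyp2F1_reg)
      also have "\<dots> = a * b * eval_fps (fps_hyp2F1_reg (a + 1) (b + 1) (c + 1)) w"
        using rad by (subst eval_fps_mult) auto
      finally have dF': "deriv ?F w = a * b * eval_fps (fps_hyp2F1_reg (a + 1) (b + 1) (c + 1)) w" .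
      have dG: "(G1 has_field_derivative deriv G1 w) (at w)" "(G2 has_field_derivative deriv G2 w) (at w)"
        using w(2) by (auto intro!: holomorphic_derivI[of _ "ball 1 r"] Suc.prems)
      have "((\<lambda>w. G1 w + (1 - w) powr (c - a - b) * G2 w) has_field_derivative
          H1 w + (1 - w) powr (c - a - b - 1) * H2 w) (at w)"
      proof -
        define t where "t = c - a - b"
        define q where "q = (1 - w) powr (t - 1)"
        have t: "\<mu> = - t" by (simp add: t_def \<mu>_def)
        have d: "((\<lambda>w. (1 - w) powr t) has_field_derivative - t * q) (at w)"
          unfolding q_def using cut nz by (auto intro!: derivative_eq_intros simp: powr_diff)
        have e: "(1 - w) powr t = q * (1 - w)"
          unfolding q_def using nz by (simp add: powr_diff)
        show ?thesis
          unfolding t_def[symmetric] q_def[symmetric]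
          by (rule DERIV_cong[OF DERIV_add[OF dG(1) DERIV_mult[OF d dG(2)]]])
             (simp add: H1_def H2_def t e algebra_simps)
      qed
      moreover have "eventually (\<lambda>w. w \<in> S) (nhds w)" using S wS by (rule eventually_nhds_in_open)
      then have "eventually (\<lambda>w. k * ?F w = G1 w + (1 - w) powr (c - a - b) * G2 w) (nhds w)"
        by eventually_elim (use Suc.prems(6) in \<open>auto simp: S_def\<close>)
      ultimately have "((\<lambda>w. k * ?F w) has_field_derivative
          H1 w + (1 - w) powr (c - a - b - 1) * H2 w) (at w)"
        by (subst DERIV_cong_ev[OF refl _ refl])
      moreover have "((\<lambda>w. k * ?F w) has_field_derivative k * deriv ?F w) (at w)"
        by (intro DERIV_cmult dF)
      ultimately have "k * deriv ?F w = H1 w + (1 - w) powr (c - a - b - 1) * H2 w"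
        using DERIV_unique by blast
      then have "k * (a * b) * eval_fps (fps_hyp2F1_reg (a + 1) (b + 1) (c + 1)) w = H1 w + (1 - w) powr (c - a - b - 1) * H2 w"
        by (simp add: dF' mult.assoc)
      also have "c - a - b - 1 = c + 1 - (a + 1) - (b + 1)" by simp
      finally show "k * (a * b) * eval_fps (fps_hyp2F1_reg (a + 1) (b + 1) (c + 1)) w =
         H1 w + (1 - w) powr (c + 1 - (a + 1) - (b + 1)) * H2 w" .
    qed
    also have "(a + 1) + (b + 1) - (c + 1) = \<mu> + 1" by (simp add: \<mu>_def)
    \<comment> \<open>Both sides thus carry a factor \<open>\<mu>\<close>, nonzero since
      \<open>\<mu>\<close> is not an integer. The factors \<open>a\<close> and \<open>b\<close> are
      absorbed by \<open>a * rGamma (a + 1) = rGamma a\<close>, even if they vanish.\<close>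
    also have "Gamma (\<mu> + 1) = \<mu> * Gamma \<mu>" using \<mu> by (intro Gamma_plus1) (auto dest: nonpos_Ints_Int)
    also have "k * (a * b) * (\<mu> * Gamma \<mu>) * rGamma (a + 1) * rGamma (b + 1)
        = \<mu> * (k * Gamma \<mu> * (a * rGamma (a + 1)) * (b * rGamma (b + 1)))"
      by (simp only: mult_ac)
    also have "H2 1 = \<mu> * G2 1" by (simp add: H2_def)
    finally have "\<mu> * G2 1 = \<mu> * (k * Gamma \<mu> * (a * rGamma (a + 1)) * (b * rGamma (b + 1)))" .
    moreover have "\<mu> \<noteq> 0" using \<mu> by auto
    ultimately have "G2 1 = k * Gamma \<mu> * (a * rGamma (a + 1)) * (b * rGamma (b + 1))" by simp
    then show ?case by (simp add: rGamma_plus1 \<mu>_def)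
  qed
qed

section \<open>Connection between 0 and 1\<close>

lemma DERIV_powr_const:
  fixes z s :: complex
  assumes "z \<notin> \<real>\<^sub>\<le>\<^sub>0"
  shows "((\<lambda>z. z powr s) has_field_derivative z powr s * (s / z)) (at z)"
proof -
  have "z \<noteq> 0" using assms by auto
  with assms show ?thesis by (auto intro!: derivative_eq_intros simp: powr_diff)
qed

lemma DERIV_one_minus_powr_const:
  fixes z s :: complex
  assumes "1 - z \<notin> \<real>\<^sub>\<le>\<^sub>0"
  shows "((\<lambda>z. (1 - z) powr s) has_field_derivative - ((1 - z) powr s * (s / (1 - z)))) (at z)"
proof -
  have "((\<lambda>z. 1 - z) has_field_derivative - 1) (at z)" by (auto intro!: derivative_eq_intros)
  from DERIV_chain2[OF DERIV_powr_const[OF assms] this] show ?thesis by simp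
qed

text \<open>Star-shaped about 1/2, which lies in the gap between the two cuts.\<close>

lemma connected_double_cut: "connected {w :: complex. w \<notin> \<real>\<^sub>\<le>\<^sub>0 \<and> 1 - w \<notin> \<real>\<^sub>\<le>\<^sub>0}"
proof -
  let ?S = "{w :: complex. w \<notin> \<real>\<^sub>\<le>\<^sub>0 \<and> 1 - w \<notin> \<real>\<^sub>\<le>\<^sub>0}"
  have S: "w \<in> ?S \<longleftrightarrow> Im w \<noteq> 0 \<or> 0 < Re w \<and> Re w < 1" for w
    by (auto simp: complex_nonpos_Reals_iff)
  have "starlike ?S" unfolding starlike_def
  proof (intro bexI[of _ "1 / 2"] ballI subsetI)
    fix x y :: complex assume "x \<in> ?S" "y \<in> closed_segment (1 / 2) x"
    then obtain u where u: "0 \<le> u" "u \<le> 1" "y = (1 - u) *\<^sub>R (1 / 2) + u *\<^sub>R x"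
      by (auto simp: closed_segment_def)
    have Re: "Re y = (1 - u) / 2 + u * Re x" and Im: "Im y = u * Im x" by (simp_all add: u)
    show "y \<in> ?S"
    proof (cases "u = 0 \<or> Im x \<noteq> 0")
      case True
      then show ?thesis unfolding S using Re Im by auto
    next
      case False
      then have x: "0 < Re x" "Re x < 1" "0 < u" using \<open>x \<in> ?S\<close>[unfolded S] u by auto
      have "u * Re x > 0" "u * Re x < u" using x by auto
      then have "0 < Re y \<and> Re y < 1" using Re u(1,2) by (simp add: field_simps)
      then show ?thesis unfolding S by blast
    qed
  qed (simp only: S, simp)
  then show ?thesis by (rule starlike_imp_connected)
qed

text \<open>Among the equivalent forms of the solutions at 1, those with the factor
  \<open>w powr (1 - c)\<close> are taken: for the Legendre parameters \<open>F1\<close> and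
  \<open>F2\<close> are then the two functions of the final formula, and no further Euler
  transformation is needed.\<close>

theorem hyp2F1_reg_connection_0_1:
  fixes a b c :: complex
  assumes "a + b - c \<notin> \<int>"
    and P: "P holomorphic_on cut_plane" "P has_fps_expansion fps_hyp2F1_reg a b c"
    and F1: "F1 holomorphic_on cut_plane" "F1 has_fps_expansion H1" "hyp_rec (a - c + 1) (b - c + 1) (a + b - c + 1) H1" "F1 0 = 1"
    and F2: "F2 holomorphic_on cut_plane" "F2 has_fps_expansion H2" "hyp_rec (1 - a) (1 - b) (c - a - b + 1) H2" "F2 0 = 1"
    and w: "w \<notin> \<real>\<^sub>\<le>\<^sub>0" "1 - w \<notin> \<real>\<^sub>\<le>\<^sub>0"
  shows "P w = Gamma (c - a - b) * rGamma (c - a) * rGamma (c - b) * (w powr (1 - c) * F1 (1 - w))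
            + Gamma (a + b - c) * rGamma a * rGamma b * (w powr (1 - c) * (1 - w) powr (c - a - b) * F2 (1 - w))"
proof -
  define \<mu> where "\<mu> = a + b - c"
  have \<mu>: "\<mu> \<noteq> 0" using assms(1) by (auto simp: \<mu>_def)
  define T where "T = - (\<real>\<^sub>\<le>\<^sub>0 :: complex set)"
  have T: "open T" by (simp add: T_def open_Compl)
  have Tcut: "1 - z \<in> cut_plane" if "z \<in> T" for z using that unfolding cut_plane_iff T_def by simp
  define S where "S = {w :: complex. w \<notin> \<real>\<^sub>\<le>\<^sub>0 \<and> 1 - w \<notin> \<real>\<^sub>\<le>\<^sub>0}"
  have "S = T \<inter> (\<lambda>w. 1 - w) -` T" by (auto simp: S_def T_def)
  then have "open S" by (auto intro!: open_Int T open_vimage continuous_intros)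
  moreover have "connected S" unfolding S_def by (rule connected_double_cut)
  moreover have "0 \<notin> S" "1 \<notin> S" by (auto simp: S_def)
  ultimately have S: "open S" "connected S" "0 \<notin> S" "1 \<notin> S" .
  have ST: "S \<subseteq> T" by (auto simp: S_def T_def)
  have Scut: "S \<subseteq> cut_plane" using cut_plane_iff by (auto simp: S_def)
  define f1 where "f1 = (\<lambda>w. F1 (1 - w))"
  define f2 where "f2 = (\<lambda>w. F2 (1 - w))"
  have "(\<lambda>w. 1 - w) holomorphic_on T" by (intro holomorphic_intros)
  moreover have "(\<lambda>w. 1 - w) ` T \<subseteq> cut_plane" using Tcut by (rule image_subsetI)
  ultimately have f: "f1 holomorphic_on T" "f2 holomorphic_on T"
    unfolding f1_def f2_def
    using holomorphic_on_compose_gen[OF _ F1(1), unfolded o_def]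
      holomorphic_on_compose_gen[OF _ F2(1), unfolded o_def] by simp_all
  define g2 where "g2 = (\<lambda>w. w powr (1 - c) * f2 w)"
  define \<phi>1 where "\<phi>1 = (\<lambda>w. w powr (1 - c) * f1 w)"
  define \<phi>2 where "\<phi>2 = (\<lambda>w. (1 - w) powr (c - a - b) * g2 w)"
  have g2T: "g2 holomorphic_on T" and \<phi>1T: "\<phi>1 holomorphic_on T"
    unfolding g2_def \<phi>1_def by (intro holomorphic_intros f; simp add: T_def)+
  have \<phi>2S: "\<phi>2 holomorphic_on S"
    unfolding \<phi>2_def by (intro holomorphic_intros holomorphic_on_subset[OF g2T ST]) (auto simp: S_def)
  have ode1: "hyp_ode a b c \<phi>1 z = 0" if "z \<in> T" for z
  proof -
    have "hyp_ode a b c \<phi>1 z = z powr (1 - c) * hyp_ode (a - c + 1) (b - c + 1) (2 - c) f1 z"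
      unfolding \<phi>1_def using hyp_ode_shift_exponent_0[OF T f(1) that] that by (simp add: T_def)
    also have "hyp_ode (a - c + 1) (b - c + 1) (2 - c) f1 z = hyp_ode (a - c + 1) (b - c + 1) (a + b - c + 1) F1 (1 - z)"
      unfolding f1_def using hyp_ode_reflect[OF open_cut_plane F1(1) Tcut[OF that], of "a - c + 1" "b - c + 1" "2 - c"]
      by (simp add: algebra_simps)
    also have "\<dots> = 0"
      using hyp_ode_of_rec[OF F1(3,2,1) open_cut_plane connected_cut_plane zero_in_cut_plane Tcut[OF that]] .
    finally show ?thesis by simp
  qed
  have ode2: "hyp_ode a b c \<phi>2 z = 0" if "z \<in> S" for z
  proof -
    have zT: "z \<in> T" using that ST by auto
    have "hyp_ode a b c \<phi>2 z = (1 - z) powr (c - a - b) * hyp_ode (c - a) (c - b) c g2 z"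
      unfolding \<phi>2_def using hyp_ode_Euler[OF T g2T zT] that by (simp add: S_def)
    also have "hyp_ode (c - a) (c - b) c g2 z = z powr (1 - c) * hyp_ode (1 - a) (1 - b) (2 - c) f2 z"
      unfolding g2_def using hyp_ode_shift_exponent_0[OF T f(2) zT, of "c - a" "c - b" c] zT by (simp add: T_def)
    also have "hyp_ode (1 - a) (1 - b) (2 - c) f2 z = hyp_ode (1 - a) (1 - b) (c - a - b + 1) F2 (1 - z)"
      unfolding f2_def using hyp_ode_reflect[OF open_cut_plane F2(1) Tcut[OF zT], of "1 - a" "1 - b" "2 - c"]
      by (simp add: algebra_simps)
    also have "\<dots> = 0"
      using hyp_ode_of_rec[OF F2(3,2,1) open_cut_plane connected_cut_plane zero_in_cut_plane Tcut[OF zT]] .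
    finally show ?thesis by simp
  qed
  have odeP: "hyp_ode a b c P z = 0" if "z \<in> S" for z
    using hyp_ode_of_rec[OF hyp_rec_reg P(2,1) open_cut_plane connected_cut_plane zero_in_cut_plane] that Scut by blast
  define \<omega> where "\<omega> = (\<lambda>w. w powr c * (1 - w) powr (a + b - c + 1))"
  have \<omega>: "(\<omega> has_field_derivative \<omega> z * (c - (a + b + 1) * z) / (z * (1 - z))) (at z)" if "z \<in> S" for z
  proof -
    have *: "z \<notin> \<real>\<^sub>\<le>\<^sub>0" "1 - z \<notin> \<real>\<^sub>\<le>\<^sub>0" "z \<noteq> 0" "1 - z \<noteq> 0" using that by (auto simp: S_def)
    have "(\<omega> has_field_derivative \<omega> z * (c / z - (a + b - c + 1) / (1 - z))) (at z)"
      unfolding \<omega>_def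
      by (rule DERIV_cong[OF DERIV_mult[OF DERIV_powr_const[OF *(1)] DERIV_one_minus_powr_const[OF *(2)]]])
         (simp add: algebra_simps)
    also have "c / z - (a + b - c + 1) / (1 - z) = (c - (a + b + 1) * z) / (z * (1 - z))"
      using * by (simp add: divide_simps) (simp add: algebra_simps)
    finally show ?thesis by simp
  qed
  \<comment> \<open>\<open>\<omega>\<close> times the Wronskian of \<open>\<phi>1\<close> and
    \<open>\<phi>2\<close> after cancelling the powers of \<open>1 - z\<close>. In this form it
    extends across the point 1, where its value is simply \<open>\<mu>\<close>.\<close>
  define \<kappa> where "\<kappa> = (\<lambda>z. z powr (2 - c) * (\<mu> * f1 z * f2 z + (1 - z) * (f1 z * deriv f2 z - deriv f1 z * f2 z)))"
  have W: "\<omega> z * (\<phi>1 z * deriv \<phi>2 z - deriv \<phi>1 z * \<phi>2 z) = \<kappa> z" if "z \<in> S" for z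
  proof -
    have *: "z \<notin> \<real>\<^sub>\<le>\<^sub>0" "1 - z \<notin> \<real>\<^sub>\<le>\<^sub>0" "z \<noteq> 0" "1 - z \<noteq> 0" "z \<noteq> 1" "z \<in> T" using that ST by (auto simp: S_def)
    note df = holomorphic_derivI[OF f(1) T *(6)] holomorphic_derivI[OF f(2) T *(6)]
    define p where "p = z powr (1 - c)"
    define q where "q = (1 - z) powr (c - a - b)"
    have d\<phi>1: "(\<phi>1 has_field_derivative p * ((1 - c) / z * f1 z + deriv f1 z)) (at z)"
      unfolding \<phi>1_def p_def
      by (rule DERIV_cong[OF DERIV_mult[OF DERIV_powr_const[OF *(1)] df(1)]]) (simp add: algebra_simps)
    from d\<phi>1 have d1: "deriv \<phi>1 z = p * ((1 - c) / z * f1 z + deriv f1 z)" by (rule DERIV_imp_deriv)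
    have dg2: "(g2 has_field_derivative p * ((1 - c) / z * f2 z + deriv f2 z)) (at z)"
      unfolding g2_def p_def
      by (rule DERIV_cong[OF DERIV_mult[OF DERIV_powr_const[OF *(1)] df(2)]]) (simp add: algebra_simps)
    have \<mu>': "c - a - b = - \<mu>" by (simp add: \<mu>_def)
    have "(\<phi>2 has_field_derivative q * (\<mu> / (1 - z) * (p * f2 z) + p * ((1 - c) / z * f2 z + deriv f2 z))) (at z)"
      unfolding \<phi>2_def q_def \<mu>'
      by (rule DERIV_cong[OF DERIV_mult[OF DERIV_one_minus_powr_const[OF *(2)] dg2]])
         (simp add: g2_def p_def algebra_simps)
    then have d2: "deriv \<phi>2 z = q * (\<mu> / (1 - z) * (p * f2 z) + p * ((1 - c) / z * f2 z + deriv f2 z))" by (rule DERIV_imp_deriv)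
    have "\<phi>1 z * deriv \<phi>2 z - deriv \<phi>1 z * \<phi>2 z = p\<^sup>2 * q / (1 - z) * (\<mu> * f1 z * f2 z + (1 - z) * (f1 z * deriv f2 z - deriv f1 z * f2 z))"
      unfolding d1 d2 unfolding \<phi>1_def \<phi>2_def g2_def p_def[symmetric] q_def[symmetric] using *(3,4)
      by (simp add: divide_simps) (simp add: algebra_simps power2_eq_square)
    moreover have "\<omega> z * (p\<^sup>2 * q / (1 - z)) = z powr (2 - c)"
    proof -
      have "\<omega> z * (p\<^sup>2 * q / (1 - z)) = (z powr c * z powr (1 - c) * z powr (1 - c)) *
         ((1 - z) powr (a + b - c + 1) * (1 - z) powr (c - a - b) / (1 - z))"
        by (simp add: \<omega>_def p_def q_def power2_eq_square)
      also have "(1 - z) powr (a + b - c + 1) * (1 - z) powr (c - a - b) = (1 - z) powr 1"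
        by (simp flip: powr_add)
      also have "z powr c * z powr (1 - c) * z powr (1 - c) = z powr (c + (1 - c) + (1 - c))"
        by (simp only: powr_add)
      also have "c + (1 - c) + (1 - c) = 2 - c" by simp
      finally show ?thesis using * by simp
    qed
    ultimately show ?thesis by (simp only: \<kappa>_def mult.assoc[symmetric])
  qed
  obtain K where K: "\<And>z. z \<in> S \<Longrightarrow> \<kappa> z = K"
  proof -
    obtain K where "\<And>z. z \<in> S \<Longrightarrow> \<omega> z * (\<phi>1 z * deriv \<phi>2 z - deriv \<phi>1 z * \<phi>2 z) = K"
      using hyp_ode_Wronskian_const[OF S \<omega> holomorphic_on_subset[OF \<phi>1T ST] ode1 \<phi>2S ode2] ST by blast
    with W show ?thesis by (intro that[of K]) simp
  qed
  have "K = \<mu>"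
  proof -
    have \<kappa>T: "\<kappa> holomorphic_on T" unfolding \<kappa>_def using T
      by (intro holomorphic_intros f holomorphic_deriv) (auto simp: T_def)
    have 1: "1 \<in> T" by (simp add: T_def)
    have "isCont \<kappa> 1" using \<kappa>T T 1
      by (meson continuous_on_eq_continuous_at holomorphic_on_imp_continuous_on)
    then have "((\<lambda>x. \<kappa> (of_real x)) \<longlongrightarrow> \<kappa> 1) (at_left (1::real))"
      using tendsto_of_real[OF tendsto_ident_at, of 1 "{..<1::real}"] by (intro isCont_tendsto_compose[of 1 \<kappa>]) simp_all
    moreover have "eventually (\<lambda>x::real. x \<in> {0<..<1}) (at_left 1)"
      by (rule eventually_at_left_real) simp
    then have "\<forall>\<^sub>F x in at_left 1. \<kappa> (of_real x) = K"
      by eventually_elim (rule K, simp add: S_def complex_nonpos_Reals_iff)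
    ultimately have "((\<lambda>x::real. K) \<longlongrightarrow> \<kappa> 1) (at_left 1)"
      by (rule Lim_transform_eventually)
    then have "\<kappa> 1 = K" by (simp add: tendsto_const_iff)
    moreover have "\<kappa> 1 = \<mu>" using F1(4) F2(4) by (simp add: \<kappa>_def f1_def f2_def)
    ultimately show ?thesis by simp
  qed
  with \<mu> have "K \<noteq> 0" by simp
  then obtain A B where AB: "\<And>z. z \<in> S \<Longrightarrow> P z = A * \<phi>1 z + B * \<phi>2 z"
    using hyp_ode_span[OF S \<omega> holomorphic_on_subset[OF \<phi>1T ST] _ \<phi>2S ode2 holomorphic_on_subset[OF P(1) Scut] odeP, of K]
      W K ode1 ST by (metis subsetD)
  have ball: "z \<in> T" if "z \<in> ball 1 1" for z
    using one_minus_notin_nonpos_Reals[of "1 - z"] that by (simp add: T_def dist_norm)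
  have bS: "z \<in> S" if "z \<in> ball 0 1" "z \<in> ball 1 1" for z
    using ball[OF that(2)] one_minus_notin_nonpos_Reals[of z] that(1) by (simp add: S_def T_def)
  have Pe: "P z = eval_fps (fps_hyp2F1_reg a b c) z" if "z \<in> ball 0 1" for z
    using has_fps_expansion_imp_eval_fps_eq[OF P(2), of z 1] that
      holomorphic_on_subset[OF P(1) ball_subset_cut_plane] by simp
  have B: "B = Gamma (a + b - c) * rGamma a * rGamma b"
  proof -
    have "(\<lambda>w. B * g2 w) 1 = 1 * Gamma (a + b - c) * rGamma a * rGamma b"
    proof (rule hyp2F1_reg_singular_coeff[OF assms(1) zero_less_one])
      show "(\<lambda>w. A * \<phi>1 w) holomorphic_on ball 1 1" "(\<lambda>w. B * g2 w) holomorphic_on ball 1 1"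
        using ball by (auto intro!: holomorphic_intros holomorphic_on_subset[OF \<phi>1T] holomorphic_on_subset[OF g2T])
      show "1 * eval_fps (fps_hyp2F1_reg a b c) z = A * \<phi>1 z + (1 - z) powr (c - a - b) * (B * g2 z)"
        if "z \<in> ball 0 1" "z \<in> ball 1 1" for z
        using AB[OF bS[OF that]] Pe[OF that(1)] by (simp add: \<phi>2_def)
    qed
    then show ?thesis using F2(4) by (simp add: g2_def f2_def)
  qed
  have A: "A = Gamma (c - a - b) * rGamma (c - a) * rGamma (c - b)"
  proof -
    \<comment> \<open>Multiplication by \<open>(1 - z) powr (a + b - c)\<close> makes the terms
      trade places: \<open>B * g2\<close> becomes the regular part and \<open>A * \<phi>1\<close>
      the coefficient of the singular power.\<close>
    have "(\<lambda>w. A * \<phi>1 w) 1 = 1 * Gamma ((c - a) + (c - b) - c) * rGamma (c - a) * rGamma (c - b)"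
    proof (rule hyp2F1_reg_singular_coeff[OF _ zero_less_one])
      show "c - a + (c - b) - c \<notin> \<int>"
      proof
        assume "c - a + (c - b) - c \<in> \<int>"
        then have "- (c - a + (c - b) - c) \<in> \<int>" by (rule Ints_minus)
        also have "- (c - a + (c - b) - c) = a + b - c" by simp
        finally show False using assms(1) by blast
      qed
      show "(\<lambda>w. A * \<phi>1 w) holomorphic_on ball 1 1" "(\<lambda>w. B * g2 w) holomorphic_on ball 1 1"
        using ball by (auto intro!: holomorphic_intros holomorphic_on_subset[OF \<phi>1T] holomorphic_on_subset[OF g2T])
      fix z :: complex assume z: "z \<in> ball 0 1" "z \<in> ball 1 1"
      have nz: "1 - z \<noteq> 0" using S(4) bS[OF z] by auto
      have "eval_fps (fps_hyp2F1_reg (c - a) (c - b) c) z = (1 - z) powr (a + b - c) * P z"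
        using hyp2F1_reg_Euler[of z a b c] z(1) by (simp add: Pe)
      also have "\<dots> = (1 - z) powr (a + b - c) * (A * \<phi>1 z) + ((1 - z) powr (a + b - c) * (1 - z) powr (c - a - b)) * (B * g2 z)"
        by (simp add: AB[OF bS[OF z]] \<phi>2_def algebra_simps)
      also have "(1 - z) powr (a + b - c) * (1 - z) powr (c - a - b) = 1"
        using nz by (simp flip: powr_add)
      finally show "1 * eval_fps (fps_hyp2F1_reg (c - a) (c - b) c) z = B * g2 z + (1 - z) powr (c - (c - a) - (c - b)) * (A * \<phi>1 z)"
        by (simp add: algebra_simps)
    qed
    then show ?thesis using F1(4) by (simp add: \<phi>1_def f1_def algebra_simps)
  qed
  have "w \<in> S" using w by (simp add: S_def)
  from AB[OF this] show ?thesis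
    unfolding A B \<phi>1_def \<phi>2_def g2_def f1_def f2_def by (simp add: mult_ac)
qed

section \<open>Solutions near infinity\<close>

text \<open>\<open>Ln (1 - w)\<close> maps this set onto a half-strip, which is convex;
  \<open>exp\<close> carries connectedness back.\<close>

lemma connected_cut_exterior: "connected {w :: complex. 1 - w \<notin> \<real>\<^sub>\<le>\<^sub>0 \<and> norm (1 - w) > 1}"
proof -
  let ?R = "{z. Re z > 0} \<inter> {z. Im z > - pi} \<inter> {z. Im z < pi}"
  have "convex ?R"
    by (intro convex_Int convex_halfspace_Re_gt convex_halfspace_Im_gt convex_halfspace_Im_lt)
  then have "connected ((\<lambda>z. 1 - exp z) ` ?R)"
    by (intro connected_continuous_image continuous_intros convex_connected)
  also have "(\<lambda>z. 1 - exp z) ` ?R = {w :: complex. 1 - w \<notin> \<real>\<^sub>\<le>\<^sub>0 \<and> norm (1 - w) > 1}"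
  proof (intro equalityI subsetI)
    fix w assume "w \<in> (\<lambda>z. 1 - exp z) ` ?R"
    then obtain z where z: "w = 1 - exp z" "Re z > 0" "Im z > - pi" "Im z < pi" by auto
    have "Ln (exp z) = z" using z by simp
    then have "\<not> (Re (exp z) < 0 \<and> Im (exp z) = 0)" using z(4) Im_Ln_eq_pi[of "exp z"] by simp
    moreover have "\<not> (Re (exp z) = 0 \<and> Im (exp z) = 0)" 
      using exp_not_eq_zero[of z] by (auto simp only: complex_eq_iff zero_complex.sel)
    ultimately have "exp z \<notin> \<real>\<^sub>\<le>\<^sub>0" unfolding complex_nonpos_Reals_iff by linarith
    then show "w \<in> {w :: complex. 1 - w \<notin> \<real>\<^sub>\<le>\<^sub>0 \<and> norm (1 - w) > 1}" using z by simp
  next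
    fix w :: complex assume "w \<in> {w :: complex. 1 - w \<notin> \<real>\<^sub>\<le>\<^sub>0 \<and> norm (1 - w) > 1}"
    then have w: "1 - w \<notin> \<real>\<^sub>\<le>\<^sub>0" "norm (1 - w) > 1" by auto
    then have nz: "1 - w \<noteq> 0" by auto
    have "Im (Ln (1 - w)) < pi"
      using w(1) Im_Ln_le_pi[OF nz] Im_Ln_eq_pi[OF nz] by (fastforce simp: complex_nonpos_Reals_iff)
    then have "Ln (1 - w) \<in> ?R" using w nz mpi_less_Im_Ln[OF nz] by simp
    moreover have "w = 1 - exp (Ln (1 - w))" using nz by simp
    ultimately show "w \<in> (\<lambda>z. 1 - exp z) ` ?R" by blast
  qed
  finally show ?thesis .
qed

lemma hyp_ode_commute: "hyp_ode a b c f z = hyp_ode b a c f z"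
  by (simp add: hyp_ode_def algebra_simps)

text \<open>Only the existence of \<open>f\<close> and \<open>g\<close> matters: they will show that
  the continuation is holomorphic near the imaginary axis, so their constants stay
  undetermined.\<close>

lemma hyp_ode_span_infinity:
  fixes a b c :: complex
  assumes ab: "a - b \<notin> \<int>"
    and P: "P holomorphic_on cut_plane" "\<And>w. w \<in> cut_plane \<Longrightarrow> hyp_ode a b c P w = 0"
  obtains f g where "f holomorphic_on ball 0 1" "g holomorphic_on ball 0 1"
    "\<And>w. 1 - w \<notin> \<real>\<^sub>\<le>\<^sub>0 \<Longrightarrow> norm (1 - w) > 1 \<Longrightarrow>
       P w = (1 - w) powr (- a) * f (1 / (1 - w)) + (1 - w) powr (- b) * g (1 / (1 - w))"
proof -
  have nonint: "z + 1 \<notin> \<int>\<^sub>\<le>\<^sub>0" if "z \<notin> \<int>" for z :: complex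
  proof
    assume "z + 1 \<in> \<int>\<^sub>\<le>\<^sub>0"
    then have "z + 1 - 1 \<in> \<int>" by (intro Ints_diff) (auto dest: nonpos_Ints_Int)
    with that show False by simp
  qed
  have ba: "b - a \<notin> \<int>" using ab Ints_minus[of "b - a"] by auto
  define H1 where "H1 = fps_hypergeo [a, c - b] [a - b + 1] 1"
  define H2 where "H2 = fps_hypergeo [b, c - a] [b - a + 1] 1"
  define f1 where "f1 = eval_fps H1"
  define f2 where "f2 = eval_fps H2"
  have H: "hyp_rec a (c - b) (a - b + 1) H1" "hyp_rec b (c - a) (b - a + 1) H2"
    unfolding H1_def H2_def by (intro hyp_rec_hypergeo nonint ab ba)+
  have f: "f1 holomorphic_on ball 0 1" "f2 holomorphic_on ball 0 1"
    unfolding f1_def f2_def by (intro hyp_rec_expansion(1)[OF H(1)] hyp_rec_expansion(1)[OF H(2)])+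
  have f0: "f1 0 = 1" "f2 0 = 1" by (simp_all add: f1_def f2_def H1_def H2_def eval_fps_at_0 del: fps_hypergeo_nth)
  have fode: "hyp_ode a (c - b) (a - b + 1) f1 t = 0" "hyp_ode b (c - a) (b - a + 1) f2 t = 0" if "t \<in> ball 0 1" for t
    unfolding f1_def f2_def using that
    by (auto intro!: hyp_ode_of_rec[OF H(1) hyp_rec_expansion(2,1)[OF H(1)]] hyp_ode_of_rec[OF H(2) hyp_rec_expansion(2,1)[OF H(2)]])
  define S where "S = {w :: complex. 1 - w \<notin> \<real>\<^sub>\<le>\<^sub>0 \<and> norm (1 - w) > 1}"
  define m where "m = (\<lambda>w :: complex. 1 / (1 - w))"
  have "S = cut_plane \<inter> {w. norm (1 - w) > 1}" using cut_plane_iff by (auto simp: S_def)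
  moreover have "open {w :: complex. norm (1 - w) > 1}" by (intro open_Collect_less continuous_intros)
  ultimately have "open S" using open_cut_plane by auto
  moreover have "connected S" unfolding S_def by (rule connected_cut_exterior)
  moreover have "0 \<notin> S" "1 \<notin> S" by (auto simp: S_def)
  ultimately have S: "open S" "connected S" "0 \<notin> S" "1 \<notin> S" .
  have Scut: "S \<subseteq> cut_plane" using cut_plane_iff by (auto simp: S_def)
  have mb: "m w \<in> ball 0 1" if "w \<in> S" for w
    using that by (auto simp: S_def m_def norm_divide divide_simps)
  define \<psi>1 where "\<psi>1 = (\<lambda>w. (1 - w) powr (- a) * f1 (m w))"
  define \<psi>2 where "\<psi>2 = (\<lambda>w. (1 - w) powr (- b) * f2 (m w))"
  have ode1: "hyp_ode a b c \<psi>1 z = 0" if "z \<in> S" for z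
    unfolding \<psi>1_def m_def 
    using hyp_ode_infinity[OF open_ball f(1), of z a b c] mb[OF that] fode(1)[OF mb[OF that]] that by (simp add: m_def S_def)
  have ode2: "hyp_ode a b c \<psi>2 z = 0" if "z \<in> S" for z
    unfolding \<psi>2_def m_def hyp_ode_commute[of a b]
    using hyp_ode_infinity[OF open_ball f(2), of z b a c] mb[OF that] fode(2)[OF mb[OF that]] that by (simp add: m_def S_def)
  have dm: "(m has_field_derivative (m z)\<^sup>2) (at z)" if "z \<in> S" for z
  proof -
    have "z \<noteq> 1" using that S by auto
    then show ?thesis unfolding m_def by (auto intro!: derivative_eq_intros simp: power2_eq_square)
  qed
  have d\<psi>: "((\<lambda>w. (1 - w) powr (- s) * h (m w)) has_field_derivative 
      (1 - z) powr (- s) * m z * (s * h (m z) + m z * deriv h (m z))) (at z)"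
    if z: "z \<in> S" and h: "h holomorphic_on ball 0 1" for z h s
  proof -
    have "1 - z \<notin> \<real>\<^sub>\<le>\<^sub>0" using z by (simp add: S_def)
    moreover have "((\<lambda>w. h (m w)) has_field_derivative deriv h (m z) * (m z)\<^sup>2) (at z)"
      using DERIV_chain2[OF holomorphic_derivI[OF h open_ball mb[OF z]] dm[OF z]] by simp
    ultimately show ?thesis
      by (intro DERIV_cong[OF DERIV_mult[OF DERIV_one_minus_powr_const]]) (auto simp: m_def algebra_simps power2_eq_square)
  qed
  have \<psi>S: "\<psi>1 holomorphic_on S" "\<psi>2 holomorphic_on S"
    unfolding \<psi>1_def \<psi>2_def using d\<psi> f S(1) by (auto simp: holomorphic_on_open)
  \<comment> \<open>\<open>S\<close> contains negative reals, where \<open>w powr c\<close> jumps.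
    Since \<open>1 - m w = - w / (1 - w)\<close> with \<open>m w\<close> in the unit disc, this is a
    holomorphic branch, up to a constant, of the integrating factor.\<close>
  define \<omega> where "\<omega> = (\<lambda>w. (1 - m w) powr c * (1 - w) powr (a + b + 1))"
  have \<omega>: "(\<omega> has_field_derivative \<omega> z * (c - (a + b + 1) * z) / (z * (1 - z))) (at z)" if "z \<in> S" for z
  proof -
    have *: "1 - z \<notin> \<real>\<^sub>\<le>\<^sub>0" "z \<noteq> 0" "1 - z \<noteq> 0" using that S by (auto simp: S_def)
    have m1: "1 - m z \<notin> \<real>\<^sub>\<le>\<^sub>0" using one_minus_notin_nonpos_Reals[of "m z"] mb[OF that] by simp
    have 1: "((\<lambda>w. (1 - m w) powr c) has_field_derivative - ((1 - m z) powr c * (c / (1 - m z))) * (m z)\<^sup>2) (at z)"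
      using DERIV_chain2[OF DERIV_one_minus_powr_const[OF m1] dm[OF that]] .
    have 2: "- ((1 - m z) powr c * (c / (1 - m z))) * (m z)\<^sup>2 = (1 - m z) powr c * (c / (z * (1 - z)))"
    proof -
      have "1 - m z = - z / (1 - z)" using * by (simp add: m_def field_simps)
      then have "c / (1 - m z) * (m z)\<^sup>2 = - (c / (z * (1 - z)))"
        using * by (simp add: m_def power2_eq_square)
      then show ?thesis by (metis (no_types, lifting) mult.assoc mult_minus_left mult_minus_right minus_minus)
    qed
    have "(\<omega> has_field_derivative \<omega> z * (c / (z * (1 - z)) - (a + b + 1) / (1 - z))) (at z)"
      unfolding \<omega>_def
      by (rule DERIV_cong[OF DERIV_mult[OF 1[unfolded 2] DERIV_one_minus_powr_const[OF *(1)]]])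
         (simp add: algebra_simps)
    also have "c / (z * (1 - z)) - (a + b + 1) / (1 - z) = (c - (a + b + 1) * z) / (z * (1 - z))"
      using * by (simp add: divide_simps)
    finally show ?thesis by simp
  qed
  define \<kappa> where "\<kappa> = (\<lambda>t. (1 - t) powr c * ((b - a) * f1 t * f2 t + t * (f1 t * deriv f2 t - deriv f1 t * f2 t)))"
  have W: "\<omega> z * (\<psi>1 z * deriv \<psi>2 z - deriv \<psi>1 z * \<psi>2 z) = \<kappa> (m z)" if "z \<in> S" for z
  proof -
    have *: "1 - z \<notin> \<real>\<^sub>\<le>\<^sub>0" "1 - z \<noteq> 0" using that by (auto simp: S_def)
    define p where "p = (1 - z) powr (- a)"
    define q where "q = (1 - z) powr (- b)"
    have d1: "deriv \<psi>1 z = p * m z * (a * f1 (m z) + m z * deriv f1 (m z))"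
      unfolding \<psi>1_def p_def by (rule DERIV_imp_deriv[OF d\<psi>[OF that f(1)]])
    have d2: "deriv \<psi>2 z = q * m z * (b * f2 (m z) + m z * deriv f2 (m z))"
      unfolding \<psi>2_def q_def by (rule DERIV_imp_deriv[OF d\<psi>[OF that f(2)]])
    have "\<psi>1 z * deriv \<psi>2 z - deriv \<psi>1 z * \<psi>2 z = p * q * m z * ((b - a) * f1 (m z) * f2 (m z)
       + m z * (f1 (m z) * deriv f2 (m z) - deriv f1 (m z) * f2 (m z)))"
      unfolding d1 d2 unfolding \<psi>1_def \<psi>2_def p_def[symmetric] q_def[symmetric] by (simp add: algebra_simps)
    moreover have "\<omega> z * (p * q * m z) = (1 - m z) powr c"
    proof -
      have "(1 - z) powr (a + b + 1) * p * q = (1 - z) powr (a + b + 1 + - a + - b)"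
        unfolding p_def q_def by (simp only: powr_add)
      also have "a + b + 1 + - a + - b = 1" by simp
      finally have "(1 - z) powr (a + b + 1) * p * q * m z = 1" using * by (simp add: m_def)
      then show ?thesis by (simp add: \<omega>_def mult.assoc)
    qed
    ultimately show ?thesis by (simp only: \<kappa>_def mult.assoc[symmetric])
  qed
  obtain K where K: "\<And>z. z \<in> S \<Longrightarrow> \<kappa> (m z) = K"
  proof -
    obtain K where "\<And>z. z \<in> S \<Longrightarrow> \<omega> z * (\<psi>1 z * deriv \<psi>2 z - deriv \<psi>1 z * \<psi>2 z) = K"
      using hyp_ode_Wronskian_const[OF S \<omega> \<psi>S(1) ode1 \<psi>S(2) ode2] by blast
    with W show ?thesis by (intro that[of K]) simp
  qed
  have "K = b - a"
  proof -
    have "\<kappa> holomorphic_on ball 0 1" unfolding \<kappa>_def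
      by (intro holomorphic_intros f holomorphic_deriv) (auto intro!: one_minus_notin_nonpos_Reals)
    then have "isCont \<kappa> 0"
      by (intro continuous_on_interior[of "ball 0 1"] holomorphic_on_imp_continuous_on) simp_all
    then have "((\<lambda>x. \<kappa> (of_real x)) \<longlongrightarrow> \<kappa> 0) (at_right (0::real))"
      using tendsto_of_real[OF tendsto_ident_at, of 0 "{0::real<..}"] by (intro isCont_tendsto_compose[of 0 \<kappa>]) simp_all
    moreover have "eventually (\<lambda>x::real. x \<in> {0<..<1}) (at_right 0)"
      by (rule eventually_at_right_real) simp
    then have "\<forall>\<^sub>F x in at_right 0. \<kappa> (of_real x) = K"
    proof eventually_elim
      case (elim x)
      \<comment> \<open>The point \<open>1 - 1 / x\<close> is the preimage of \<open>x\<close> under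
        \<open>m\<close>; as \<open>x\<close> decreases to 0 it runs to infinity along the negative
        reals.\<close>
      have "1 - (1 - 1 / complex_of_real x) = of_real (1 / x)" by simp
      then have "1 - 1 / complex_of_real x \<in> S"
        using elim unfolding S_def mem_Collect_eq by (simp only: norm_of_real complex_nonpos_Reals_iff) auto
      moreover have "m (1 - 1 / complex_of_real x) = of_real x" by (simp add: m_def)
      ultimately show ?case using K by metis
    qed
    ultimately have "((\<lambda>x::real. K) \<longlongrightarrow> \<kappa> 0) (at_right 0)"
      by (rule Lim_transform_eventually)
    then have "\<kappa> 0 = K" by (simp add: tendsto_const_iff)
    then show ?thesis using f0 by (simp add: \<kappa>_def)
  qed
  with ba have "K \<noteq> 0" by auto
  obtain A B where AB: "\<And>z. z \<in> S \<Longrightarrow> P z = A * \<psi>1 z + B * \<psi>2 z"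
  proof (rule hyp_ode_span[OF S \<omega> \<psi>S(1) ode1 \<psi>S(2) ode2 holomorphic_on_subset[OF P(1) Scut] _ _ \<open>K \<noteq> 0\<close>])
    show "hyp_ode a b c P z = 0" if "z \<in> S" for z using that Scut P(2) by blast
    show "\<omega> z * (\<psi>1 z * deriv \<psi>2 z - deriv \<psi>1 z * \<psi>2 z) = K" if "z \<in> S" for z
      using W[OF that] K[OF that] by simp
  qed (assumption | rule that)+
  show ?thesis
  proof (rule that[of "\<lambda>t. A * f1 t" "\<lambda>t. B * f2 t"])
    show "(\<lambda>t. A * f1 t) holomorphic_on ball 0 1" "(\<lambda>t. B * f2 t) holomorphic_on ball 0 1"
      by (intro holomorphic_intros f)+
    show "P w = (1 - w) powr (- a) * (A * f1 (1 / (1 - w))) + (1 - w) powr (- b) * (B * f2 (1 / (1 - w)))"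
      if "1 - w \<notin> \<real>\<^sub>\<le>\<^sub>0" "norm (1 - w) > 1" for w
      using AB[of w] that by (simp add: S_def \<psi>1_def \<psi>2_def m_def mult_ac)
  qed
qed

section \<open>Branches of the logarithm and the cut plane of the Ferrers function\<close>

text \<open>Up to the branch this is \<open>1 - 1/z^2 = - (1 - z^2) / z^2\<close>. The constant
  \<open>\<i> * pi\<close> is the source of the phase in the boundary values of
  \<open>(1 - w) powr (- \<mu>)\<close>.\<close>

lemma Ln_one_minus_inverse_square:
  assumes "Im z > 0"
  shows "Ln (1 - 1 / z\<^sup>2) = Ln (1 - z\<^sup>2) - 2 * Ln z + \<i> * of_real pi"
proof (rule Ln_unique)
  have nz: "z \<noteq> 0" using assms by auto
  have nz1: "1 - z\<^sup>2 \<noteq> 0"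
  proof
    assume "1 - z\<^sup>2 = 0"
    then have "z = 1 \<or> z = - 1" by (simp add: power2_eq_1_iff)
    then show False using assms by auto
  qed
  have "exp (Ln (1 - z\<^sup>2) - 2 * Ln z + \<i> * of_real pi) = (1 - z\<^sup>2) / (exp (Ln z))\<^sup>2 * (- 1)"
    unfolding exp_add exp_diff exp_double using nz1 by simp
  also have "\<dots> = 1 - 1 / z\<^sup>2" using nz by (simp add: field_simps)
  finally show "exp (Ln (1 - z\<^sup>2) - 2 * Ln z + \<i> * of_real pi) = 1 - 1 / z\<^sup>2" .
  have z: "0 < Im (Ln z)" "Im (Ln z) < pi" using Im_Ln_pos_lt[OF nz] assms by auto
  have "- pi < Im (Ln (1 - z\<^sup>2)) - 2 * Im (Ln z) + pi \<and> Im (Ln (1 - z\<^sup>2)) - 2 * Im (Ln z) + pi \<le> pi"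
  proof -
    \<comment> \<open>The sign of \<open>Re z\<close> decides in which half-plane
      \<open>1 - z^2\<close> lies and on which side of \<open>pi / 2\<close> the argument of
      \<open>z\<close> is; together they confine the imaginary part.\<close>
    consider "Re z > 0" | "Re z = 0" | "Re z < 0" by linarith
    then show ?thesis
    proof cases
      case 1
      then have "\<bar>Im (Ln z)\<bar> < pi / 2" using Re_Ln_pos_lt[OF nz] by simp
      moreover have "Im (1 - z\<^sup>2) < 0" using 1 assms by (simp add: power2_eq_square)
      then have "Im (Ln (1 - z\<^sup>2)) < 0" 
        using Im_Ln_pos_le[OF nz1] mpi_less_Im_Ln[OF nz1] Im_Ln_le_pi[OF nz1] by linarith
      ultimately show ?thesis using mpi_less_Im_Ln[OF nz1] z by auto
    next
      case 2
      then have "z = \<i> * of_real (Im z)" by (simp add: complex_eq_iff)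
      then have "Ln z = Ln (of_real (Im z)) + \<i> * of_real pi / 2"
        using assms Ln_times_ii[of "of_real (Im z)"] by (simp add: mult.commute)
      moreover have "Im (Ln (complex_of_real (Im z))) = 0" using assms by (simp add: Ln_of_real)
      ultimately have "Im (Ln z) = pi / 2" by simp
      moreover have "1 - z\<^sup>2 = of_real (1 + (Im z)\<^sup>2)" using 2 by (simp add: complex_eq_iff power2_eq_square)
      then have "Im (Ln (1 - z\<^sup>2)) = 0" using Ln_of_real[of "1 + (Im z)\<^sup>2"] by (simp add: add_pos_nonneg del: of_real_add)
      ultimately show ?thesis using z by simp
    next
      case 3
      have "Im (Ln z) > pi / 2"
      proof (rule ccontr)
        assume "\<not> ?thesis"
        then have "\<bar>Im (Ln z)\<bar> \<le> pi / 2" using z by simp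
        then have "Re z \<ge> 0" using Re_Ln_pos_le[OF nz] by simp
        with 3 show False by simp
      qed
      moreover have "Im (1 - z\<^sup>2) > 0" using 3 assms by (simp add: power2_eq_square mult_pos_neg)
      then have "0 < Im (Ln (1 - z\<^sup>2))" using Im_Ln_pos_lt[OF nz1] by simp
      ultimately show ?thesis using Im_Ln_le_pi[OF nz1] z by auto
    qed
  qed
  then show "- pi < Im (Ln (1 - z\<^sup>2) - 2 * Ln z + \<i> * of_real pi)" "Im (Ln (1 - z\<^sup>2) - 2 * Ln z + \<i> * of_real pi) \<le> pi"
    by simp_all
qed

lemma one_minus_square_notin_nonpos_Reals:
  assumes "Im z \<noteq> 0 \<or> Re z < 1 \<and> - 1 < Re z"
  shows "1 - z\<^sup>2 \<notin> \<real>\<^sub>\<le>\<^sub>0"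
proof
  assume "1 - z\<^sup>2 \<in> \<real>\<^sub>\<le>\<^sub>0"
  then have *: "Re z * Im z = 0" "(Re z)\<^sup>2 - (Im z)\<^sup>2 \<ge> 1"
    by (auto simp: complex_nonpos_Reals_iff Re_power2 Im_power2)
  have "Im z = 0"
  proof (rule ccontr)
    assume "Im z \<noteq> 0"
    with * have "- (Im z)\<^sup>2 \<ge> 1" by simp
    then show False using zero_le_power2[of "Im z"] by linarith
  qed
  with * have "(Re z)\<^sup>2 \<ge> 1" by simp
  then have "\<bar>Re z\<bar> \<ge> 1" using abs_square_less_1[of "Re z"] by linarith
  with assms \<open>Im z = 0\<close> show False by auto
qed

text \<open>By conjugation, since none of the three logarithms is taken on its cut.\<close>

lemma Ln_one_minus_inverse_square_lower:
  assumes "Im z < 0"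
  shows "Ln (1 - 1 / z\<^sup>2) = Ln (1 - z\<^sup>2) - 2 * Ln z - \<i> * of_real pi"
proof -
  have z: "z \<notin> \<real>\<^sub>\<le>\<^sub>0" and z1: "1 - z\<^sup>2 \<notin> \<real>\<^sub>\<le>\<^sub>0"
    using assms one_minus_square_notin_nonpos_Reals[of z] by (auto simp: complex_nonpos_Reals_iff)
  have z2: "1 - 1 / z\<^sup>2 \<notin> \<real>\<^sub>\<le>\<^sub>0"
  proof -
    have "Im (1 / z) \<noteq> 0" using assms by (auto simp: Im_divide)
    from one_minus_square_notin_nonpos_Reals[of "1 / z"] this show ?thesis by (simp add: power_divide)
  qed
  have "cnj (Ln (1 - 1 / z\<^sup>2)) = Ln (1 - 1 / (cnj z)\<^sup>2)"
    using cnj_Ln[OF z2] by simp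
  also have "\<dots> = Ln (1 - (cnj z)\<^sup>2) - 2 * Ln (cnj z) + \<i> * of_real pi"
    using assms by (intro Ln_one_minus_inverse_square) simp
  also have "\<dots> = cnj (Ln (1 - z\<^sup>2) - 2 * Ln z - \<i> * of_real pi)"
    using cnj_Ln[OF z1] cnj_Ln[OF z] by simp
  finally show ?thesis by (metis complex_cnj_cnj)
qed

lemma D1_iff: "z \<in> D1 \<longleftrightarrow> Im z \<noteq> 0 \<or> Re z < 1 \<and> - 1 < Re z"
proof -
  have "z \<in> complex_of_real ` ({..-1} \<union> {1..}) \<longleftrightarrow> Im z = 0 \<and> (Re z \<le> - 1 \<or> 1 \<le> Re z)"
    by (auto simp: image_iff complex_eq_iff intro!: bexI[of _ "Re z"])
  then show ?thesis unfolding D1_def by auto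
qed

lemma open_D1: "open D1"
  unfolding D1_def by (intro open_Compl closed_injective_linear_image closed_Un) (auto simp: inj_def intro: bounded_linear.linear bounded_linear_of_real)

lemma connected_D1: "connected D1"
proof -
  have "starlike D1" unfolding starlike_def
  proof (intro bexI[of _ 0] ballI subsetI)
    fix x y assume x: "x \<in> D1" "y \<in> closed_segment 0 x"
    then obtain u where u: "0 \<le> u" "u \<le> 1" "y = u *\<^sub>R x"
      by (auto simp: closed_segment_def)
    have "\<bar>u * Re x\<bar> \<le> \<bar>Re x\<bar>" using u by (simp add: abs_mult mult_left_le_one_le)
    then have "\<bar>Re x\<bar> < 1 \<Longrightarrow> \<bar>u * Re x\<bar> < 1" by linarith
    then show "y \<in> D1" using x(1) u unfolding D1_iff by (cases "u = 0") (auto simp: abs_less_iff)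
  qed (simp add: D1_iff)
  then show ?thesis by (rule starlike_imp_connected)
qed

lemma D1_one_minus_square: "z \<in> D1 \<Longrightarrow> 1 - z\<^sup>2 \<notin> \<real>\<^sub>\<le>\<^sub>0"
  using one_minus_square_notin_nonpos_Reals D1_iff by blast

lemma inverse_square_notin_nonpos_Reals:
  assumes "Re z > 0" shows "1 / z\<^sup>2 \<notin> \<real>\<^sub>\<le>\<^sub>0" "Ln (1 / z\<^sup>2) = - 2 * Ln z"
proof -
  have nz: "z \<noteq> 0" using assms by auto
  have im: "\<bar>Im (Ln z)\<bar> < pi / 2" using Re_Ln_pos_lt[OF nz] assms by simp
  show L: "Ln (1 / z\<^sup>2) = - 2 * Ln z"
  proof (rule Ln_unique)
    show "exp (- 2 * Ln z) = 1 / z\<^sup>2"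
      using nz exp_double[of "Ln z"] by (simp add: exp_minus divide_inverse)
  qed (use im in auto)
  show "1 / z\<^sup>2 \<notin> \<real>\<^sub>\<le>\<^sub>0"
  proof
    assume "1 / z\<^sup>2 \<in> \<real>\<^sub>\<le>\<^sub>0"
    moreover have w: "1 / z\<^sup>2 \<noteq> 0" using nz by simp
    ultimately have "Re (1 / z\<^sup>2) < 0" "Im (1 / z\<^sup>2) = 0"
      unfolding complex_nonpos_Reals_iff complex_eq_iff[of _ 0] by auto
    then have "Im (Ln (1 / z\<^sup>2)) = pi" using Im_Ln_eq_pi[OF w] by blast
    with L im show False by auto
  qed
qed

section \<open>Continuation of the Legendre function across the cut\<close>

text \<open>
  The function \<open>z powr (- 2 * \<alpha>) * P (1 / z\<^sup>2)\<close> is continued from the upper half-plane to \<open>D1\<close> by three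
  overlapping formulas: the connection formula at \<open>w = 1\<close> for \<open>Re z > 0\<close>, its mirror image for
  \<open>Re z < 0\<close>, and the expansion at \<open>w = \<infinity>\<close> on \<open>Re (z\<^sup>2) < 1 / 2\<close>, a neighbourhood of the imaginary axis.
\<close>

lemma hyp2F1_reg_continuation_D1:
  fixes \<alpha> c :: complex
  defines "\<beta> \<equiv> \<alpha> + 1 / 2"
  defines "\<mu> \<equiv> \<alpha> + \<beta> - c"
  assumes \<mu>: "\<mu> \<notin> \<int>"
    and P: "P holomorphic_on cut_plane" "P has_fps_expansion fps_hyp2F1_reg \<alpha> \<beta> c"
    and F1: "F1 holomorphic_on cut_plane" "F1 has_fps_expansion H1" "hyp_rec (\<alpha> - c + 1) (\<beta> - c + 1) (1 + \<mu>) H1" "F1 0 = 1"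
    and F2: "F2 holomorphic_on cut_plane" "F2 has_fps_expansion H2" "hyp_rec (1 - \<alpha>) (1 - \<beta>) (1 - \<mu>) H2" "F2 0 = 1"
  obtains Tp Tm where "Tp holomorphic_on D1" "Tm holomorphic_on D1"
    "\<And>z. Im z > 0 \<Longrightarrow> Tp z = z powr (- 2 * \<alpha>) * P (1 / z\<^sup>2)"
    "\<And>z. Im z < 0 \<Longrightarrow> Tm z = z powr (- 2 * \<alpha>) * P (1 / z\<^sup>2)"
    "\<And>z. z \<in> D1_plus \<Longrightarrow> (Tp z + Tm z) / 2 = z powr (2 * c - 2 * \<alpha> - 2) *
       (Gamma (- \<mu>) * rGamma (c - \<alpha>) * rGamma (c - \<beta>) * F1 (1 - 1 / z\<^sup>2)
        + cos (of_real pi * \<mu>) * Gamma \<mu> * rGamma \<alpha> * rGamma \<beta> * (1 - z\<^sup>2) powr (- \<mu>) * z powr (2 * \<mu>) * F2 (1 - 1 / z\<^sup>2))"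
proof -
  define A where "A = Gamma (- \<mu>) * rGamma (c - \<alpha>) * rGamma (c - \<beta>)"
  define B where "B = Gamma \<mu> * rGamma \<alpha> * rGamma \<beta>"
  define T where "T = (\<lambda>z. z powr (- 2 * \<alpha>) * P (1 / z\<^sup>2))"
  \<comment> \<open>The two continuations on the right half: \<open>\<epsilon> = - 1\<close> agrees
    with \<open>T\<close> above the real axis and \<open>\<epsilon> = 1\<close> below it.\<close>
  define R where "R = (\<lambda>\<epsilon> z. z powr (2 * c - 2 * \<alpha> - 2) * (A * F1 (1 - 1 / z\<^sup>2)
        + exp (\<epsilon> * \<i> * of_real pi * \<mu>) * B * (1 - z\<^sup>2) powr (- \<mu>) * z powr (2 * \<mu>) * F2 (1 - 1 / z\<^sup>2)))"
  have odeP: "hyp_ode \<alpha> \<beta> c P w = 0" if "w \<in> cut_plane" for w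
    using hyp_ode_of_rec[OF hyp_rec_reg P(2,1) open_cut_plane connected_cut_plane zero_in_cut_plane that] .
  have conn: "P w = A * (w powr (1 - c) * F1 (1 - w)) + B * (w powr (1 - c) * (1 - w) powr (- \<mu>) * F2 (1 - w))"
    if "w \<notin> \<real>\<^sub>\<le>\<^sub>0" "1 - w \<notin> \<real>\<^sub>\<le>\<^sub>0" for w
  proof -
    have *: "c - \<alpha> - \<beta> = - \<mu>" "\<alpha> + \<beta> - c = \<mu>" by (simp_all add: \<mu>_def)
    show ?thesis
      using hyp2F1_reg_connection_0_1[of \<alpha> \<beta> c P F1 H1 F2 H2 w, unfolded *] \<mu> P F1 F2 that
      by (simp add: A_def B_def add.commute)
  qed
  have z2: "1 - 1 / z\<^sup>2 \<notin> \<real>\<^sub>\<le>\<^sub>0" if "Im z \<noteq> 0" for z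
  proof -
    have "Im (1 / z) \<noteq> 0" using that by (auto simp: Im_divide complex_eq_iff)
    from one_minus_square_notin_nonpos_Reals[of "1 / z"] this show ?thesis by (simp add: power_divide)
  qed
  have nz1: "1 - z\<^sup>2 \<noteq> 0" if "Im z \<noteq> 0" for z
    using one_minus_square_notin_nonpos_Reals[of z] that by auto
  have TR: "T z = R \<epsilon> z" if z: "Re z > 0" "Im z \<noteq> 0"
    and \<epsilon>: "Ln (1 - 1 / z\<^sup>2) = Ln (1 - z\<^sup>2) - 2 * Ln z - \<epsilon> * \<i> * of_real pi" for z \<epsilon>
  proof -
    have zz: "z \<noteq> 0" and w0: "1 / z\<^sup>2 \<noteq> 0" "1 - 1 / z\<^sup>2 \<noteq> 0" using z z2[OF z(2)] by auto
    have 1: "z powr (- 2 * \<alpha>) * (1 / z\<^sup>2) powr (1 - c) = z powr (2 * c - 2 * \<alpha> - 2)"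
    proof -
      have "(1 / z\<^sup>2) powr (1 - c) = exp ((1 - c) * (- 2 * Ln z))"
        using w0(1) inverse_square_notin_nonpos_Reals(2)[OF z(1)] by (simp add: powr_def)
      then show ?thesis using zz by (simp add: powr_def exp_add[symmetric] algebra_simps)
    qed
    have 2: "(1 - 1 / z\<^sup>2) powr (- \<mu>) = exp (\<epsilon> * \<i> * of_real pi * \<mu>) * (1 - z\<^sup>2) powr (- \<mu>) * z powr (2 * \<mu>)"
    proof -
      have "(1 - 1 / z\<^sup>2) powr (- \<mu>) = exp (- \<mu> * (Ln (1 - z\<^sup>2) - 2 * Ln z - \<epsilon> * \<i> * of_real pi))"
        using w0(2) \<epsilon> by (simp add: powr_def)
      also have "\<dots> = exp (\<epsilon> * \<i> * of_real pi * \<mu> + - \<mu> * Ln (1 - z\<^sup>2) + 2 * \<mu> * Ln z)"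
        by (simp add: algebra_simps)
      finally show ?thesis unfolding exp_add using zz nz1[OF z(2)] by (simp add: powr_def)
    qed
    have "T z = z powr (- 2 * \<alpha>) * (1 / z\<^sup>2) powr (1 - c) * (A * F1 (1 - 1 / z\<^sup>2) + B * (1 - 1 / z\<^sup>2) powr (- \<mu>) * F2 (1 - 1 / z\<^sup>2))"
      unfolding T_def conn[OF inverse_square_notin_nonpos_Reals(1)[OF z(1)] z2[OF z(2)]] by (simp add: algebra_simps)
    then show ?thesis unfolding 1 2 R_def by (simp add: algebra_simps)
  qed
  have TRp: "T z = R (- 1) z" if "Re z > 0" "Im z > 0" for z
    using that Ln_one_minus_inverse_square[of z] by (intro TR) auto
  have TRm: "T z = R 1 z" if "Re z > 0" "Im z < 0" for z
    using that Ln_one_minus_inverse_square_lower[of z] by (intro TR) auto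
  define Dp where "Dp = D1 \<inter> {z. Re z > 0}"
  have oDp: "open Dp" unfolding Dp_def by (intro open_Int open_D1 open_halfspace_Re_gt)
  have Rhol: "R \<epsilon> holomorphic_on Dp" for \<epsilon>
  proof -
    have "(\<lambda>z. 1 - 1 / z\<^sup>2) holomorphic_on Dp" by (intro holomorphic_intros) (auto simp: Dp_def)
    moreover have "(\<lambda>z. 1 - 1 / z\<^sup>2) ` Dp \<subseteq> cut_plane"
    proof (rule image_subsetI)
      fix z assume "z \<in> Dp"
      then show "1 - 1 / z\<^sup>2 \<in> cut_plane"
        using inverse_square_notin_nonpos_Reals(1)[of z] unfolding cut_plane_iff Dp_def by simp
    qed
    ultimately have "(\<lambda>z. F1 (1 - 1 / z\<^sup>2)) holomorphic_on Dp" "(\<lambda>z. F2 (1 - 1 / z\<^sup>2)) holomorphic_on Dp"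
      using holomorphic_on_compose_gen[OF _ F1(1), unfolded o_def]
        holomorphic_on_compose_gen[OF _ F2(1), unfolded o_def] by simp_all
    moreover have "z \<notin> \<real>\<^sub>\<le>\<^sub>0" "1 - z\<^sup>2 \<notin> \<real>\<^sub>\<le>\<^sub>0" if "z \<in> Dp" for z
      using that D1_one_minus_square[of z] complex_nonpos_Reals_iff[of z] by (auto simp: Dp_def)
    ultimately show ?thesis unfolding R_def
      by (intro holomorphic_intros) blast+
  qed
  obtain f g where fg: "f holomorphic_on ball 0 1" "g holomorphic_on ball 0 1"
    and Pfg: "\<And>w. 1 - w \<notin> \<real>\<^sub>\<le>\<^sub>0 \<Longrightarrow> norm (1 - w) > 1 \<Longrightarrow>
       P w = (1 - w) powr (- \<alpha>) * f (1 / (1 - w)) + (1 - w) powr (- \<beta>) * g (1 / (1 - w))"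
  proof (rule hyp_ode_span_infinity[OF _ P(1) odeP])
    show "\<alpha> - \<beta> \<notin> \<int>" 
    proof
      assume "\<alpha> - \<beta> \<in> \<int>"
      then obtain k :: int where "- 1 / 2 = complex_of_int k" by (auto simp: \<beta>_def elim!: Ints_cases)
      then have "Re (- 1 / 2) = Re (complex_of_int k)" by simp
      then have "real_of_int (2 * k) = real_of_int (- 1)" by simp
      then have "2 * k = - 1" by (simp only: of_int_eq_iff)
      then show False by presburger
    qed
  qed (assumption | rule that)+
  \<comment> \<open>\<open>Re (z^2) < 1 / 2\<close> says exactly \<open>|z^2| < |z^2 - 1|\<close>,
    so that the local variable \<open>z^2 / (z^2 - 1)\<close> at \<open>w = \<infinity>\<close> lies
    in the unit disc.\<close>
  define M where "M = {z. Re (z\<^sup>2) < 1 / 2}"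
  have oM: "open M" unfolding M_def by (intro open_Collect_less continuous_intros)
  \<comment> \<open>The factor \<open>z powr (- 2 * \<alpha>)\<close> meets
    \<open>z powr (2 * \<alpha>)\<close> and \<open>z powr (2 * \<beta>)\<close>; as
    \<open>\<beta> = \<alpha> + 1 / 2\<close>, only 1 and \<open>z\<close> remain, so nothing is
    singular at \<open>z = 0\<close>.\<close>
  define TM where "TM = (\<lambda>z. exp (- (\<i> * of_real pi * \<alpha>)) * (1 - z\<^sup>2) powr (- \<alpha>) * f (z\<^sup>2 / (z\<^sup>2 - 1))
     + exp (- (\<i> * of_real pi * \<beta>)) * (1 - z\<^sup>2) powr (- \<beta>) * z * g (z\<^sup>2 / (z\<^sup>2 - 1)))"
  have Mlt: "norm (z\<^sup>2) < norm (z\<^sup>2 - 1)" if "z \<in> M" for z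
  proof -
    have "(norm (z\<^sup>2))\<^sup>2 < (norm (z\<^sup>2 - 1))\<^sup>2"
      using that unfolding cmod_power2 M_def by (simp add: power2_eq_square algebra_simps)
    then show ?thesis using power2_less_imp_less norm_ge_zero by blast
  qed
  have M0: "z \<in> M" if "Re z = 0" for z
  proof -
    have "Re (z\<^sup>2) = - ((Im z)\<^sup>2)" using that by (simp only: Re_power2) simp
    then have "Re (z\<^sup>2) \<le> 0" by simp
    then show ?thesis by (simp add: M_def)
  qed
  have Mpos: "1 - z\<^sup>2 \<notin> \<real>\<^sub>\<le>\<^sub>0" if "z \<in> M" for z
    using that by (auto simp: M_def complex_nonpos_Reals_iff)
  have TMhol: "TM holomorphic_on M"
  proof -
    have "(\<lambda>z. z\<^sup>2 / (z\<^sup>2 - 1)) holomorphic_on M" using Mlt by (intro holomorphic_intros) force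
    moreover have "(\<lambda>z. z\<^sup>2 / (z\<^sup>2 - 1)) ` M \<subseteq> ball 0 1"
    proof (rule image_subsetI)
      fix z assume "z \<in> M"
      from Mlt[OF this] have "norm (z\<^sup>2) < norm (z\<^sup>2 - 1)" "norm (z\<^sup>2 - 1) > 0"
        using norm_ge_zero[of "z\<^sup>2"] by linarith+
      then show "z\<^sup>2 / (z\<^sup>2 - 1) \<in> ball 0 1" by (simp add: norm_divide divide_less_eq)
    qed
    ultimately have "(\<lambda>z. f (z\<^sup>2 / (z\<^sup>2 - 1))) holomorphic_on M" "(\<lambda>z. g (z\<^sup>2 / (z\<^sup>2 - 1))) holomorphic_on M"
      using holomorphic_on_compose_gen[OF _ fg(1), unfolded o_def]
        holomorphic_on_compose_gen[OF _ fg(2), unfolded o_def] by simp_all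
    then show ?thesis unfolding TM_def by (intro holomorphic_intros) (auto simp: Mpos)
  qed
  have T_TM: "T z = TM z" if "z \<in> M" "Im z > 0" for z
  proof -
    have zz: "z \<noteq> 0" and w0: "1 - 1 / z\<^sup>2 \<noteq> 0" using that z2[of z] by auto
    have "norm (1 - 1 / z\<^sup>2) = norm (z\<^sup>2 - 1) / norm (z\<^sup>2)"
      using zz by (simp add: norm_divide[symmetric] diff_divide_distrib)
    then have n: "norm (1 - 1 / z\<^sup>2) > 1" using Mlt[OF that(1)] zz by (simp add: less_divide_eq)
    have t: "1 / (1 - 1 / z\<^sup>2) = z\<^sup>2 / (z\<^sup>2 - 1)"
      using zz by (simp add: diff_divide_distrib[symmetric] divide_simps)
    have pw: "(1 - 1 / z\<^sup>2) powr (- s) = exp (- (\<i> * of_real pi * s)) * (1 - z\<^sup>2) powr (- s) * z powr (2 * s)" for s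
    proof -
      have "(1 - 1 / z\<^sup>2) powr (- s) = exp (- s * (Ln (1 - z\<^sup>2) - 2 * Ln z + \<i> * of_real pi))"
        using w0 Ln_one_minus_inverse_square[OF that(2)] by (simp add: powr_def)
      also have "\<dots> = exp (- (\<i> * of_real pi * s) + - s * Ln (1 - z\<^sup>2) + 2 * s * Ln z)"
        by (simp add: algebra_simps)
      finally show ?thesis unfolding exp_add using zz nz1[of z] that(2) by (simp add: powr_def)
    qed
    have a1: "z powr (- 2 * \<alpha>) * z powr (2 * \<alpha>) = 1" using zz by (simp add: powr_def exp_add[symmetric])
    have a2: "z powr (- 2 * \<alpha>) * z powr (2 * \<beta>) = z"
      using zz by (simp add: powr_def exp_add[symmetric] \<beta>_def algebra_simps)
    have "T z = (z powr (- 2 * \<alpha>) * z powr (2 * \<alpha>)) * (exp (- (\<i> * of_real pi * \<alpha>)) * (1 - z\<^sup>2) powr (- \<alpha>) * f (z\<^sup>2 / (z\<^sup>2 - 1)))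
       + (z powr (- 2 * \<alpha>) * z powr (2 * \<beta>)) * (exp (- (\<i> * of_real pi * \<beta>)) * (1 - z\<^sup>2) powr (- \<beta>) * g (z\<^sup>2 / (z\<^sup>2 - 1)))"
      unfolding T_def Pfg[OF z2 n] pw t using that by (simp add: Pfg[OF z2 n] pw t algebra_simps)
    then show ?thesis unfolding a1 a2 TM_def by (simp add: algebra_simps)
  qed
  \<comment> \<open>\<open>P (1 / z^2)\<close> is even, so passing to \<open>- z\<close> changes
    only the phase of the power.\<close>
  have refl: "T z = exp (- 2 * \<i> * of_real pi * \<alpha>) * T (- z)" if "Im z > 0" for z
  proof -
    have zz: "z \<noteq> 0" using that by auto
    have L: "Ln (- z) = Ln z - \<i> * of_real pi"
      using Ln_minus[OF zz] that by simp
    have "exp (- 2 * \<i> * of_real pi * \<alpha>) * (- z) powr (- 2 * \<alpha>) = z powr (- 2 * \<alpha>)"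
      using zz by (simp add: powr_def L exp_add[symmetric] algebra_simps)
    then show ?thesis by (simp add: T_def mult.assoc[symmetric])
  qed
  define \<theta> where "\<theta> = exp (- 2 * \<i> * of_real pi * \<alpha>)"
  have \<theta>: "\<theta> \<noteq> 0" by (simp add: \<theta>_def)
  define N where "N = M \<inter> {z. Re z > 0}"
  have oN: "open N" unfolding N_def by (intro open_Int oM open_halfspace_Re_gt)
  have ND: "N \<subseteq> Dp"
  proof
    fix z assume z: "z \<in> N"
    have "Re z < 1" if "Im z = 0"
    proof -
      have "(Re z)\<^sup>2 < 1" using z that by (simp add: N_def M_def Re_power2)
      then show ?thesis by (simp add: abs_square_less_1)
    qed
    then show "z \<in> Dp" using z by (auto simp: N_def Dp_def D1_iff)
  qed
  have cN: "connected N"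
  proof -
    \<comment> \<open>\<open>N\<close> is the region
      \<open>0 < Re z < sqrt ((Im z)^2 + 1/2)\<close>; rescaling the real part on each horizontal
      line straightens it to a strip.\<close>
    define h where "h = (\<lambda>s. Complex (Re s * sqrt ((Im s)\<^sup>2 + 1 / 2)) (Im s))"
    have "convex ({s. Re s > 0} \<inter> {s. Re s < 1})"
      by (intro convex_Int convex_halfspace_Re_gt convex_halfspace_Re_lt)
    then have "connected (h ` ({s. Re s > 0} \<inter> {s. Re s < 1}))"
      unfolding h_def by (intro connected_continuous_image continuous_intros convex_connected)
    also have "h ` ({s. Re s > 0} \<inter> {s. Re s < 1}) = N"
    proof (intro equalityI subsetI)
      fix z assume "z \<in> h ` ({s. Re s > 0} \<inter> {s. Re s < 1})"
      then obtain s where s: "z = h s" "0 < Re s" "Re s < 1" by auto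
      define q where "q = (Im s)\<^sup>2 + 1 / 2"
      have q: "q > 0" by (simp add: q_def add_nonneg_pos)
      have "(Re s)\<^sup>2 < 1" using s by (simp add: abs_square_less_1)
      then have "(Re s)\<^sup>2 * q < 1 * q" using q by (rule mult_strict_right_mono)
      moreover have "Re (z\<^sup>2) = (Re s)\<^sup>2 * q - (Im s)\<^sup>2"
        using q by (simp add: s(1) h_def Re_power2 power_mult_distrib flip: q_def)
      moreover have "q = (Im s)\<^sup>2 + 1 / 2" by (rule q_def)
      ultimately have "Re (z\<^sup>2) < 1 / 2" by simp
      then show "z \<in> N" using s q by (simp add: N_def M_def h_def flip: q_def)
    next
      fix z assume z: "z \<in> N"
      define t where "t = sqrt ((Im z)\<^sup>2 + 1 / 2)"
      have t: "t > 0" unfolding t_def by (simp add: add_nonneg_pos)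
      have "(Re z)\<^sup>2 < (Im z)\<^sup>2 + 1 / 2" using z by (simp add: N_def M_def Re_power2)
      then have "Re z < t" unfolding t_def by (rule real_less_rsqrt)
      moreover have "z = h (Complex (Re z / t) (Im z))"
        using t by (simp add: h_def complex_eq_iff flip: t_def)
      ultimately show "z \<in> h ` ({s. Re s > 0} \<inter> {s. Re s < 1})"
        using z t by (intro image_eqI) (auto simp: N_def)
    qed
    finally show ?thesis .
  qed
  \<comment> \<open>Above the real axis both sides equal \<open>T\<close>. As \<open>N\<close> is
    connected and crosses the real axis, the equality persists below it, where \<open>T\<close>
    itself is a different branch.\<close>
  have RTM: "R (- 1) z = TM z" if "z \<in> N" for z
  proof (rule analytic_continuation_open[of "N \<inter> {z. Im z > 0}" N "R (- 1)" TM])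
    have "Complex (1 / 2) (1 / 2) \<in> N \<inter> {z. Im z > 0}" by (simp add: N_def M_def Re_power2)
    then show "N \<inter> {z. Im z > 0} \<noteq> {}" by blast
    show "R (- 1) z = TM z" if "z \<in> N \<inter> {z. Im z > 0}" for z
      using TRp[of z] T_TM[of z] that by (simp add: N_def)
    show "TM holomorphic_on N" using TMhol by (rule holomorphic_on_subset) (auto simp: N_def)
  qed (use oN cN ND that in \<open>auto intro: open_Int open_halfspace_Im_gt holomorphic_on_subset[OF Rhol]\<close>)
  have RTM': "\<theta> * R 1 z = TM (- z)" if "z \<in> N" for z
  proof (rule analytic_continuation_open[of "N \<inter> {z. Im z < 0}" N "\<lambda>z. \<theta> * R 1 z" "\<lambda>z. TM (- z)"])
    have "Complex (1 / 2) (- 1 / 2) \<in> N \<inter> {z. Im z < 0}" by (simp add: N_def M_def Re_power2)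
    then show "N \<inter> {z. Im z < 0} \<noteq> {}" by blast
    show "\<theta> * R 1 z = TM (- z)" if "z \<in> N \<inter> {z. Im z < 0}" for z
      using TRm[of z] T_TM[of "- z"] refl[of "- z"] that by (simp add: N_def M_def \<theta>_def)
    have "(\<lambda>z. TM (- z)) holomorphic_on N"
      by (rule holomorphic_on_compose_gen[OF _ TMhol, unfolded o_def]) (auto simp: N_def M_def intro!: holomorphic_intros)
    then show "(\<lambda>z. TM (- z)) holomorphic_on N" .
    show "(\<lambda>z. \<theta> * R 1 z) holomorphic_on N"
      by (intro holomorphic_intros holomorphic_on_subset[OF Rhol ND])
  qed (use oN cN that in \<open>auto intro: open_Int open_halfspace_Im_lt\<close>)
  \<comment> \<open>For \<open>Re z < 0\<close> and \<open>Im z > 0\<close>, \<open>refl\<close>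
    gives \<open>T z = \<theta> * T (- z)\<close> with \<open>- z\<close> in the lower right
    quadrant, hence \<open>R 1\<close>.\<close>
  define Tp where "Tp = (\<lambda>z. if Re z > 0 then R (- 1) z else if Re z < 0 then \<theta> * R 1 (- z) else TM z)"
  define Dn where "Dn = D1 \<inter> {z. Re z < 0}"
  have oDn: "open Dn" unfolding Dn_def by (intro open_Int open_D1 open_halfspace_Re_lt)
  have "Tp holomorphic_on Dp"
    by (rule holomorphic_transform[OF Rhol[of "- 1"]]) (simp add: Dp_def Tp_def)
  moreover have "Tp holomorphic_on Dn"
  proof (rule holomorphic_transform)
    have "(\<lambda>z. R 1 (- z)) holomorphic_on Dn"
      by (rule holomorphic_on_compose_gen[OF _ Rhol, unfolded o_def]) (auto simp: Dn_def Dp_def D1_iff intro!: holomorphic_intros)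
    then show "(\<lambda>z. \<theta> * R 1 (- z)) holomorphic_on Dn" by (intro holomorphic_intros)
  qed (simp add: Dn_def Tp_def)
  moreover have "Tp holomorphic_on M"
  proof (rule holomorphic_transform[OF TMhol])
    fix z assume z: "z \<in> M"
    show "TM z = Tp z" 
      using RTM[of z] RTM'[of "- z"] z by (simp add: Tp_def N_def M_def)
  qed
  ultimately have "Tp holomorphic_on Dp \<union> Dn \<union> M"
    using oDp oDn oM by (auto simp: holomorphic_on_open open_Un)
  moreover have "D1 \<subseteq> Dp \<union> Dn \<union> M"
  proof
    fix z assume "z \<in> D1"
    then show "z \<in> Dp \<union> Dn \<union> M" 
      using M0[of z] by (cases "Re z = 0") (auto simp: Dp_def Dn_def)
  qed
  ultimately have Tp: "Tp holomorphic_on D1" by (rule holomorphic_on_subset)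
  have TpT: "Tp z = T z" if "Im z > 0" for z
  proof -
    consider "Re z > 0" | "Re z < 0" | "Re z = 0" by linarith
    then show ?thesis
    proof cases
      case 1 then show ?thesis using TRp that by (simp add: Tp_def)
    next
      case 2 then show ?thesis using TRm[of "- z"] refl[of z] that by (simp add: Tp_def \<theta>_def)
    next
      case 3
      then have "z \<in> M" by (rule M0)
      with 3 show ?thesis using T_TM[of z] that by (simp add: Tp_def)
    qed
  qed
  have "(\<lambda>z. Tp (- z)) holomorphic_on D1"
    by (rule holomorphic_on_compose_gen[OF _ Tp, unfolded o_def]) (auto simp: D1_iff intro!: holomorphic_intros)
  \<comment> \<open>For \<open>Im z < 0\<close> the point \<open>- z\<close> lies above the axis,
    and \<open>refl\<close> gives \<open>T (- z) = \<theta> * T z\<close>; the second continuation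
    is thus a reflection of the first.\<close>
  then have Tm: "(\<lambda>z. Tp (- z) / \<theta>) holomorphic_on D1" using \<theta> by (intro holomorphic_intros)
  have avg: "(Tp z + Tp (- z) / \<theta>) / 2 = z powr (2 * c - 2 * \<alpha> - 2) *
       (A * F1 (1 - 1 / z\<^sup>2) + cos (of_real pi * \<mu>) * B * (1 - z\<^sup>2) powr (- \<mu>) * z powr (2 * \<mu>) * F2 (1 - 1 / z\<^sup>2))"
    if "z \<in> D1_plus" for z
  proof -
    have "Re z > 0" using that by (simp add: D1_plus_def)
    then have "Tp z + Tp (- z) / \<theta> = R (- 1) z + R 1 z" using \<theta> by (simp add: Tp_def)
    also have "\<dots> = z powr (2 * c - 2 * \<alpha> - 2) *
       (2 * (A * F1 (1 - 1 / z\<^sup>2)) + (exp (\<i> * (of_real pi * \<mu>)) + exp (- (\<i> * (of_real pi * \<mu>)))) * B * (1 - z\<^sup>2) powr (- \<mu>) * z powr (2 * \<mu>) * F2 (1 - 1 / z\<^sup>2))"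
      by (simp add: R_def algebra_simps)
    also have "exp (\<i> * (of_real pi * \<mu>)) + exp (- (\<i> * (of_real pi * \<mu>))) = 2 * cos (of_real pi * \<mu>)"
      by (simp add: cos_exp_eq)
    finally show ?thesis by (simp add: algebra_simps)
  qed
  show ?thesis
  proof (rule that[OF Tp Tm])
    show "Tp z = z powr (- 2 * \<alpha>) * P (1 / z\<^sup>2)" if "Im z > 0" for z
      using TpT[OF that] by (simp add: T_def)
    show "Tp (- z) / \<theta> = z powr (- 2 * \<alpha>) * P (1 / z\<^sup>2)" if "Im z < 0" for z
    proof -
      have "Tp (- z) = \<theta> * T z" using TpT[of "- z"] refl[of "- z"] that by (simp add: \<theta>_def)
      then show ?thesis using \<theta> by (simp add: T_def)
    qed
  qed (use avg in \<open>simp add: A_def B_def mult.assoc\<close>)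
qed

section \<open>The Ferrers function of the second kind\<close>

text \<open>Above the real axis the arguments of \<open>z + 1\<close> and \<open>z - 1\<close> lie
  in \<open>(0, pi)\<close>, so their sum minus \<open>pi\<close> is a principal argument of
  \<open>1 - z^2\<close>.\<close>

lemma powr_square_minus_one_upper:
  assumes "Im z > 0"
  shows "(z + 1) powr s * (z - 1) powr s = exp (\<i> * of_real pi * s) * (1 - z\<^sup>2) powr s"
proof -
  have nz: "z + 1 \<noteq> 0" "z - 1 \<noteq> 0" using assms by (auto simp: complex_eq_iff)
  have e: "1 - z\<^sup>2 = (z + 1) * (z - 1) * (- 1)" by (simp add: algebra_simps power2_eq_square)
  have nz1: "1 - z\<^sup>2 \<noteq> 0" using nz unfolding e by simp
  have L: "Ln (1 - z\<^sup>2) = Ln (z + 1) + Ln (z - 1) - \<i> * of_real pi"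
  proof (rule Ln_unique)
    show "exp (Ln (z + 1) + Ln (z - 1) - \<i> * of_real pi) = 1 - z\<^sup>2"
      unfolding exp_add exp_diff e using nz by simp
    have "0 < Im (Ln (z + 1))" "Im (Ln (z + 1)) < pi" "0 < Im (Ln (z - 1))" "Im (Ln (z - 1)) < pi"
      using Im_Ln_pos_lt[OF nz(1)] Im_Ln_pos_lt[OF nz(2)] assms by auto
    then show "- pi < Im (Ln (z + 1) + Ln (z - 1) - \<i> * of_real pi)" "Im (Ln (z + 1) + Ln (z - 1) - \<i> * of_real pi) \<le> pi"
      by auto
  qed
  have "exp (\<i> * of_real pi * s) * exp (s * Ln (1 - z\<^sup>2)) = exp (s * Ln (z + 1)) * exp (s * Ln (z - 1))"
    unfolding L by (simp add: exp_add[symmetric] algebra_simps)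
  then show ?thesis using nz nz1 by (simp add: powr_def)
qed

lemma powr_square_minus_one_lower:
  assumes "Im z < 0"
  shows "(z + 1) powr s * (z - 1) powr s = exp (- (\<i> * of_real pi * s)) * (1 - z\<^sup>2) powr s"
proof -
  have "w powr s = cnj (cnj w powr cnj s)" if "w \<notin> \<real>\<^sub>\<le>\<^sub>0" for w
  proof -
    have "cnj (w powr s) = cnj w powr cnj s"
      using that by (intro cnj_powr) (auto simp: complex_nonpos_Reals_iff)
    then show ?thesis by (metis complex_cnj_cnj)
  qed
  moreover have "z + 1 \<notin> \<real>\<^sub>\<le>\<^sub>0" "z - 1 \<notin> \<real>\<^sub>\<le>\<^sub>0" "1 - z\<^sup>2 \<notin> \<real>\<^sub>\<le>\<^sub>0"
    using assms one_minus_square_notin_nonpos_Reals[of z] by (auto simp: complex_nonpos_Reals_iff)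
  ultimately show ?thesis
    using arg_cong[OF powr_square_minus_one_upper[of "cnj z" "cnj s"], of cnj] assms
    by (simp add: exp_cnj)
qed

text \<open>In reciprocal form both sides vanish where Gamma has poles. This generality is needed
  since \<open>\<nu> - \<mu> + 1\<close> may be a nonpositive integer.\<close>

lemma rGamma_legendre_duplication:
  fixes z :: complex
  shows "rGamma z * rGamma (z + 1 / 2) = rGamma (2 * z) * 2 powr (2 * z - 1) / of_real (sqrt pi)"
proof (cases "2 * z \<in> \<int>\<^sub>\<le>\<^sub>0")
  case True
  then obtain n :: nat where n: "2 * z = - of_nat n" by (auto elim: nonpos_Ints_cases')
  have "rGamma z = 0 \<or> rGamma (z + 1 / 2) = 0"
  proof (cases "even n")
    case True
    then obtain m where "n = 2 * m" by blast
    then have "z = - of_nat m" using n by simp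
    then show ?thesis by (simp add: rGamma_eq_zero_iff)
  next
    case False
    then obtain m where "n = 2 * m + 1" by (blast elim: oddE)
    then have "2 * z = - (2 * of_nat m + 1)" using n by simp
    moreover have "z + 1 / 2 = (2 * z + 1) / 2" by simp
    ultimately have "z + 1 / 2 = - of_nat m" by simp
    then show ?thesis by (simp add: rGamma_eq_zero_iff)
  qed
  moreover have "rGamma (2 * z) = 0" using True by (simp add: rGamma_eq_zero_iff)
  ultimately show ?thesis by auto
next
  case False
  have 1: "z \<notin> \<int>\<^sub>\<le>\<^sub>0"
  proof
    assume "z \<in> \<int>\<^sub>\<le>\<^sub>0"
    then obtain n :: nat where "z = - of_nat n" by (auto elim: nonpos_Ints_cases')
    then have "2 * z = - of_nat (2 * n)" by simp
    with False show False by (metis minus_of_nat_in_nonpos_Ints)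
  qed
  have 2: "z + 1 / 2 \<notin> \<int>\<^sub>\<le>\<^sub>0"
  proof
    assume "z + 1 / 2 \<in> \<int>\<^sub>\<le>\<^sub>0"
    then obtain n :: nat where "z + 1 / 2 = - of_nat n" by (auto elim: nonpos_Ints_cases')
    moreover have "2 * z = 2 * (z + 1 / 2) - 1" by simp
    ultimately have "2 * z = - of_nat (2 * n + 1)" by simp
    with False show False by (metis minus_of_nat_in_nonpos_Ints)
  qed
  have "exp ((1 - 2 * z) * of_real (ln 2)) = (2 :: complex) powr (1 - 2 * z)"
    by (simp add: powr_def Ln_of_real flip: Ln_of_real[of 2])
  also have "\<dots> = inverse (2 powr (2 * z - 1))" by (simp flip: powr_minus)
  finally have "Gamma z * Gamma (z + 1 / 2) = inverse (2 powr (2 * z - 1)) * of_real (sqrt pi) * Gamma (2 * z)"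
    using Gamma_legendre_duplication[OF 1 2] by simp
  then have "inverse (Gamma z * Gamma (z + 1 / 2)) = inverse (inverse (2 powr (2 * z - 1)) * of_real (sqrt pi) * Gamma (2 * z))"
    by simp
  then show ?thesis by (simp add: rGamma_inverse_Gamma field_simps)
qed

lemma hyp2F1_props:
  assumes "c \<notin> \<int>\<^sub>\<le>\<^sub>0"
  shows "hyp2F1 a (a + 1 / 2) c holomorphic_on cut_plane"
    and "hyp2F1 a (a + 1 / 2) c has_fps_expansion fps_hypergeo [a, a + 1 / 2] [c] 1"
    and "hyp2F1 a (a + 1 / 2) c 0 = 1"
proof -
  obtain f where "f holomorphic_on cut_plane" "f has_fps_expansion fps_hypergeo [a, a + 1 / 2] [c] 1"
    using quadratic_continuation[OF hyp_rec_hypergeo[OF assms]] .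
  note * = principal_branch[OF this, folded hyp2F1_def]
  show "hyp2F1 a (a + 1 / 2) c holomorphic_on cut_plane"
    and "hyp2F1 a (a + 1 / 2) c has_fps_expansion fps_hypergeo [a, a + 1 / 2] [c] 1"
    using *(1,2) by blast+
  show "hyp2F1 a (a + 1 / 2) c 0 = 1" using *(3)[of 0] by (simp add: eval_fps_at_0 del: fps_hypergeo_nth)
qed

lemma hyp2F1_reg_props:
  shows "hyp2F1_reg a (a + 1 / 2) c holomorphic_on cut_plane"
    and "hyp2F1_reg a (a + 1 / 2) c has_fps_expansion fps_hyp2F1_reg a (a + 1 / 2) c"
proof -
  obtain f where "f holomorphic_on cut_plane" "f has_fps_expansion fps_hyp2F1_reg a (a + 1 / 2) c"
    using quadratic_continuation[OF hyp_rec_reg] .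
  from principal_branch[OF this, folded hyp2F1_reg_def] 
  show "hyp2F1_reg a (a + 1 / 2) c holomorphic_on cut_plane"
    and "hyp2F1_reg a (a + 1 / 2) c has_fps_expansion fps_hyp2F1_reg a (a + 1 / 2) c" by blast+
qed

lemma hyp_rec_commute: "hyp_rec a b c F \<longleftrightarrow> hyp_rec b a c F"
  by (simp add: hyp_rec_def mult_ac)

lemma hyp2F1_reg_commute: "hyp2F1_reg a b c = hyp2F1_reg b a c"
  by (simp add: hyp2F1_reg_def fps_hyp2F1_reg_def mult_ac)

lemma islimpt_halfplane:
  "of_real x islimpt {z. Im z > 0}" "of_real x islimpt {z. Im z < 0}"
proof -
  have "\<exists>z\<in>{z. Im z > 0}. z \<noteq> of_real x \<and> dist z (of_real x) < e" if "e > 0" for e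
    using that by (intro bexI[of _ "of_real x + \<i> * of_real (e / 2)"]) (auto simp: complex_eq_iff dist_norm norm_mult)
  then show "of_real x islimpt {z. Im z > 0}" unfolding islimpt_approachable by blast
  have "\<exists>z\<in>{z. Im z < 0}. z \<noteq> of_real x \<and> dist z (of_real x) < e" if "e > 0" for e
    using that by (intro bexI[of _ "of_real x + \<i> * of_real (- e / 2)"]) (auto simp: complex_eq_iff dist_norm norm_mult)
  then show "of_real x islimpt {z. Im z < 0}" unfolding islimpt_approachable by blast
qed

lemma Lim_within_holomorphic:
  assumes "g holomorphic_on S" "open S" "a \<in> S" "a islimpt A" "\<And>z. z \<in> A \<Longrightarrow> f z = g z"
  shows "Lim (at a within A) f = g a"
proof (rule tendsto_Lim)
  show "at a within A \<noteq> bot" using assms(4) by (simp add: trivial_limit_within)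
  have "isCont g a" using assms(1-3)
    by (meson continuous_on_eq_continuous_at holomorphic_on_imp_continuous_on)
  then have "(g \<longlongrightarrow> g a) (at a within A)"
    by (simp add: isCont_def tendsto_within_subset[OF _ subset_UNIV])
  then show "(f \<longlongrightarrow> g a) (at a within A)"
    by (rule Lim_transform_eventually) (simp add: eventually_at_filter assms(5))
qed

text \<open>\<open>f\<close> itself witnesses the choice, and the interval accumulates at 0 inside
  the connected \<open>D1\<close>, so the chosen function can only be \<open>f\<close>.\<close>

lemma Ferrers_Q_eqI:
  assumes "f holomorphic_on D1" "\<And>x. x \<in> {-1<..<1} \<Longrightarrow> f (of_real x) = Ferrers_Q_real \<nu> \<mu> x" "z \<in> D1"
  shows "Ferrers_Q \<nu> \<mu> z = f z"
proof -
  let ?g = "Ferrers_Q \<nu> \<mu>"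
  have "\<exists>f. f holomorphic_on D1 \<and> (\<forall>x\<in>{-1<..<1}. f (of_real x) = Ferrers_Q_real \<nu> \<mu> x)"
    using assms(1,2) by blast
  then have g: "?g holomorphic_on D1 \<and> (\<forall>x\<in>{-1<..<1}. ?g (of_real x) = Ferrers_Q_real \<nu> \<mu> x)"
    unfolding Ferrers_Q_def by (rule someI_ex)
  have "(\<lambda>z. ?g z - f z) z = 0"
  proof (rule analytic_continuation[of "\<lambda>z. ?g z - f z" D1 "of_real ` {-1<..<1}" 0])
    show "(\<lambda>z. ?g z - f z) holomorphic_on D1" using g assms(1) by (intro holomorphic_intros) auto
    show "complex_of_real ` {-1<..<1} \<subseteq> D1" "0 \<in> D1" by (auto simp: D1_iff)
    show "(0::complex) islimpt of_real ` {-1<..<1}"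
    proof -
      have "\<exists>y\<in>complex_of_real ` {-1<..<1}. y \<noteq> 0 \<and> dist y 0 < e" if "e > 0" for e
      proof -
        define t where "t = min (1 / 2) (e / 2)"
        have "0 < t" "t < 1" "t < e" using that by (auto simp: t_def)
        then show ?thesis by (intro bexI[of _ "of_real t"]) auto
      qed
      then show ?thesis unfolding islimpt_approachable by blast
    qed
    show "?g w - f w = 0" if "w \<in> complex_of_real ` {-1<..<1}" for w
      using that g assms(2) by auto
  qed (use open_D1 connected_D1 assms(3) in auto)
  then show ?thesis by simp
qed

theorem theorem4p5:
  fixes x \<nu> \<mu> :: complex
  assumes "x \<in> D1_plus"
    and "\<mu> \<notin> \<int>"
    and "\<forall>n::nat. n \<ge> 1 \<longrightarrow> \<nu> + \<mu> \<noteq> - of_nat n"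
  shows "Ferrers_Q \<nu> \<mu> x =
      2 powr (\<mu> - 1) * cos (of_real pi * \<mu>) * Gamma \<mu> / (1 - x\<^sup>2) powr (\<mu> / 2)
        * x powr (\<nu> + \<mu>)
        * hyp2F1 ((- \<nu> - \<mu>) / 2) ((- \<nu> - \<mu> + 1) / 2) (1 - \<mu>) ((x\<^sup>2 - 1) / x\<^sup>2)
    + Gamma (\<nu> + \<mu> + 1) * Gamma (- \<mu>) * rGamma (\<nu> - \<mu> + 1) / 2 powr (\<mu> + 1)
        * (1 - x\<^sup>2) powr (\<mu> / 2) * x powr (\<nu> - \<mu>)
        * hyp2F1 ((\<mu> - \<nu>) / 2) ((\<mu> - \<nu> + 1) / 2) (1 + \<mu>) ((x\<^sup>2 - 1) / x\<^sup>2)"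
proof -
  \<comment> \<open>With these parameters \<open>z powr (\<nu> + \<mu> + 1)\<close> is
    \<open>z powr (2 * \<alpha>)\<close>, and the exponent difference
    \<open>\<alpha> + \<beta> - c\<close> is \<open>\<mu>\<close>.\<close>
  define \<alpha> where "\<alpha> = (\<nu> + \<mu> + 1) / 2"
  define \<beta> where "\<beta> = \<alpha> + 1 / 2"
  define c where "c = \<nu> + 3 / 2"
  define P where "P = hyp2F1_reg \<alpha> \<beta> c"
  define F1 where "F1 = hyp2F1 ((\<mu> - \<nu>) / 2) ((\<mu> - \<nu> + 1) / 2) (1 + \<mu>)"
  define F2 where "F2 = hyp2F1 ((- \<nu> - \<mu>) / 2) ((- \<nu> - \<mu> + 1) / 2) (1 - \<mu>)"
  have \<mu>: "\<alpha> + (\<alpha> + 1 / 2) - c = \<mu>" by (simp add: \<alpha>_def c_def field_simps)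
  have i1: "1 + \<mu> \<notin> \<int>\<^sub>\<le>\<^sub>0"
  proof
    assume "1 + \<mu> \<in> \<int>\<^sub>\<le>\<^sub>0"
    then have "1 + \<mu> - 1 \<in> \<int>" by (intro Ints_diff[OF _ Ints_1]) (auto dest: nonpos_Ints_Int)
    with assms(2) show False by simp
  qed
  have i2: "1 - \<mu> \<notin> \<int>\<^sub>\<le>\<^sub>0"
  proof
    assume "1 - \<mu> \<in> \<int>\<^sub>\<le>\<^sub>0"
    then have "1 - (1 - \<mu>) \<in> \<int>" by (intro Ints_diff[OF Ints_1]) (auto dest: nonpos_Ints_Int)
    with assms(2) show False by simp
  qed
  have e1: "\<alpha> - c + 1 = (\<mu> - \<nu>) / 2" "\<alpha> + 1 / 2 - c + 1 = (\<mu> - \<nu>) / 2 + 1 / 2"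
    and e1': "(\<mu> - \<nu> + 1) / 2 = (\<mu> - \<nu>) / 2 + 1 / 2"
    and e2: "1 - \<alpha> = (- \<nu> - \<mu>) / 2 + 1 / 2" "1 - (\<alpha> + 1 / 2) = (- \<nu> - \<mu>) / 2"
    and e2': "(- \<nu> - \<mu> + 1) / 2 = (- \<nu> - \<mu>) / 2 + 1 / 2"
    by (simp_all add: \<alpha>_def c_def field_simps)
  obtain Tp Tm where T: "Tp holomorphic_on D1" "Tm holomorphic_on D1"
    "\<And>z. Im z > 0 \<Longrightarrow> Tp z = z powr (- 2 * \<alpha>) * P (1 / z\<^sup>2)"
    "\<And>z. Im z < 0 \<Longrightarrow> Tm z = z powr (- 2 * \<alpha>) * P (1 / z\<^sup>2)"
    "\<And>z. z \<in> D1_plus \<Longrightarrow> (Tp z + Tm z) / 2 = z powr (2 * c - 2 * \<alpha> - 2) *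
       (Gamma (- \<mu>) * rGamma (c - \<alpha>) * rGamma (c - \<beta>) * F1 (1 - 1 / z\<^sup>2)
        + cos (of_real pi * \<mu>) * Gamma \<mu> * rGamma \<alpha> * rGamma \<beta> * (1 - z\<^sup>2) powr (- \<mu>) * z powr (2 * \<mu>) * F2 (1 - 1 / z\<^sup>2))"
  proof (rule hyp2F1_reg_continuation_D1[of \<alpha> c P F1 _ F2, unfolded \<mu>, folded \<beta>_def])
    show "\<mu> \<notin> \<int>" by (rule assms(2))
    show "P holomorphic_on cut_plane" "P has_fps_expansion fps_hyp2F1_reg \<alpha> \<beta> c"
      unfolding P_def \<beta>_def by (rule hyp2F1_reg_props)+
    show "F1 holomorphic_on cut_plane" "F1 has_fps_expansion fps_hypergeo [(\<mu> - \<nu>) / 2, (\<mu> - \<nu>) / 2 + 1 / 2] [1 + \<mu>] 1" "F1 0 = 1"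
      unfolding F1_def e1' by (rule hyp2F1_props[OF i1])+
    show "F2 holomorphic_on cut_plane" "F2 has_fps_expansion fps_hypergeo [(- \<nu> - \<mu>) / 2, (- \<nu> - \<mu>) / 2 + 1 / 2] [1 - \<mu>] 1" "F2 0 = 1"
      unfolding F2_def e2' by (rule hyp2F1_props[OF i2])+
    show "hyp_rec (\<alpha> - c + 1) (\<beta> - c + 1) (1 + \<mu>) (fps_hypergeo [(\<mu> - \<nu>) / 2, (\<mu> - \<nu>) / 2 + 1 / 2] [1 + \<mu>] 1)"
      unfolding \<beta>_def e1 by (rule hyp_rec_hypergeo[OF i1])
    show "hyp_rec (1 - \<alpha>) (1 - \<beta>) (1 - \<mu>) (fps_hypergeo [(- \<nu> - \<mu>) / 2, (- \<nu> - \<mu>) / 2 + 1 / 2] [1 - \<mu>] 1)"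
      \<comment> \<open>Here \<open>1 - \<alpha>\<close> exceeds \<open>1 - \<beta>\<close> by 1/2,
        so the upper parameters are interchanged.\<close>
      unfolding \<beta>_def e2 hyp_rec_commute[of "_ + 1 / 2"] by (rule hyp_rec_hypergeo[OF i2])
  qed (assumption | rule that)+
  define K where "K = of_real (sqrt pi) * Gamma (\<nu> + \<mu> + 1) / 2 powr (\<nu> + 1)"
  define f where "f = (\<lambda>z. K * (1 - z\<^sup>2) powr (\<mu> / 2) * ((Tp z + Tm z) / 2))"
  have D1p: "(\<lambda>z. K * (1 - z\<^sup>2) powr (\<mu> / 2) * h z) holomorphic_on D1" if "h holomorphic_on D1" for h
    using that by (intro holomorphic_intros) (auto simp: D1_one_minus_square)
  have fhol: "f holomorphic_on D1"
    unfolding f_def by (rule D1p) (intro holomorphic_intros T(1,2), simp)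
  have L: "Legendre_Q \<nu> \<mu> z = exp (\<i> * of_real pi * \<mu>) * (K * ((z + 1) powr (\<mu> / 2) * (z - 1) powr (\<mu> / 2)) * (z powr (- 2 * \<alpha>) * P (1 / z\<^sup>2)))" for z
  proof -
    have "\<nu> + \<mu> + 1 = 2 * \<alpha>" "(\<nu> + \<mu> + 2) / 2 = \<beta>" "(\<nu> + \<mu> + 1) / 2 = \<alpha>"
      by (simp_all add: \<alpha>_def \<beta>_def field_simps)
    then show ?thesis 
      unfolding Legendre_Q_def K_def P_def c_def[symmetric] hyp2F1_reg_commute[of \<alpha>]
      by (simp add: powr_minus field_simps)
  qed
  have F: "Ferrers_Q_real \<nu> \<mu> y = f (of_real y)" if "y \<in> {-1<..<1}" for y
  proof -
    have y: "of_real y \<in> D1" using that by (simp add: D1_iff)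
    let ?e = "exp (\<i> * of_real pi * \<mu>)"
    let ?h = "exp (\<i> * of_real pi * (\<mu> / 2))"
    \<comment> \<open>The phases \<open>?e\<close> and \<open>?h\<close> or its inverse are
      precisely what the prefactors in \<open>Ferrers_Q_real\<close> remove; the plain average of
      \<open>Tp\<close> and \<open>Tm\<close> is left.\<close>
    have "Legendre_Q \<nu> \<mu> z = ?e * ?h * (K * (1 - z\<^sup>2) powr (\<mu> / 2) * Tp z)" if "Im z > 0" for z
      using powr_square_minus_one_upper[OF that, of "\<mu> / 2"] T(3)[OF that] by (simp add: L mult_ac)
    then have 1: "Lim (at (of_real y) within {z. Im z > 0}) (Legendre_Q \<nu> \<mu>) = ?e * ?h * (K * (1 - (of_real y)\<^sup>2) powr (\<mu> / 2) * Tp (of_real y))"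
      by (intro Lim_within_holomorphic[where S = D1 and g = "\<lambda>z. ?e * ?h * (K * (1 - z\<^sup>2) powr (\<mu> / 2) * Tp z)"] 
            holomorphic_on_mult holomorphic_on_const D1p T open_D1 y islimpt_halfplane) auto
    have "Legendre_Q \<nu> \<mu> z = ?e * inverse ?h * (K * (1 - z\<^sup>2) powr (\<mu> / 2) * Tm z)" if "Im z < 0" for z
      using powr_square_minus_one_lower[OF that, of "\<mu> / 2"] T(4)[OF that] by (simp add: L exp_minus mult_ac)
    then have 2: "Lim (at (of_real y) within {z. Im z < 0}) (Legendre_Q \<nu> \<mu>) = ?e * inverse ?h * (K * (1 - (of_real y)\<^sup>2) powr (\<mu> / 2) * Tm (of_real y))"
      by (intro Lim_within_holomorphic[where S = D1 and g = "\<lambda>z. ?e * inverse ?h * (K * (1 - z\<^sup>2) powr (\<mu> / 2) * Tm z)"] 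
            holomorphic_on_mult holomorphic_on_const D1p T open_D1 y islimpt_halfplane) auto
    have "Ferrers_Q_real \<nu> \<mu> y = 1 / 2 * (inverse ?h * inverse ?e * (?e * ?h * (K * (1 - (of_real y)\<^sup>2) powr (\<mu> / 2) * Tp (of_real y)))
       + ?h * inverse ?e * (?e * inverse ?h * (K * (1 - (of_real y)\<^sup>2) powr (\<mu> / 2) * Tm (of_real y))))"
      unfolding Ferrers_Q_real_def 1 2 by (simp add: exp_minus)
    also have "\<dots> = f (of_real y)" by (simp add: f_def field_simps)
    finally show ?thesis .
  qed
  have xD: "x \<in> D1" "Re x > 0" using assms(1) by (auto simp: D1_plus_def)
  have xz: "x \<noteq> 0" "1 - x\<^sup>2 \<noteq> 0" using xD(2) D1_one_minus_square[OF xD(1)] by auto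
  have arg: "1 - 1 / x\<^sup>2 = (x\<^sup>2 - 1) / x\<^sup>2" using xz by (simp add: field_simps)
  \<comment> \<open>The hypothesis on \<open>\<nu> + \<mu>\<close> keeps this Gamma value away from
    its poles, so it cancels in the first coefficient.\<close>
  have G: "Gamma (\<nu> + \<mu> + 1) * rGamma (\<nu> + \<mu> + 1) = 1"
  proof -
    have "\<nu> + \<mu> + 1 \<notin> \<int>\<^sub>\<le>\<^sub>0"
    proof
      assume "\<nu> + \<mu> + 1 \<in> \<int>\<^sub>\<le>\<^sub>0"
      then obtain n :: nat where "\<nu> + \<mu> + 1 = - of_nat n" by (auto elim: nonpos_Ints_cases')
      then have "\<nu> + \<mu> = - of_nat (Suc n)" by (simp add: algebra_simps eq_neg_iff_add_eq_0)
      with assms(3) show False by (metis Suc_le_eq One_nat_def zero_less_Suc)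
    qed
    then show ?thesis by (simp add: Gamma_def rGamma_eq_zero_iff)
  qed
  have d1: "K * (rGamma \<alpha> * rGamma \<beta>) = 2 powr (\<mu> - 1)"
  proof -
    have "rGamma \<alpha> * rGamma \<beta> = rGamma (\<nu> + \<mu> + 1) * 2 powr (\<nu> + \<mu>) / of_real (sqrt pi)"
    proof -
      have "2 * \<alpha> = \<nu> + \<mu> + 1" by (simp add: \<alpha>_def)
      then show ?thesis using rGamma_legendre_duplication[of \<alpha>] by (simp add: \<beta>_def)
    qed
    then have "K * (rGamma \<alpha> * rGamma \<beta>) = (Gamma (\<nu> + \<mu> + 1) * rGamma (\<nu> + \<mu> + 1)) * (2 powr (\<nu> + \<mu>) / 2 powr (\<nu> + 1))"
      by (simp add: K_def)
    also have "2 powr (\<nu> + \<mu>) / 2 powr (\<nu> + 1) = (2 :: complex) powr (\<nu> + \<mu> - (\<nu> + 1))" by (simp only: powr_diff)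
    also have "\<nu> + \<mu> - (\<nu> + 1) = \<mu> - 1" by simp
    finally show ?thesis unfolding G by simp
  qed
  \<comment> \<open>Duplication at \<open>c - \<beta>\<close>, whose double is
    \<open>\<nu> - \<mu> + 1\<close>; at \<open>\<alpha>\<close> the double was
    \<open>\<nu> + \<mu> + 1\<close>.\<close>
  have d2: "K * (rGamma (c - \<alpha>) * rGamma (c - \<beta>)) = Gamma (\<nu> + \<mu> + 1) * rGamma (\<nu> - \<mu> + 1) / 2 powr (\<mu> + 1)"
  proof -
    have *: "c - \<alpha> = (c - \<beta>) + 1 / 2" "2 * (c - \<beta>) = \<nu> - \<mu> + 1" "2 * (c - \<beta>) - 1 = \<nu> - \<mu>"
      by (simp_all add: \<beta>_def \<alpha>_def c_def field_simps)
    have "rGamma (c - \<alpha>) * rGamma (c - \<beta>) = rGamma (\<nu> - \<mu> + 1) * 2 powr (\<nu> - \<mu>) / of_real (sqrt pi)"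
      using rGamma_legendre_duplication[of "c - \<beta>"] unfolding *(2,3) *(1)[symmetric] by (simp add: mult.commute)
    then have "K * (rGamma (c - \<alpha>) * rGamma (c - \<beta>)) = Gamma (\<nu> + \<mu> + 1) * rGamma (\<nu> - \<mu> + 1) * (2 powr (\<nu> - \<mu>) / 2 powr (\<nu> + 1))"
      by (simp add: K_def)
    also have "2 powr (\<nu> - \<mu>) / 2 powr (\<nu> + 1) = (2 :: complex) powr (\<nu> - \<mu> - (\<nu> + 1))" by (simp only: powr_diff)
    also have "\<nu> - \<mu> - (\<nu> + 1) = - (\<mu> + 1)" by simp
    finally show ?thesis by (simp only: powr_minus divide_inverse)
  qed
  have p1: "(1 - x\<^sup>2) powr (\<mu> / 2) * (1 - x\<^sup>2) powr (- \<mu>) = inverse ((1 - x\<^sup>2) powr (\<mu> / 2))"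
  proof -
    have "(1 - x\<^sup>2) powr (\<mu> / 2) * (1 - x\<^sup>2) powr (- \<mu>) = (1 - x\<^sup>2) powr (\<mu> / 2 + - \<mu>)" by (simp only: powr_add)
    also have "\<mu> / 2 + - \<mu> = - (\<mu> / 2)" by simp
    finally show ?thesis by (simp only: powr_minus)
  qed
  have ex: "2 * c - 2 * \<alpha> - 2 = \<nu> - \<mu>" by (simp add: c_def \<alpha>_def field_simps)
  have p2: "x powr (\<nu> - \<mu>) * x powr (2 * \<mu>) = x powr (\<nu> + \<mu>)"
  proof -
    have "x powr (\<nu> - \<mu>) * x powr (2 * \<mu>) = x powr (\<nu> - \<mu> + 2 * \<mu>)" by (simp only: powr_add)
    also have "\<nu> - \<mu> + 2 * \<mu> = \<nu> + \<mu>" by simp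
    finally show ?thesis .
  qed
  have regroup: "k * W * (X * (g * r * s * y + C * h * t * u * V * Y * z))
      = (k * (t * u)) * C * h * (W * V) * (X * Y) * z + (k * (r * s)) * g * W * X * y"
    for k W X g r s y C h t u V Y z :: complex
    by (simp add: algebra_simps)
  have "Ferrers_Q \<nu> \<mu> x = f x"
    using F by (intro Ferrers_Q_eqI fhol xD) auto
  also have "f x = (K * (rGamma \<alpha> * rGamma \<beta>)) * cos (of_real pi * \<mu>) * Gamma \<mu> * ((1 - x\<^sup>2) powr (\<mu> / 2) * (1 - x\<^sup>2) powr (- \<mu>))
        * (x powr (\<nu> - \<mu>) * x powr (2 * \<mu>)) * F2 (1 - 1 / x\<^sup>2)
     + (K * (rGamma (c - \<alpha>) * rGamma (c - \<beta>))) * Gamma (- \<mu>) * (1 - x\<^sup>2) powr (\<mu> / 2) * x powr (\<nu> - \<mu>) * F1 (1 - 1 / x\<^sup>2)"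
    unfolding f_def T(5)[OF assms(1)] ex by (rule regroup)
  finally show ?thesis
    unfolding d1 d2 p1 p2 arg F1_def F2_def by (simp only: divide_inverse mult_ac)
qed

end
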